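(* Let $M$ be a Kerr manifold, equipped with a Kerr structure $(M=\mathcal S\times\mathbb R,\ \pi:\mathcal S\to N,\ (J,g_o),\ \mathcal H)$ and the corresponding canonical optical structure $\mathcal Q_o$. If $n=\dim M$ is greater than $4$, then there is no $\mathcal Q_o$-compatible Lorentzian metric $g$ satisfying the following two conditions: (a) it has the form $$g=\sigma\,\check\pi^*g_o+\vartheta\vee\left(\mathsf p_o^*+\frac{\widetilde\beta}{2}\vartheta\right),\qquad \check\pi=\pi\circ\pi^{\mathcal S}:M\to N,$$ for some $\sigma,\widetilde\beta:M\to\mathbb R$, where $\sigma$ is nowhere vanishing and such that $\mathbf T(\sigma)=\mathbf T(\widetilde\beta)=0$ for the vector field $\mathbf T=\mathsf q_o-B\mathsf p_o$ with a constant $B\ne0$; (b) its Ricci curvature satisfies $\mathrm{Ric}(\mathsf p_o,X)=0$ for any vector field $X$ in $\mathcal W_o$. In particular, if $\dim M>4$, then there is no Einstein metric with the properties in (a).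
   Context: Conventions. For $1$-forms $\alpha,\beta$: $\alpha\vee\beta=\frac12(\alpha\otimes\beta+\beta\otimes\alpha)$. For a Kähler manifold $(N,J,g_o)$ the Kähler form is $\omega_o=g_o(J\cdot,\cdot)$. Lorentzian metrics may have mostly plus or mostly minus signature. Einstein means $\mathrm{Ric}=\Lambda g$ for a constant $\Lambda$. Functions are smooth. Kerr manifold. It is a manifold $M=\mathcal S\times\mathbb R$ where $\pi:\mathcal S\to N$ is a principal $\mathbb R$-bundle over a Kähler manifold $(N,J,g_o)$, endowed with a connection $\mathcal H=\ker\theta\subset T\mathcal S$, where $\theta$ is an $\mathbb R$-invariant connection $1$-form with $d\theta=\pi^*\omega_o$. Here $\dim M=\dim_{\mathbb R}N+2$. Any connected open subset $\mathcal S\times I$, $I\subset\mathbb R$, of such a manifold is also called a Kerr manifold. Let $\pi^{\mathcal S}:M\to\mathcal S$ be the projection, $\mathsf p_o=\partial/\partial u$ the coordinate vector field of the second factor $\mathbb R$, and $\mathsf q_o$ the vector field on $M$ corresponding to the fundamental vertical vector field of $\mathcal S$ (generator of the right $\mathbb R$-action), so that $TM=\mathcal H\oplus\mathbb R\mathsf p_o\oplus\mathbb R\mathsf q_o$ ($\mathcal H$ being regarded as a distribution on $M$ through $M=\mathcal S\times\mathbb R$). Let $\vartheta=(\pi^{\mathcal S})^*\theta$ (so $\vartheta(\mathsf q_o)=1$, $\vartheta|_{\mathcal H+\mathbb R\mathsf p_o}=0$) and let $\mathsf p_o^*$ be the $1$-form with $\mathsf p_o^*(\mathsf p_o)=1$,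 $\mathsf p_o^*|_{\mathcal H+\mathbb R\mathsf q_o}=0$. Canonical optical structure. Set $\mathcal W_o=\mathcal H+\mathbb R\mathsf p_o$ and $h_o=\check\pi^*g_o|_{\mathcal W_o\times\mathcal W_o}$. A Lorentzian metric $g$ on $M$ is called $\mathcal Q_o$-compatible if $g|_{\mathcal W_o\times\mathcal W_o}=\sigma h_o$ for a smooth function $\sigma$ that is everywhere positive or everywhere negative. *)

theory Defs
  imports "HOL-Analysis.Analysis"
begin

section \<open>Smooth functions between Euclidean spaces\<close>

abbreviation dird :: "('e::euclidean_space \<Rightarrow> 'f::euclidean_space) \<Rightarrow> 'e \<Rightarrow> 'e \<Rightarrow> 'f" where
  "dird f x v \<equiv> frechet_derivative f (at x) v"

text \<open>To be used for open sets only: the derivatives are taken in the ambient space.\<close>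

primrec Ck_on :: "nat \<Rightarrow> 'e::euclidean_space set \<Rightarrow> ('e \<Rightarrow> 'f::euclidean_space) \<Rightarrow> bool" where
  "Ck_on 0 S f \<longleftrightarrow> continuous_on S f"
| "Ck_on (Suc k) S f \<longleftrightarrow>
     (\<forall>x\<in>S. f differentiable (at x)) \<and> (\<forall>v. Ck_on k S (\<lambda>x. dird f x v))"

definition smooth_on :: "'e::euclidean_space set \<Rightarrow> ('e \<Rightarrow> 'f::euclidean_space) \<Rightarrow> bool" where
  "smooth_on S f \<longleftrightarrow> (\<forall>k. Ck_on k S f)"

section \<open>Smooth manifolds\<close>

text \<open>
  A chart is a pair \<open>(U, f)\<close> of an open set and a homeomorphism of \<open>U\<close> onto an open subset of the
  model space (the values of \<open>f\<close> outside \<open>U\<close> are irrelevant).  A smooth manifold is given by its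
  maximal atlas.  Its underlying set is the open set covered by the charts; the Hausdorff
  property and second countability come from the type classes of the point type.
\<close>

type_synonym ('a, 'e) chart = "'a set \<times> ('a \<Rightarrow> 'e)"

abbreviation cdom :: "('a, 'e) chart \<Rightarrow> 'a set" where "cdom c \<equiv> fst c"
abbreviation cmap :: "('a, 'e) chart \<Rightarrow> 'a \<Rightarrow> 'e" where "cmap c \<equiv> snd c"
abbreviation cran :: "('a, 'e) chart \<Rightarrow> 'e set" where "cran c \<equiv> cmap c ` cdom c"
abbreviation cinv :: "('a, 'e) chart \<Rightarrow> 'e \<Rightarrow> 'a" where "cinv c \<equiv> inv_into (cdom c) (cmap c)"

definition is_chart :: "('a::topological_space, 'e::euclidean_space) chart \<Rightarrow> bool" where
  "is_chart c \<longleftrightarrow> open (cdom c) \<and> open (cran c) \<and> homeomorphism (cdom c) (cran c) (cmap c) (cinv c)"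

definition smooth_change ::
  "('a::topological_space, 'e::euclidean_space) chart \<Rightarrow> ('a, 'e) chart \<Rightarrow> bool" where
  "smooth_change c d \<longleftrightarrow> smooth_on (cmap c ` (cdom c \<inter> cdom d)) (cmap d \<circ> cinv c)"

definition atlas :: "('a::topological_space, 'e::euclidean_space) chart set \<Rightarrow> bool" where
  "atlas A \<longleftrightarrow> (\<forall>c\<in>A. is_chart c) \<and> (\<forall>c\<in>A. \<forall>d\<in>A. smooth_change c d)"

definition carrier :: "('a, 'e) chart set \<Rightarrow> 'a set" where
  "carrier A = (\<Union>c\<in>A. cdom c)"

definition max_atlas ::
  "('a::topological_space, 'e::euclidean_space) chart set \<Rightarrow> ('a, 'e) chart set" where
  "max_atlas A = {c. is_chart c \<and> cdom c \<subseteq> carrier A \<and> (\<forall>d\<in>A. smooth_change c d \<and> smooth_change d c)}"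

definition smooth_manifold ::
  "('a::{t2_space,second_countable_topology}, 'e::euclidean_space) chart set \<Rightarrow> bool" where
  "smooth_manifold A \<longleftrightarrow> atlas A \<and> max_atlas A = A \<and> carrier A \<noteq> {}"

definition smooth_fun ::
  "('a::topological_space, 'e::euclidean_space) chart set \<Rightarrow> ('a \<Rightarrow> real) \<Rightarrow> bool" where
  "smooth_fun A \<phi> \<longleftrightarrow> (\<forall>c\<in>A. smooth_on (cran c) (\<phi> \<circ> cinv c))"

text \<open>Smoothness in a neighbourhood of a point; the atlas \<open>A\<close> is assumed to be maximal.\<close>

definition smooth_near ::
  "('a::topological_space, 'e::euclidean_space) chart set \<Rightarrow> 'a \<Rightarrow> ('a \<Rightarrow> real) \<Rightarrow> bool" where
  "smooth_near A p \<phi> \<longleftrightarrow> (\<exists>c\<in>A. p \<in> cdom c \<and> smooth_on (cran c) (\<phi> \<circ> cinv c))"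

section \<open>Tangent vectors\<close>

text \<open>
  A tangent vector at \<open>p\<close> is a derivation of the germs at \<open>p\<close> of smooth functions.  As an operator on
  all functions it is extended by \<open>0\<close> to the functions that are not smooth near \<open>p\<close>.
  In particular, the derivative of \<open>\<phi>\<close> along \<open>X\<close> is \<open>X \<phi>\<close>, and vectors are added pointwise.
  \<open>coord_vec A c p v\<close> is the vector whose components in the chart \<open>c\<close> are \<open>v\<close>.
\<close>

type_synonym 'a tvec = "('a \<Rightarrow> real) \<Rightarrow> real"

definition coord_vec ::
  "('a::topological_space, 'e::euclidean_space) chart set \<Rightarrow> ('a, 'e) chart \<Rightarrow> 'a \<Rightarrow> 'e \<Rightarrow> 'a tvec" where
  "coord_vec A c p v =
     (\<lambda>\<phi>. if smooth_near A p \<phi> then dird (\<phi> \<circ> cinv c) (cmap c p) v else 0)"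

definition tangent_space ::
  "('a::topological_space, 'e::euclidean_space) chart set \<Rightarrow> 'a \<Rightarrow> 'a tvec set" where
  "tangent_space A p = {coord_vec A c p v | c v. c \<in> A \<and> p \<in> cdom c}"

definition components ::
  "('a::topological_space, 'e::euclidean_space) chart set \<Rightarrow> ('a, 'e) chart \<Rightarrow> 'a \<Rightarrow> 'a tvec \<Rightarrow> 'e" where
  "components A c p X = (THE v. X = coord_vec A c p v)"

definition velocity ::
  "('a::topological_space, 'e::euclidean_space) chart set \<Rightarrow> (real \<Rightarrow> 'a) \<Rightarrow> real \<Rightarrow> 'a tvec" where
  "velocity A \<gamma> t = (\<lambda>\<phi>. if smooth_near A (\<gamma> t) \<phi> then deriv (\<phi> \<circ> \<gamma>) t else 0)"

text \<open>The differential at \<open>p\<close> of a smooth map \<open>f\<close> into the manifold with atlas \<open>B\<close>.\<close>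

definition push ::
  "('b::topological_space, 'f::euclidean_space) chart set \<Rightarrow> ('a \<Rightarrow> 'b) \<Rightarrow> 'a \<Rightarrow> 'a tvec \<Rightarrow> 'b tvec" where
  "push B f p X = (\<lambda>\<phi>. if smooth_near B (f p) \<phi> then X (\<phi> \<circ> f) else 0)"

section \<open>Tensor fields\<close>

definition comp1 ::
  "('a::topological_space, 'e::euclidean_space) chart set \<Rightarrow> ('a, 'e) chart \<Rightarrow>
   ('a \<Rightarrow> 'a tvec \<Rightarrow> real) \<Rightarrow> 'e \<Rightarrow> 'e \<Rightarrow> real" where
  "comp1 A c \<alpha> x v = \<alpha> (cinv c x) (coord_vec A c (cinv c x) v)"

definition comp2 ::
  "('a::topological_space, 'e::euclidean_space) chart set \<Rightarrow> ('a, 'e) chart \<Rightarrow>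
   ('a \<Rightarrow> 'a tvec \<Rightarrow> 'a tvec \<Rightarrow> real) \<Rightarrow> 'e \<Rightarrow> 'e \<Rightarrow> 'e \<Rightarrow> real" where
  "comp2 A c g x v w = g (cinv c x) (coord_vec A c (cinv c x) v) (coord_vec A c (cinv c x) w)"

definition one_form ::
  "('a::topological_space, 'e::euclidean_space) chart set \<Rightarrow> ('a \<Rightarrow> 'a tvec \<Rightarrow> real) \<Rightarrow> bool" where
  "one_form A \<alpha> \<longleftrightarrow>
     (\<forall>c\<in>A. (\<forall>x\<in>cran c. linear (comp1 A c \<alpha> x)) \<and>
            (\<forall>v. smooth_on (cran c) (\<lambda>x. comp1 A c \<alpha> x v)))"

definition symmetric_tensor ::
  "('a::topological_space, 'e::euclidean_space) chart set \<Rightarrow>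
   ('a \<Rightarrow> 'a tvec \<Rightarrow> 'a tvec \<Rightarrow> real) \<Rightarrow> bool" where
  "symmetric_tensor A g \<longleftrightarrow>
     (\<forall>c\<in>A. (\<forall>x\<in>cran c. bilinear (comp2 A c g x) \<and>
                        (\<forall>v w. comp2 A c g x v w = comp2 A c g x w v)) \<and>
            (\<forall>v w. smooth_on (cran c) (\<lambda>x. comp2 A c g x v w)))"

definition riemannian_metric ::
  "('a::topological_space, 'e::euclidean_space) chart set \<Rightarrow>
   ('a \<Rightarrow> 'a tvec \<Rightarrow> 'a tvec \<Rightarrow> real) \<Rightarrow> bool" where
  "riemannian_metric A g \<longleftrightarrow>
     symmetric_tensor A g \<and>
     (\<forall>c\<in>A. \<forall>x\<in>cran c. \<forall>v. v \<noteq> 0 \<longrightarrow> 0 < comp2 A c g x v v)"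

text \<open>
  Signature \<open>(n - 1, 1)\<close> for \<open>\<epsilon> = 1\<close> and \<open>(1, n - 1)\<close> for \<open>\<epsilon> = -1\<close>: in the frame \<open>L b\<close>, where \<open>b\<close> ranges
  over the standard basis, the matrix of \<open>G\<close> is diagonal with entry \<open>-\<epsilon>\<close> at \<open>e\<close> and \<open>\<epsilon>\<close> elsewhere.
\<close>

definition lorentzian_form :: "('e::euclidean_space \<Rightarrow> 'e \<Rightarrow> real) \<Rightarrow> bool" where
  "lorentzian_form G \<longleftrightarrow>
     (\<exists>\<epsilon>\<in>{1, -1}. \<exists>e\<in>Basis. \<exists>L :: 'e \<Rightarrow> 'e. linear L \<and> bij L \<and>
        (\<forall>v w. G (L v) (L w) = \<epsilon> * (v \<bullet> w - 2 * (v \<bullet> e) * (w \<bullet> e))))"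

definition lorentzian_metric ::
  "('a::topological_space, 'e::euclidean_space) chart set \<Rightarrow>
   ('a \<Rightarrow> 'a tvec \<Rightarrow> 'a tvec \<Rightarrow> real) \<Rightarrow> bool" where
  "lorentzian_metric A g \<longleftrightarrow>
     symmetric_tensor A g \<and> (\<forall>c\<in>A. \<forall>x\<in>cran c. lorentzian_form (comp2 A c g x))"

definition sym_prod ::
  "('a \<Rightarrow> 'a tvec \<Rightarrow> real) \<Rightarrow> ('a \<Rightarrow> 'a tvec \<Rightarrow> real) \<Rightarrow> 'a \<Rightarrow> 'a tvec \<Rightarrow> 'a tvec \<Rightarrow> real"
  (infixl "\<or>\<^sub>s" 70) where
  "(\<alpha> \<or>\<^sub>s \<beta>) p X Y = (1/2) * (\<alpha> p X * \<beta> p Y + \<beta> p X * \<alpha> p Y)"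

text \<open>
  Exterior derivatives of 1-forms and 2-forms and the Ricci tensor are given by their components
  in a chart \<open>c\<close>; being tensorial, equations between them are imposed in all charts of the
  maximal atlas.  Convention: \<open>d\<alpha>(X, Y) = X(\<alpha>(Y)) - Y(\<alpha>(X)) - \<alpha>([X, Y])\<close>; the fields of
  vectors with constant components commute.
\<close>

definition d1 ::
  "('a::topological_space, 'e::euclidean_space) chart set \<Rightarrow> ('a, 'e) chart \<Rightarrow>
   ('a \<Rightarrow> 'a tvec \<Rightarrow> real) \<Rightarrow> 'e \<Rightarrow> 'e \<Rightarrow> 'e \<Rightarrow> real" where
  "d1 A c \<alpha> x v w = dird (\<lambda>y. comp1 A c \<alpha> y w) x v - dird (\<lambda>y. comp1 A c \<alpha> y v) x w"

definition d2 ::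
  "('a::topological_space, 'e::euclidean_space) chart set \<Rightarrow> ('a, 'e) chart \<Rightarrow>
   ('a \<Rightarrow> 'a tvec \<Rightarrow> 'a tvec \<Rightarrow> real) \<Rightarrow> 'e \<Rightarrow> 'e \<Rightarrow> 'e \<Rightarrow> 'e \<Rightarrow> real" where
  "d2 A c \<omega> x u v w =
     dird (\<lambda>y. comp2 A c \<omega> y v w) x u - dird (\<lambda>y. comp2 A c \<omega> y u w) x v
     + dird (\<lambda>y. comp2 A c \<omega> y u v) x w"

section \<open>Ricci curvature\<close>

text \<open>
  \<open>G\<close> is the component function of a pseudo-Riemannian metric on an open set of a Euclidean space.
  \<open>christoffel G x v w\<close> is the value at \<open>x\<close> of the Levi-Civita derivative along \<open>v\<close> of the constant
  field \<open>w\<close>, and \<open>riemann G x u v w\<close> is \<open>R(u, v) w\<close> for \<open>R(u, v) = [\<nabla> u, \<nabla> v] - \<nabla> [u, v]\<close>.  The Ricci tensor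
  is \<open>Ric(v, w) = trace (u \<mapsto> R(u, v) w)\<close>.
\<close>

definition christoffel :: "('e::euclidean_space \<Rightarrow> 'e \<Rightarrow> 'e \<Rightarrow> real) \<Rightarrow> 'e \<Rightarrow> 'e \<Rightarrow> 'e \<Rightarrow> 'e" where
  "christoffel G x v w =
     (THE z. \<forall>y. G x z y =
        (1/2) * (dird (\<lambda>x. G x w y) x v + dird (\<lambda>x. G x v y) x w - dird (\<lambda>x. G x v w) x y))"

definition riemann :: "('e::euclidean_space \<Rightarrow> 'e \<Rightarrow> 'e \<Rightarrow> real) \<Rightarrow> 'e \<Rightarrow> 'e \<Rightarrow> 'e \<Rightarrow> 'e \<Rightarrow> 'e" where
  "riemann G x u v w =
     dird (\<lambda>x. christoffel G x v w) x u - dird (\<lambda>x. christoffel G x u w) x v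
     + christoffel G x u (christoffel G x v w) - christoffel G x v (christoffel G x u w)"

definition ricci_comp :: "('e::euclidean_space \<Rightarrow> 'e \<Rightarrow> 'e \<Rightarrow> real) \<Rightarrow> 'e \<Rightarrow> 'e \<Rightarrow> 'e \<Rightarrow> real" where
  "ricci_comp G x v w = (\<Sum>e\<in>Basis. riemann G x e v w \<bullet> e)"

definition ricci ::
  "('a::topological_space, 'e::euclidean_space) chart set \<Rightarrow> ('a, 'e) chart \<Rightarrow>
   ('a \<Rightarrow> 'a tvec \<Rightarrow> 'a tvec \<Rightarrow> real) \<Rightarrow> 'a \<Rightarrow> 'a tvec \<Rightarrow> 'a tvec \<Rightarrow> real" where
  "ricci A c g p X Y =
     ricci_comp (comp2 A c g) (cmap c p) (components A c p X) (components A c p Y)"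

definition einstein ::
  "('a::topological_space, 'e::euclidean_space) chart set \<Rightarrow>
   ('a \<Rightarrow> 'a tvec \<Rightarrow> 'a tvec \<Rightarrow> real) \<Rightarrow> bool" where
  "einstein A g \<longleftrightarrow>
     (\<exists>\<Lambda>::real. \<forall>c\<in>A. \<forall>p\<in>cdom c. \<forall>X\<in>tangent_space A p. \<forall>Y\<in>tangent_space A p.
        ricci A c g p X Y = \<Lambda> * g p X Y)"

section \<open>Kaehler manifolds\<close>

text \<open>
  Integrability of \<open>J\<close> means that there are holomorphic coordinates near every point, i.e. a chart in
  which \<open>J\<close> is a constant complex structure \<open>j\<close> of the model space.  This contains the smoothness of
  \<open>J\<close> and \<open>J\<^sup>2 = -1\<close>.
\<close>

definition complex_structure ::
  "('a::topological_space, 'e::euclidean_space) chart set \<Rightarrow> ('a \<Rightarrow> 'a tvec \<Rightarrow> 'a tvec) \<Rightarrow> bool" where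
  "complex_structure A J \<longleftrightarrow>
     (\<forall>p\<in>carrier A. \<exists>c\<in>A. p \<in> cdom c \<and>
        (\<exists>j. linear j \<and> (\<forall>v. j (j v) = - v) \<and>
             (\<forall>q\<in>cdom c. \<forall>v. J q (coord_vec A c q v) = coord_vec A c q (j v))))"

definition kaehler_form ::
  "('a \<Rightarrow> 'a tvec \<Rightarrow> 'a tvec) \<Rightarrow> ('a \<Rightarrow> 'a tvec \<Rightarrow> 'a tvec \<Rightarrow> real) \<Rightarrow> 'a \<Rightarrow> 'a tvec \<Rightarrow> 'a tvec \<Rightarrow> real" where
  "kaehler_form J g p X Y = g p (J p X) Y"

definition kaehler_manifold ::
  "('a::{t2_space,second_countable_topology}, 'e::euclidean_space) chart set \<Rightarrow>
   ('a \<Rightarrow> 'a tvec \<Rightarrow> 'a tvec) \<Rightarrow> ('a \<Rightarrow> 'a tvec \<Rightarrow> 'a tvec \<Rightarrow> real) \<Rightarrow> bool" where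
  "kaehler_manifold A J g \<longleftrightarrow>
     smooth_manifold A \<and> complex_structure A J \<and> riemannian_metric A g \<and>
     (\<forall>p\<in>carrier A. \<forall>X\<in>tangent_space A p. \<forall>Y\<in>tangent_space A p. g p (J p X) (J p Y) = g p X Y) \<and>
     (\<forall>c\<in>A. \<forall>x\<in>cran c. \<forall>u v w. d2 A c (kaehler_form J g) x u v w = 0)"

section \<open>Kerr manifolds\<close>

text \<open>
  The data of a Kerr structure: the base \<open>N\<close> with \<open>J\<close> and \<open>g\<^sub>o\<close>; the total space \<open>\<S>\<close> with its
  projection, its right action of the reals and the connection form \<open>\<theta>\<close> (whose kernel is the
  connection \<open>\<H>\<close>); and the interval \<open>I\<close> with \<open>M = \<S> \<times> I\<close>.
\<close>

record ('n, 'e, 's) kerr =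
  base :: "('n, 'e) chart set"
  cplx :: "'n \<Rightarrow> 'n tvec \<Rightarrow> 'n tvec"
  base_metric :: "'n \<Rightarrow> 'n tvec \<Rightarrow> 'n tvec \<Rightarrow> real"
  total :: "('s, 'e \<times> real) chart set"
  proj :: "'s \<Rightarrow> 'n"
  act :: "'s \<Rightarrow> real \<Rightarrow> 's"
  conn :: "'s \<Rightarrow> 's tvec \<Rightarrow> real"
  factor :: "real set"

text \<open>
  Local triviality: over the domain of some chart \<open>c\<close> of \<open>N\<close> around any given point, there is an
  equivariant diffeomorphism \<open>s \<mapsto> (\<pi> s, \<tau> s)\<close> of the preimage onto \<open>cdom c \<times> \<real>\<close>; it is expressed by
  the fact that its composition with \<open>c \<times> id\<close> is a chart of \<open>\<S>\<close>.  Smoothness of the projection and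
  of the action, as well as freeness and simple transitivity on fibres, are consequences.
\<close>

definition principal_bundle ::
  "('n::{t2_space,second_countable_topology}, 'e::euclidean_space) chart set \<Rightarrow>
   ('s::{t2_space,second_countable_topology}, 'e \<times> real) chart set \<Rightarrow>
   ('s \<Rightarrow> 'n) \<Rightarrow> ('s \<Rightarrow> real \<Rightarrow> 's) \<Rightarrow> bool" where
  "principal_bundle N S \<pi> \<rho> \<longleftrightarrow>
     smooth_manifold N \<and> smooth_manifold S \<and> \<pi> ` carrier S = carrier N \<and>
     (\<forall>s\<in>carrier S. \<rho> s 0 = s \<and>
        (\<forall>a. \<rho> s a \<in> carrier S \<and> \<pi> (\<rho> s a) = \<pi> s) \<and>
        (\<forall>a b. \<rho> (\<rho> s a) b = \<rho> s (a + b))) \<and>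
     (\<forall>x\<in>carrier N. \<exists>c\<in>N. x \<in> cdom c \<and>
        (\<exists>\<tau>. let P = {s \<in> carrier S. \<pi> s \<in> cdom c}; \<Phi> = (\<lambda>s. (cmap c (\<pi> s), \<tau> s)) in
           (P, \<Phi>) \<in> S \<and> \<Phi> ` P = cran c \<times> UNIV \<and>
           (\<forall>s\<in>P. \<forall>a. \<tau> (\<rho> s a) = \<tau> s + a)))"

definition fundamental ::
  "('n, 'e::euclidean_space, 's::topological_space) kerr \<Rightarrow> 's \<Rightarrow> 's tvec" where
  "fundamental K s = velocity (total K) (\<lambda>t. act K s t) 0"

definition connection_form ::
  "('n::topological_space, 'e::euclidean_space, 's::topological_space) kerr \<Rightarrow> bool" where
  "connection_form K \<longleftrightarrow>
     one_form (total K) (conn K) \<and>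
     (\<forall>s\<in>carrier (total K). conn K s (fundamental K s) = 1) \<and>
     (\<forall>s\<in>carrier (total K). \<forall>a. \<forall>X\<in>tangent_space (total K) s.
        conn K (act K s a) (push (total K) (\<lambda>s. act K s a) s X) = conn K s X)"

text \<open>The curvature condition: \<open>d\<theta>\<close> is the pull-back of the Kaehler form.\<close>

definition curvature_condition ::
  "('n::topological_space, 'e::euclidean_space, 's::topological_space) kerr \<Rightarrow> bool" where
  "curvature_condition K \<longleftrightarrow>
     (\<forall>c\<in>total K. \<forall>s\<in>cdom c. \<forall>v w.
        d1 (total K) c (conn K) (cmap c s) v w =
        kaehler_form (cplx K) (base_metric K) (proj K s)
          (push (base K) (proj K) s (coord_vec (total K) c s v))
          (push (base K) (proj K) s (coord_vec (total K) c s w)))"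

definition kerr_manifold ::
  "('n::{t2_space,second_countable_topology}, 'e::euclidean_space,
    's::{t2_space,second_countable_topology}) kerr \<Rightarrow> bool" where
  "kerr_manifold K \<longleftrightarrow>
     kaehler_manifold (base K) (cplx K) (base_metric K) \<and>
     principal_bundle (base K) (total K) (proj K) (act K) \<and>
     connection_form K \<and> curvature_condition K \<and>
     open (factor K) \<and> factor K \<noteq> {} \<and>
     (factor K = UNIV \<or> connected (carrier (total K) \<times> factor K))"

text \<open>The product manifold \<open>M = \<S> \<times> I\<close>.\<close>

definition kerr_space ::
  "('n, 'e::euclidean_space, 's::topological_space) kerr \<Rightarrow> ('s \<times> real, ('e \<times> real) \<times> real) chart set" where
  "kerr_space K = max_atlas {(cdom c \<times> factor K, \<lambda>(s, u). (cmap c s, u)) | c. c \<in> total K}"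

definition p_o :: "('n, 'e::euclidean_space, 's::topological_space) kerr \<Rightarrow> 's \<times> real \<Rightarrow> ('s \<times> real) tvec" where
  "p_o K = (\<lambda>(s, u). velocity (kerr_space K) (\<lambda>t. (s, t)) u)"

definition q_o :: "('n, 'e::euclidean_space, 's::topological_space) kerr \<Rightarrow> 's \<times> real \<Rightarrow> ('s \<times> real) tvec" where
  "q_o K = (\<lambda>(s, u). push (kerr_space K) (\<lambda>s. (s, u)) s (fundamental K s))"

definition horizontal ::
  "('n, 'e::euclidean_space, 's::topological_space) kerr \<Rightarrow> 's \<times> real \<Rightarrow> ('s \<times> real) tvec set" where
  "horizontal K = (\<lambda>(s, u).
     push (kerr_space K) (\<lambda>s. (s, u)) s ` {X \<in> tangent_space (total K) s. conn K s X = 0})"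

definition W_o ::
  "('n, 'e::euclidean_space, 's::topological_space) kerr \<Rightarrow> 's \<times> real \<Rightarrow> ('s \<times> real) tvec set" where
  "W_o K m = {(\<lambda>\<phi>. Y \<phi> + b * p_o K m \<phi>) | Y b. Y \<in> horizontal K m}"

definition vartheta ::
  "('n, 'e::euclidean_space, 's::topological_space) kerr \<Rightarrow> 's \<times> real \<Rightarrow> ('s \<times> real) tvec \<Rightarrow> real" where
  "vartheta K m X = conn K (fst m) (push (total K) fst m X)"

text \<open>The 1-form dual to \<open>\<p>\<^sub>o\<close> with respect to \<open>TM = \<H> \<oplus> \<real>\<p>\<^sub>o \<oplus> \<real>\<q>\<^sub>o\<close>.\<close>

definition p_o_dual ::
  "('n, 'e::euclidean_space, 's::topological_space) kerr \<Rightarrow> 's \<times> real \<Rightarrow> ('s \<times> real) tvec \<Rightarrow> real" where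
  "p_o_dual K m X =
     (THE b. \<exists>Y\<in>horizontal K m. \<exists>a. X = (\<lambda>\<phi>. Y \<phi> + b * p_o K m \<phi> + a * q_o K m \<phi>))"

text \<open>The pull-back of \<open>g\<^sub>o\<close> to \<open>M\<close>; its restriction to \<open>W\<^sub>o\<close> is \<open>h\<^sub>o\<close>.\<close>

definition pullback_metric ::
  "('n::topological_space, 'e::euclidean_space, 's::topological_space) kerr \<Rightarrow>
   's \<times> real \<Rightarrow> ('s \<times> real) tvec \<Rightarrow> ('s \<times> real) tvec \<Rightarrow> real" where
  "pullback_metric K m X Y =
     base_metric K (proj K (fst m))
       (push (base K) (proj K \<circ> fst) m X) (push (base K) (proj K \<circ> fst) m Y)"

definition compatible_metric ::
  "('n::topological_space, 'e::euclidean_space, 's::topological_space) kerr \<Rightarrow>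
   ('s \<times> real \<Rightarrow> ('s \<times> real) tvec \<Rightarrow> ('s \<times> real) tvec \<Rightarrow> real) \<Rightarrow> bool" where
  "compatible_metric K g \<longleftrightarrow>
     lorentzian_metric (kerr_space K) g \<and>
     (\<exists>\<sigma>. smooth_fun (kerr_space K) \<sigma> \<and>
        ((\<forall>m\<in>carrier (kerr_space K). 0 < \<sigma> m) \<or> (\<forall>m\<in>carrier (kerr_space K). \<sigma> m < 0)) \<and>
        (\<forall>m\<in>carrier (kerr_space K). \<forall>X\<in>W_o K m. \<forall>Y\<in>W_o K m.
           g m X Y = \<sigma> m * pullback_metric K m X Y))"

definition special_form ::
  "('n::topological_space, 'e::euclidean_space, 's::topological_space) kerr \<Rightarrow>
   ('s \<times> real \<Rightarrow> ('s \<times> real) tvec \<Rightarrow> ('s \<times> real) tvec \<Rightarrow> real) \<Rightarrow> bool" where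
  "special_form K g \<longleftrightarrow>
     (\<exists>\<sigma> \<beta>. smooth_fun (kerr_space K) \<sigma> \<and> smooth_fun (kerr_space K) \<beta> \<and>
        (\<forall>m\<in>carrier (kerr_space K). \<sigma> m \<noteq> 0) \<and>
        (\<forall>m\<in>carrier (kerr_space K). \<forall>X\<in>tangent_space (kerr_space K) m. \<forall>Y\<in>tangent_space (kerr_space K) m.
           g m X Y = \<sigma> m * pullback_metric K m X Y
             + (vartheta K \<or>\<^sub>s (\<lambda>m X. p_o_dual K m X + \<beta> m / 2 * vartheta K m X)) m X Y) \<and>
        (\<exists>B::real. B \<noteq> 0 \<and>
           (let T = (\<lambda>m \<phi>. q_o K m \<phi> - B * p_o K m \<phi>) in
            \<forall>m\<in>carrier (kerr_space K). T m \<sigma> = 0 \<and> T m \<beta> = 0)))"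

definition ricci_condition ::
  "('n, 'e::euclidean_space, 's::topological_space) kerr \<Rightarrow>
   ('s \<times> real \<Rightarrow> ('s \<times> real) tvec \<Rightarrow> ('s \<times> real) tvec \<Rightarrow> real) \<Rightarrow> bool" where
  "ricci_condition K g \<longleftrightarrow>
     (\<forall>c\<in>kerr_space K. \<forall>m\<in>cdom c. \<forall>X\<in>W_o K m. ricci (kerr_space K) c g m (p_o K m) X = 0)"

end

theory Submission
  imports Defs
begin

text \<open>
  Over the domain of a chart of \<open>N\<close> that trivialises the bundle, \<open>M\<close> has coordinates
  \<open>((x, s), u)\<close> in which \<open>\<p>\<^sub>o = \<partial>\<^sub>u\<close>, \<open>\<q>\<^sub>o = \<partial>\<^sub>s\<close> and \<open>\<theta> = ds + A\<close> with \<open>dA = \<omega>\<^sub>o\<close>, and invariance under \<open>T\<close>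
  means \<open>\<partial>\<^sub>s \<sigma> = B \<partial>\<^sub>u \<sigma>\<close>.  Let \<open>d\<close> be the real dimension of \<open>N\<close>.  The field \<open>p = \<p>\<^sub>o\<close> is null, geodesic
  and shear-free: modulo \<open>p\<close>, its covariant derivative is the lift of \<open>a + b J\<close> on \<open>TN\<close>, where
  \<open>a = \<partial>\<^sub>u \<sigma> / (2 \<sigma>)\<close> is the expansion and \<open>b = 1 / (4 \<sigma>)\<close> the twist (\<open>christoffel_p\<close>).

  The formula for \<open>Ric(p, X)\<close> with \<open>X\<close> in \<open>W\<^sub>o\<close> (\<open>ricci_p\<close>) has two consequences.  For \<open>X = p\<close> it is the
  equation of Raychaudhuri and Sachs, \<open>\<partial>\<^sub>u a = b\<^sup>2 - a\<^sup>2\<close>.  As \<open>\<partial>\<^sub>u b = - 2 a b\<close> by definition, the complex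
  function \<open>z = a + i b\<close> satisfies \<open>\<partial>\<^sub>u z = - z\<^sup>2\<close>.  So \<open>1 / z = w - i f\<close> with \<open>\<partial>\<^sub>u w = 1\<close> and \<open>\<partial>\<^sub>u f = 0\<close>, and
  invariance gives \<open>\<partial>\<^sub>s w = B\<close> and \<open>\<partial>\<^sub>s f = 0\<close>.  Along a fibre of \<open>\<S>\<close>, \<open>f\<close> is therefore constant whereas \<open>w\<close>
  takes every real value.  For \<open>X\<close> the horizontal lift of \<open>v\<close>, denoted by \<open>v\<^sup>h\<close>, one obtains
  \<open>(1 - d) v\<^sup>h(a) + (2 - d/2) (J v)\<^sup>h(b) + b E(v) = 0\<close> for some \<open>E\<close> that comes from the base.  Expressed by \<open>w\<close> and \<open>f\<close>
  and cleared of denominators, this is an identity between polynomials in \<open>w\<close> whose coefficients are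
  constant along the fibre.  Comparing coefficients gives (\<open>polynomial_identity\<close>)
  \<open>(1 - d) v\<^sup>h(w) = (2 - d/2) (J v)(f)\<close> and \<open>(1 - d) v(f) = - (2 - d/2) (J v)\<^sup>h(w)\<close>.

  For \<open>d = 2\<close> these are Cauchy-Riemann equations, which is how the Kerr metrics arise.  But the
  determinant \<open>(d - 1)\<^sup>2 - (2 - d/2)\<^sup>2 = 3/4 (d\<^sup>2 - 4)\<close> is nonzero for \<open>d > 2\<close>, and then \<open>v\<^sup>h(w) = 0\<close> for all \<open>v\<close>.  With
  \<open>w = w\<^sub>0 + B s\<close> this says \<open>dw\<^sub>0 = B A\<close>, so \<open>A\<close> is closed, in contradiction to \<open>dA = \<omega>\<^sub>o\<close>
  (\<open>no_ricci_condition\<close>).  An Einstein metric satisfies the curvature condition because \<open>\<p>\<^sub>o\<close> is orthogonal to \<open>W\<^sub>o\<close>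
  (\<open>einstein_imp_ricci_condition\<close>).

  Ricci curvature is computed from traces of Christoffel symbols.  Traces are taken in the frame made of the
  horizontal lifts, \<open>q\<close> and \<open>p\<close> (\<open>lin_trace_frame\<close>), which reduces them to traces on \<open>TN\<close>.
\<close>

section \<open>Traces and nondegenerate bilinear forms\<close>

definition lin_trace :: "('a::euclidean_space \<Rightarrow> 'a) \<Rightarrow> real" where
  "lin_trace T = (\<Sum>e\<in>Basis. T e \<bullet> e)"

lemma lin_trace_add: "lin_trace (\<lambda>v. S v + T v) = lin_trace S + lin_trace T"
  by (simp add: lin_trace_def inner_add_left sum.distrib)

lemma lin_trace_diff: "lin_trace (\<lambda>v. S v - T v) = lin_trace S - lin_trace T"
  by (simp add: lin_trace_def inner_diff_left sum_subtractf)

lemma lin_trace_scaleR: "lin_trace (\<lambda>v. c *\<^sub>R S v) = c * lin_trace S"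
  by (simp add: lin_trace_def sum_distrib_left)

lemma lin_trace_minus: "lin_trace (\<lambda>v. - S v) = - lin_trace S"
  by (simp add: lin_trace_def sum_negf)

lemma lin_trace_id: "lin_trace (\<lambda>v::'a::euclidean_space. v) = DIM('a)"
  by (simp add: lin_trace_def)

lemma lin_trace_rank_one:
  fixes \<phi> :: "'a::euclidean_space \<Rightarrow> real"
  assumes "linear \<phi>"
  shows "lin_trace (\<lambda>v. \<phi> v *\<^sub>R z) = \<phi> z"
proof -
  have "\<phi> z = \<phi> (\<Sum>e\<in>Basis. (z \<bullet> e) *\<^sub>R e)"
    by (simp add: euclidean_representation)
  also have "\<dots> = (\<Sum>e\<in>Basis. (z \<bullet> e) * \<phi> e)"
    by (simp add: linear_sum[OF assms] linear_scale[OF assms])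
  finally show ?thesis
    by (simp add: lin_trace_def mult.commute)
qed

lemma lin_trace_commute:
  fixes S :: "'a::euclidean_space \<Rightarrow> 'b::euclidean_space" and T :: "'b \<Rightarrow> 'a"
  assumes S: "linear S" and T: "linear T"
  shows "lin_trace (\<lambda>v. S (T v)) = lin_trace (\<lambda>v. T (S v))"
proof -
  have expand: "P (Q e) \<bullet> e = (\<Sum>b\<in>Basis. (Q e \<bullet> b) * (P b \<bullet> e))"
    if "linear P" for P :: "'c::euclidean_space \<Rightarrow> 'd::euclidean_space" and Q :: "'d \<Rightarrow> 'c" and e
  proof -
    have "P (Q e) = P (\<Sum>b\<in>Basis. (Q e \<bullet> b) *\<^sub>R b)"
      by (simp add: euclidean_representation)
    also have "\<dots> = (\<Sum>b\<in>Basis. (Q e \<bullet> b) *\<^sub>R P b)"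
      by (simp add: linear_sum[OF that] linear_scale[OF that])
    finally show ?thesis
      by (simp add: inner_sum_left)
  qed
  have "lin_trace (\<lambda>v. S (T v)) = (\<Sum>e\<in>Basis. \<Sum>b\<in>Basis. (T e \<bullet> b) * (S b \<bullet> e))"
    by (simp add: lin_trace_def expand[OF S])
  also have "\<dots> = (\<Sum>b\<in>Basis. \<Sum>e\<in>Basis. (S b \<bullet> e) * (T e \<bullet> b))"
    by (subst sum.swap) (simp add: mult.commute)
  also have "\<dots> = lin_trace (\<lambda>v. T (S v))"
    by (simp add: lin_trace_def expand[OF T])
  finally show ?thesis .
qed

lemma lin_trace_prod:
  fixes T :: "('a::euclidean_space \<times> 'b::euclidean_space) \<Rightarrow> 'a \<times> 'b"
  shows "lin_trace T = lin_trace (\<lambda>v. fst (T (v, 0))) + lin_trace (\<lambda>v. snd (T (0, v)))"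
  unfolding lin_trace_def Basis_prod_def
  by (subst sum.union_disjoint)
     (auto simp: sum.reindex inj_on_def inner_prod_def)

lemma lin_trace_real: "lin_trace (T :: real \<Rightarrow> real) = T 1"
  by (simp add: lin_trace_def)

definition nondegenerate :: "('a::euclidean_space \<Rightarrow> 'a \<Rightarrow> real) \<Rightarrow> bool" where
  "nondegenerate G \<longleftrightarrow> (\<forall>z. (\<forall>y. G z y = 0) \<longrightarrow> z = 0)"

text \<open>
  The lowering of an index by \<open>G\<close>, followed by the identification of the dual space with the space itself
  through the inner product.
\<close>

definition flat_map :: "('a::euclidean_space \<Rightarrow> 'a \<Rightarrow> real) \<Rightarrow> 'a \<Rightarrow> 'a" where
  "flat_map G v = (\<Sum>b\<in>Basis. G v b *\<^sub>R b)"

lemma inner_flat_map: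
  assumes "bilinear G"
  shows "flat_map G v \<bullet> w = G v w"
proof -
  have l: "linear (G v)"
    using assms by (simp add: bilinear_def)
  have "G v w = G v (\<Sum>b\<in>Basis. (w \<bullet> b) *\<^sub>R b)"
    by (simp add: euclidean_representation)
  also have "\<dots> = (\<Sum>b\<in>Basis. (w \<bullet> b) * G v b)"
    by (simp add: linear_sum[OF l] linear_scale[OF l])
  finally show ?thesis
    by (simp add: flat_map_def inner_sum_left inner_commute[of w] mult.commute[of "_ \<bullet> w"])
qed

lemma linear_flat_map:
  assumes "bilinear G"
  shows "linear (flat_map G)"
  using assms
  by (intro linearI)
     (simp_all add: flat_map_def bilinear_ladd bilinear_lmul scaleR_add_left sum.distrib scaleR_sum_right)

lemma flat_map_inverse:
  assumes "bilinear G" "nondegenerate G"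
  obtains T where "linear T" "\<And>v. T (flat_map G v) = v" "\<And>v. flat_map G (T v) = v"
proof -
  have "v = 0" if "flat_map G v = 0" for v
    using that assms inner_flat_map[OF assms(1), of v] by (auto simp: nondegenerate_def)
  then have inj: "inj (flat_map G)"
    using linear_injective_0[OF linear_flat_map[OF assms(1)]] by blast
  obtain T where "linear T" "\<forall>v. T (flat_map G v) = v" "\<forall>v. flat_map G (T v) = v"
    using linear_injective_isomorphism[OF linear_flat_map[OF assms(1)] inj] by auto
  with that show thesis by blast
qed

lemma riesz_nondegenerate:
  assumes "bilinear G" "nondegenerate G" "linear R"
  shows "\<exists>z. \<forall>y. G z y = (R y::real)"
proof -
  obtain T where T: "linear T" "\<And>v. T (flat_map G v) = v" "\<And>v. flat_map G (T v) = v"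
    using flat_map_inverse[OF assms(1,2)] by blast
  have "G (T (\<Sum>b\<in>Basis. R b *\<^sub>R b)) y = R y" for y
  proof -
    have "R y = R (\<Sum>b\<in>Basis. (y \<bullet> b) *\<^sub>R b)"
      by (simp add: euclidean_representation)
    also have "\<dots> = (\<Sum>b\<in>Basis. (y \<bullet> b) * R b)"
      by (simp add: linear_sum[OF assms(3)] linear_scale[OF assms(3)])
    finally show ?thesis
      by (simp add: T(3) inner_flat_map[OF assms(1), symmetric] inner_sum_left inner_commute[of y] mult.commute[of "_ \<bullet> y"])
  qed
  then show ?thesis by blast
qed

lemma nondegenerate_eqI:
  assumes "bilinear G" "nondegenerate G" "\<And>y. G z y = G z' y"
  shows "z = z'"
proof -
  have "G (z - z') y = 0" for y
    using assms(1,3) by (simp add: bilinear_lsub)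
  then show ?thesis
    using assms(2) unfolding nondegenerate_def by (metis eq_iff_diff_eq_0)
qed

text \<open>
  A map and its adjoint with respect to a nondegenerate symmetric form are conjugate up to transposition, so
  they have the same trace.  In particular skew maps have trace zero.
\<close>

lemma lin_trace_adjoint:
  assumes G: "bilinear G" "nondegenerate G" "\<And>v w. G v w = G w v"
    and S: "linear S" and T: "linear T" and adj: "\<And>v w. G (S v) w = G v (T w)"
  shows "lin_trace S = lin_trace T"
proof -
  obtain L where L: "linear L" "\<And>v. L (flat_map G v) = v" "\<And>v. flat_map G (L v) = v"
    using flat_map_inverse[OF G(1,2)] by blast
  have "flat_map G (S v) \<bullet> w = adjoint T (flat_map G v) \<bullet> w" for v w
    by (metis G(1) adj adjoint_works[OF T] inner_commute inner_flat_map)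
  then have "S v = L (adjoint T (flat_map G v))" for v
    by (metis L(2) vector_eq_rdot)
  then have "lin_trace S = lin_trace (\<lambda>v. L (adjoint T (flat_map G v)))"
    by (intro arg_cong[where f = lin_trace] ext)
  also have "\<dots> = lin_trace (\<lambda>v. adjoint T (flat_map G (L v)))"
    using lin_trace_commute[OF L(1), of "\<lambda>v. adjoint T (flat_map G v)"]
      linear_compose[OF linear_flat_map[OF G(1)] adjoint_linear[OF T]] by (simp add: o_def)
  also have "\<dots> = lin_trace T"
    unfolding lin_trace_def L(3) by (metis adjoint_works[OF T] inner_commute)
  finally show ?thesis .
qed

lemma lin_trace_skew:
  assumes G: "bilinear G" "nondegenerate G" "\<And>v w. G v w = G w v"
    and S: "linear S" and skew: "\<And>v w. G (S v) w = - G v (S w)"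
  shows "lin_trace S = 0"
proof -
  have "lin_trace S = lin_trace (\<lambda>v. - S v)"
    by (rule lin_trace_adjoint[OF G S])
       (auto simp: skew bilinear_rneg[OF G(1)] intro: linear_compose_neg S)
  then show ?thesis
    by (simp add: lin_trace_minus)
qed

section \<open>Differentiation in Euclidean spaces\<close>

text \<open>
  Where the differentiable factor of a product vanishes, the other factor need only be continuous.
\<close>

lemma has_derivative_scaleR_vanishing:
  fixes g :: "'a::euclidean_space \<Rightarrow> 'b::euclidean_space" and h :: "'a \<Rightarrow> real"
  assumes g: "(g has_derivative g') (at x)" and "g x = 0" and h: "isCont h x"
  shows "((\<lambda>y. h y *\<^sub>R g y) has_derivative (\<lambda>v. h x *\<^sub>R g' v)) (at x)"
proof -
  have bl: "bounded_linear g'"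
    using g by (rule has_derivative_bounded_linear)
  obtain d where d: "d > 0" "\<And>y. norm (y - x) < d \<Longrightarrow> norm (g y - g x - g' (y - x)) \<le> 1 * norm (y - x)"
    using g unfolding has_derivative_at_alt by (metis zero_less_one)
  have bound: "norm (g y /\<^sub>R norm (y - x)) \<le> 1 + onorm g'" if "norm (y - x) < d" for y
  proof (cases "y = x")
    case False
    have "norm (g y) \<le> norm (y - x) + norm (g' (y - x))"
      using d(2)[OF that] \<open>g x = 0\<close> norm_triangle_sub[of "g y" "g' (y - x)"] by simp
    also have "\<dots> \<le> (1 + onorm g') * norm (y - x)"
      using onorm[OF bl, of "y - x"] by (simp add: algebra_simps)
    finally show ?thesis
      using False by (simp add: divide_simps)
  qed (use onorm_pos_le[OF bl] \<open>g x = 0\<close> in simp)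
  have "((\<lambda>y. (h y - h x) *\<^sub>R (g y /\<^sub>R norm (y - x))) \<longlongrightarrow> 0) (at x)"
  proof (rule tendsto_0_le[where K = "1 + onorm g'"])
    show "((\<lambda>y. h y - h x) \<longlongrightarrow> 0) (at x)"
      using h by (simp add: isCont_def LIM_zero)
    show "\<forall>\<^sub>F y in at x. norm ((h y - h x) *\<^sub>R (g y /\<^sub>R norm (y - x))) \<le> norm (h y - h x) * (1 + onorm g')"
      unfolding eventually_at using d(1) bound
      by (auto simp: dist_norm simp del: norm_scaleR scaleR_scaleR intro!: exI[of _ d]
          simp flip: norm_scaleR) (metis abs_ge_zero mult_left_mono norm_scaleR)
  qed
  then have "((\<lambda>y. (h y - h x) *\<^sub>R g y) has_derivative (\<lambda>v. 0)) (at x)"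
    unfolding has_derivative_at2 using \<open>g x = 0\<close> by (simp add: divide_inverse mult.commute)
  from has_derivative_add[OF this has_derivative_scaleR_right[OF g, of "h x"]]
  show ?thesis by (simp add: algebra_simps)
qed

text \<open>
  Write the equation as \<open>L x (z x) = \<rho> x\<close>.  Then \<open>L x\<^sub>0 (z x - z x\<^sub>0) = \<rho> x - \<rho> x\<^sub>0 - (L x - L x\<^sub>0) (z x)\<close>, where
  \<open>L x - L x\<^sub>0\<close> is differentiable and vanishes at \<open>x\<^sub>0\<close>, so that continuity of \<open>z\<close> is enough for the right-hand
  side to be differentiable.  Continuity follows from the invertibility of \<open>L x\<^sub>0\<close>.
\<close>

lemma nondegenerate_solution_differentiable:
  fixes G :: "'a::euclidean_space \<Rightarrow> 'b::euclidean_space \<Rightarrow> 'b \<Rightarrow> real"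
  assumes U: "open U" "x0 \<in> U" and bil: "\<And>x. x \<in> U \<Longrightarrow> bilinear (G x)"
    and nd: "nondegenerate (G x0)"
    and dG: "\<And>v w. (\<lambda>x. G x v w) differentiable (at x0)"
    and dR: "\<And>y. (\<lambda>x. R x y) differentiable (at x0)"
    and sol: "\<And>x y. x \<in> U \<Longrightarrow> G x (z x) y = R x y"
  shows "z differentiable (at x0)"
proof -
  obtain T where T: "linear T" "\<And>v. T (flat_map (G x0) v) = v" "\<And>v. flat_map (G x0) (T v) = v"
    using flat_map_inverse[OF bil nd] U by blast
  define \<rho> where "\<rho> x = (\<Sum>b\<in>Basis. R x b *\<^sub>R b)" for x
  define g where "g c x = flat_map (G x) c - flat_map (G x0) c" for c x
  have sum: "(\<Sum>c\<in>Basis. (w \<bullet> c) *\<^sub>R g c x) = flat_map (G x) w - flat_map (G x0) w"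
    if "x \<in> U" for x w
  proof -
    have "flat_map (G y) w = (\<Sum>c\<in>Basis. (w \<bullet> c) *\<^sub>R flat_map (G y) c)" if "y \<in> U" for y
    proof -
      have l: "linear (flat_map (G y))" by (rule linear_flat_map[OF bil[OF that]])
      have "flat_map (G y) w = flat_map (G y) (\<Sum>c\<in>Basis. (w \<bullet> c) *\<^sub>R c)"
        by (simp add: euclidean_representation)
      also have "\<dots> = (\<Sum>c\<in>Basis. (w \<bullet> c) *\<^sub>R flat_map (G y) c)"
        by (simp add: linear_sum[OF l] linear_scale[OF l])
      finally show ?thesis .
    qed
    with that U show ?thesis
      by (simp add: g_def scaleR_diff_right sum_subtractf)
  qed
  have eq: "z x = z x0 + T (\<rho> x - \<rho> x0 - (\<Sum>c\<in>Basis. (z x \<bullet> c) *\<^sub>R g c x))" if "x \<in> U" for x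
  proof -
    have f: "flat_map (G y) (z y) = \<rho> y" if "y \<in> U" for y
      using that by (simp add: flat_map_def \<rho>_def sol)
    have "\<rho> x - \<rho> x0 - (\<Sum>c\<in>Basis. (z x \<bullet> c) *\<^sub>R g c x) = flat_map (G x0) (z x - z x0)"
      using that U sum[OF that, of "z x"] f
      by (simp add: linear_diff[OF linear_flat_map[OF bil[OF \<open>x0 \<in> U\<close>]]])
    then show ?thesis by (simp add: T)
  qed
  have dg: "g c differentiable (at x0)" for c
    unfolding g_def flat_map_def by (intro derivative_intros dG differentiable_sum ballI finite_Basis)
  have d\<rho>: "\<rho> differentiable (at x0)"
    unfolding \<rho>_def by (intro derivative_intros dR differentiable_sum ballI finite_Basis)
  have blT: "bounded_linear T" using T(1) by (simp add: linear_conv_bounded_linear)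
  obtain C where C: "C > 0" "\<And>v. norm (T v) \<le> norm v * C"
    using bounded_linear.pos_bounded[OF blT] by blast
  define q where "q x = (\<Sum>c\<in>Basis. norm (g c x))" for x
  \<comment> \<open>The operator norm of \<open>L x - L x0\<close> is at most \<open>q x\<close>.\<close>
  have bound: "norm (\<Sum>c\<in>Basis. (w \<bullet> c) *\<^sub>R g c x) \<le> norm w * q x" for w x
    unfolding q_def sum_distrib_left
    by (rule sum_norm_le) (simp add: mult_right_mono Basis_le_norm)
  have gcont: "(g c \<longlongrightarrow> 0) (at x0)" for c
    using differentiable_imp_continuous_within[OF dg[of c]] by (simp add: continuous_within g_def)
  have \<rho>cont: "((\<lambda>x. \<rho> x - \<rho> x0) \<longlongrightarrow> 0) (at x0)"
    using LIM_zero[OF differentiable_imp_continuous_within[OF d\<rho>, unfolded continuous_within]] .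
  have q0: "(q \<longlongrightarrow> 0) (at x0)"
    unfolding q_def by (rule tendsto_null_sum) (rule tendsto_norm_zero[OF gcont])
  have "\<forall>\<^sub>F x in at x0. x \<in> U"
    using U by (simp add: eventually_at_topological) blast
  moreover have "\<forall>\<^sub>F x in at x0. q x < 1 / (2 * C)"
    using order_tendstoD(2)[OF q0, of "1 / (2 * C)"] C(1) by simp
  \<comment> \<open>Once \<open>C q x < 1/2\<close>, the term with \<open>z x - z x0\<close> on the right can be absorbed on the left.\<close>
  ultimately have "\<forall>\<^sub>F x in at x0. norm (z x - z x0) \<le> 2 * C * (norm (\<rho> x - \<rho> x0) + norm (z x0) * q x)"
  proof eventually_elim
    case (elim x)
    define N where "N = norm (z x - z x0)"
    have q_nonneg: "0 \<le> q x" by (simp add: q_def sum_nonneg)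
    have "N \<le> norm (\<rho> x - \<rho> x0 - (\<Sum>c\<in>Basis. (z x \<bullet> c) *\<^sub>R g c x)) * C"
      using eq[OF elim(1)] C(2) unfolding N_def by (metis add_diff_cancel_left')
    also have "\<dots> \<le> (norm (\<rho> x - \<rho> x0) + norm (z x) * q x) * C"
      using bound[of "z x" x] C(1) norm_triangle_ineq4[of "\<rho> x - \<rho> x0" "\<Sum>c\<in>Basis. (z x \<bullet> c) *\<^sub>R g c x"]
      by (intro mult_right_mono) auto
    also have "\<dots> \<le> (norm (\<rho> x - \<rho> x0) + (norm (z x0) + N) * q x) * C"
      using C(1) q_nonneg norm_triangle_sub[of "z x" "z x0"] unfolding N_def
      by (intro mult_right_mono add_left_mono) auto
    also have "\<dots> = C * (norm (\<rho> x - \<rho> x0) + norm (z x0) * q x) + N * (C * q x)"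
      by (simp add: algebra_simps)
    also have "N * (C * q x) \<le> N * (1/2)"
      using elim(2) C(1) by (intro mult_left_mono) (auto simp: N_def field_simps)
    finally show ?case unfolding N_def by simp
  qed
  moreover have "((\<lambda>x. 2 * C * (norm (\<rho> x - \<rho> x0) + norm (z x0) * q x)) \<longlongrightarrow> 0) (at x0)"
    using tendsto_mult_left[OF tendsto_add[OF tendsto_norm_zero[OF \<rho>cont]
        tendsto_mult_left[OF q0, of "norm (z x0)"]], of "2 * C"] by (simp only: norm_zero mult_zero_right add_0)
  ultimately have "((\<lambda>x. z x - z x0) \<longlongrightarrow> 0) (at x0)"
    by (rule Lim_null_comparison)
  then have zcont: "isCont z x0"
    by (simp add: isCont_def LIM_zero_iff)
  have d1: "(\<lambda>x. (z x \<bullet> c) *\<^sub>R g c x) differentiable (at x0)" for c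
  proof -
    obtain g' where "(g c has_derivative g') (at x0)" using dg by (auto simp: differentiable_def)
    from has_derivative_scaleR_vanishing[OF this, of "\<lambda>x. z x \<bullet> c"] zcont
    show ?thesis unfolding differentiable_def by (auto simp: g_def intro!: continuous_intros)
  qed
  have "(\<lambda>x. \<rho> x - \<rho> x0 - (\<Sum>c\<in>Basis. (z x \<bullet> c) *\<^sub>R g c x)) differentiable (at x0)"
    by (intro differentiable_diff differentiable_sum differentiable_const ballI finite_Basis d\<rho> d1)
  then obtain D where
    "((\<lambda>x. \<rho> x - \<rho> x0 - (\<Sum>c\<in>Basis. (z x \<bullet> c) *\<^sub>R g c x)) has_derivative D) (at x0)"
    by (auto simp: differentiable_def)
  from bounded_linear.has_derivative[OF blT this]
  have "(\<lambda>x. T (\<rho> x - \<rho> x0 - (\<Sum>c\<in>Basis. (z x \<bullet> c) *\<^sub>R g c x))) differentiable (at x0)"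
    unfolding differentiable_def by blast
  then have "(\<lambda>x. z x0 + T (\<rho> x - \<rho> x0 - (\<Sum>c\<in>Basis. (z x \<bullet> c) *\<^sub>R g c x))) differentiable (at x0)"
    by (rule differentiable_add[OF differentiable_const])
  then obtain z' where "((\<lambda>x. z x0 + T (\<rho> x - \<rho> x0 - (\<Sum>c\<in>Basis. (z x \<bullet> c) *\<^sub>R g c x))) has_derivative z') (at x0)"
    by (auto simp: differentiable_def)
  from has_derivative_transform_within_open[OF this U] eq
  show ?thesis unfolding differentiable_def by metis
qed

lemma dird_eq: "(f has_derivative f') (at x) \<Longrightarrow> dird f x v = f' v"
  by (simp add: frechet_derivative_at[symmetric])

lemma has_derivative_dird: "f differentiable (at x) \<Longrightarrow> (f has_derivative dird f x) (at x)"
  by (simp add: frechet_derivative_works)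

lemma dird_transform:
  assumes "open S" "x \<in> S" "\<And>y. y \<in> S \<Longrightarrow> f y = g y" "f differentiable (at x)"
  shows "dird g x = dird f x"
  by (metis assms frechet_derivative_transform_within_open)

lemma differentiable_transform:
  assumes "open S" "x \<in> S" "\<And>y. y \<in> S \<Longrightarrow> f y = g y" "f differentiable (at x)"
  shows "g differentiable (at x)"
  using assms has_derivative_transform_within_open unfolding differentiable_def by blast

lemma dird_compose:
  assumes "f differentiable (at x)" "g differentiable (at (f x))"
  shows "dird (\<lambda>y. g (f y)) x v = dird g (f x) (dird f x v)"
    and "(\<lambda>y. g (f y)) differentiable (at x)"
proof -
  have "((\<lambda>y. g (f y)) has_derivative (\<lambda>v. dird g (f x) (dird f x v))) (at x)"
    using has_derivative_compose[OF has_derivative_dird[OF assms(1)] has_derivative_dird[OF assms(2)]] .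
  then show "dird (\<lambda>y. g (f y)) x v = dird g (f x) (dird f x v)" "(\<lambda>y. g (f y)) differentiable (at x)"
    by (auto intro: dird_eq simp: differentiable_def)
qed

lemma Ck_on_subset: "Ck_on k S f \<Longrightarrow> T \<subseteq> S \<Longrightarrow> Ck_on k T f"
  by (induction k arbitrary: f) (auto intro: continuous_on_subset)

lemma Ck_on_Suc_imp: "Ck_on (Suc k) S f \<Longrightarrow> Ck_on k S f"
proof (induction k arbitrary: f)
  case 0
  then show ?case
    by (auto intro!: continuous_at_imp_continuous_on differentiable_imp_continuous_within)
qed auto

lemma Ck_on_cong:
  assumes "open S" "\<And>x. x \<in> S \<Longrightarrow> f x = g x" "Ck_on k S f"
  shows "Ck_on k S g"
  using assms(2,3)
proof (induction k arbitrary: f g)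
  case 0
  then show ?case by (metis Ck_on.simps(1) continuous_on_cong)
next
  case (Suc k)
  have "g differentiable (at x)" if "x \<in> S" for x
    using differentiable_transform[OF \<open>open S\<close> that Suc.prems(1)] Suc.prems(2) that by simp
  moreover have "Ck_on k S (\<lambda>x. dird g x v)" for v
  proof (rule Suc.IH)
    show "dird f x v = dird g x v" if "x \<in> S" for x
      using dird_transform[OF \<open>open S\<close> that Suc.prems(1)] Suc.prems(2) that by simp
    show "Ck_on k S (\<lambda>x. dird f x v)"
      using Suc.prems(2) by simp
  qed
  ultimately show ?case by simp
qed

lemma Ck_on_const: "Ck_on k S (\<lambda>x. c)"
  by (induction k arbitrary: c) auto

lemma Ck_on_add:
  assumes "open S" "Ck_on k S f" "Ck_on k S g"
  shows "Ck_on k S (\<lambda>x. f x + g x)"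
  using assms(2,3)
proof (induction k arbitrary: f g)
  case (Suc k)
  have "Ck_on k S (\<lambda>x. dird (\<lambda>x. f x + g x) x v)" for v
  proof (rule Ck_on_cong[OF \<open>open S\<close>])
    show "dird f x v + dird g x v = dird (\<lambda>x. f x + g x) x v" if "x \<in> S" for x
      using has_derivative_add[OF has_derivative_dird[of f x] has_derivative_dird[of g x]] Suc.prems that
      by (intro dird_eq[symmetric]) auto
    show "Ck_on k S (\<lambda>x. dird f x v + dird g x v)"
      using Suc by simp
  qed
  with Suc.prems show ?case by auto
qed (simp add: continuous_on_add)

lemma Ck_on_sum:
  assumes "open S" "finite B" "\<And>b. b \<in> B \<Longrightarrow> Ck_on k S (f b)"
  shows "Ck_on k S (\<lambda>x. \<Sum>b\<in>B. f b x)"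
  using assms(2,3) by (induction B rule: finite_induct) (auto intro: Ck_on_const Ck_on_add[OF assms(1)])

lemma Ck_on_linear_compose:
  assumes "open S" "linear L" "Ck_on k S f"
  shows "Ck_on k S (\<lambda>x. L (f x))"
  using assms(3)
proof (induction k arbitrary: f)
  case 0
  then show ?case
    using linear_continuous_on_compose[OF _ \<open>linear L\<close>] by auto
next
  case (Suc k)
  have L: "(L has_derivative L) (at y)" for y
    using \<open>linear L\<close> by (simp add: bounded_linear_imp_has_derivative linear_conv_bounded_linear)
  have hd: "((\<lambda>x. L (f x)) has_derivative (\<lambda>v. L (dird f x v))) (at x)" if "x \<in> S" for x
    using has_derivative_compose[OF has_derivative_dird L, of f x] Suc.prems that by simp
  have "Ck_on k S (\<lambda>x. dird (\<lambda>x. L (f x)) x v)" for v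
  proof (rule Ck_on_cong[OF \<open>open S\<close>])
    show "L (dird f x v) = dird (\<lambda>x. L (f x)) x v" if "x \<in> S" for x
      by (rule dird_eq[OF hd[OF that], symmetric])
    show "Ck_on k S (\<lambda>x. L (dird f x v))"
      using Suc by simp
  qed
  with hd show ?case by (auto simp: differentiable_def)
qed

lemma Ck_on_scaleR:
  fixes f :: "'a::euclidean_space \<Rightarrow> real" and g :: "'a \<Rightarrow> 'b::euclidean_space"
  assumes "open S" "Ck_on k S f" "Ck_on k S g"
  shows "Ck_on k S (\<lambda>x. f x *\<^sub>R g x)"
  using assms(2,3)
proof (induction k arbitrary: f g)
  case (Suc k)
  have hd: "((\<lambda>x. f x *\<^sub>R g x) has_derivative (\<lambda>v. f x *\<^sub>R dird g x v + dird f x v *\<^sub>R g x)) (at x)"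
    if "x \<in> S" for x
    using has_derivative_scaleR[OF has_derivative_dird[of f x] has_derivative_dird[of g x]] Suc.prems that
    by simp
  have "Ck_on k S (\<lambda>x. dird (\<lambda>x. f x *\<^sub>R g x) x v)" for v
  proof (rule Ck_on_cong[OF \<open>open S\<close>])
    show "f x *\<^sub>R dird g x v + dird f x v *\<^sub>R g x = dird (\<lambda>x. f x *\<^sub>R g x) x v" if "x \<in> S" for x
      by (rule dird_eq[OF hd[OF that], symmetric])
    show "Ck_on k S (\<lambda>x. f x *\<^sub>R dird g x v + dird f x v *\<^sub>R g x)"
      using Suc.prems Ck_on_Suc_imp[OF Suc.prems(1)] Ck_on_Suc_imp[OF Suc.prems(2)]
      by (intro Ck_on_add[OF \<open>open S\<close>] Suc.IH) auto
  qed
  with hd show ?case by (auto simp: differentiable_def)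
qed (simp add: continuous_on_scaleR)

lemma Ck_on_compose:
  assumes "open S" "open T" "f ` S \<subseteq> T" "Ck_on k S f" "Ck_on k T g"
  shows "Ck_on k S (\<lambda>x. g (f x))"
  using assms(4,5)
proof (induction k arbitrary: g)
  case 0
  then show ?case
    using continuous_on_compose2[of T g S f] assms(3) by auto
next
  case (Suc k)
  have diff: "f differentiable (at x)" "g differentiable (at (f x))" if "x \<in> S" for x
    using Suc.prems that assms(3) by auto
  have "Ck_on k S (\<lambda>x. dird (\<lambda>x. g (f x)) x v)" for v
  proof (rule Ck_on_cong[OF \<open>open S\<close>])
    show "(\<Sum>b\<in>Basis. (dird f x v \<bullet> b) *\<^sub>R dird g (f x) b) = dird (\<lambda>x. g (f x)) x v" if "x \<in> S" for x
    proof -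
      have l: "linear (dird g (f x))"
        using diff(2)[OF that] by (rule linear_frechet_derivative)
      have "dird g (f x) (dird f x v) = dird g (f x) (\<Sum>b\<in>Basis. (dird f x v \<bullet> b) *\<^sub>R b)"
        by (simp add: euclidean_representation)
      also have "\<dots> = (\<Sum>b\<in>Basis. (dird f x v \<bullet> b) *\<^sub>R dird g (f x) b)"
        by (simp add: linear_sum[OF l] linear_scale[OF l])
      finally show ?thesis
        by (simp add: dird_compose(1)[OF diff[OF that]])
    qed
    have f: "Ck_on k S f" using Suc.prems(1) by (rule Ck_on_Suc_imp)
    have "Ck_on k S (\<lambda>x. dird f x v \<bullet> b)" for b
      by (rule Ck_on_linear_compose[OF \<open>open S\<close>, of "\<lambda>w. w \<bullet> b"])
         (use Suc.prems(1) in \<open>auto intro: bounded_linear.linear bounded_linear_inner_left\<close>)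
    then show "Ck_on k S (\<lambda>x. \<Sum>b\<in>Basis. (dird f x v \<bullet> b) *\<^sub>R dird g (f x) b)"
      using Suc.prems(2) by (intro Ck_on_sum Ck_on_scaleR Suc.IH f assms finite_Basis) auto
  qed
  moreover have "\<forall>x\<in>S. (\<lambda>x. g (f x)) differentiable (at x)"
    using diff dird_compose(2) by blast
  ultimately show ?case by simp
qed

lemma mean_value_along:
  fixes f :: "'a::euclidean_space \<Rightarrow> real"
  assumes "\<And>s. 0 \<le> s \<Longrightarrow> s \<le> h \<Longrightarrow> f differentiable (at (y + s *\<^sub>R v))" "0 < h"
  shows "\<exists>s. 0 < s \<and> s < h \<and> f (y + h *\<^sub>R v) - f y = h * dird f (y + s *\<^sub>R v) v"
proof -
  have "DERIV (\<lambda>s. f (y + s *\<^sub>R v)) s :> dird f (y + s *\<^sub>R v) v" if "0 \<le> s" "s \<le> h" for s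
  proof -
    have "((\<lambda>s. y + s *\<^sub>R v) has_derivative (\<lambda>t. t *\<^sub>R v)) (at s)"
      by (auto intro!: derivative_eq_intros)
    from has_derivative_compose[OF this has_derivative_dird[OF assms(1)[OF that]]]
    have "((\<lambda>s. f (y + s *\<^sub>R v)) has_derivative (\<lambda>t. dird f (y + s *\<^sub>R v) (t *\<^sub>R v))) (at s)" .
    then show ?thesis
      by (simp add: linear_scale[OF linear_frechet_derivative[OF assms(1)[OF that]]]
          has_field_derivative_def mult.commute[of _ "dird f _ _"])
  qed
  from MVT2[OF \<open>0 < h\<close> this] show ?thesis by auto
qed

lemma Ck_on_linear:
  assumes "open S" "linear L"
  shows "Ck_on k S L"
proof -
  have id: "Ck_on k S (\<lambda>x. x)"
    by (cases k) (auto simp: Ck_on_const)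
  show ?thesis by (rule Ck_on_linear_compose[OF assms id])
qed

text \<open>
  The theorem of Schwarz.  By the mean value theorem, applied twice, one and the same second difference
  of \<open>f\<close> is \<open>h\<^sup>2\<close> times a value of either iterated derivative at a point near \<open>x\<close>.
\<close>

lemma dird_dird_commute:
  fixes f :: "'a::euclidean_space \<Rightarrow> real"
  assumes S: "open S" "x \<in> S" and f: "Ck_on (Suc (Suc 0)) S f"
  shows "dird (\<lambda>y. dird f y v) x w = dird (\<lambda>y. dird f y w) x v"
proof (rule ccontr)
  define D where "D v w = (\<lambda>z. dird (\<lambda>y. dird f y v) z w)" for v w
  assume "\<not> ?thesis"
  then have ne: "D v w x \<noteq> D w v x" by (simp add: D_def)
  define e where "e = \<bar>D v w x - D w v x\<bar> / 2"
  have e: "e > 0" using ne by (simp add: e_def)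
  have cont: "isCont (D a b) x" for a b
    using f S unfolding D_def by (simp add: continuous_on_eq_continuous_at)
  obtain d1 where d1: "d1 > 0" "\<And>y. dist y x < d1 \<Longrightarrow> dist (D v w y) (D v w x) < e"
    using cont[of v w] e unfolding continuous_at_eps_delta by metis
  obtain d2 where d2: "d2 > 0" "\<And>y. dist y x < d2 \<Longrightarrow> dist (D w v y) (D w v x) < e"
    using cont[of w v] e unfolding continuous_at_eps_delta by metis
  obtain r where r: "r > 0" "ball x r \<subseteq> S" using S openE by blast
  \<comment> \<open>So small that the parallelogram spanned by \<open>h v\<close> and \<open>h w\<close> at \<open>x\<close> stays in all three balls.\<close>
  define h where "h = min r (min d1 d2) / (2 * (norm v + norm w + 1))"
  have pos: "0 < norm v + norm w + 1" by (simp add: add_nonneg_pos)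
  have h: "h > 0" unfolding h_def using r d1 d2 pos by simp
  have near: "dist (x + s *\<^sub>R a + t *\<^sub>R b) x < min r (min d1 d2)"
    if "0 \<le> s" "s \<le> h" "0 \<le> t" "t \<le> h" "{a, b} = {v, w}" for s t a b
  proof -
    have "dist (x + s *\<^sub>R a + t *\<^sub>R b) x \<le> s * norm a + t * norm b"
      using that norm_triangle_ineq[of "s *\<^sub>R a" "t *\<^sub>R b"] by (simp add: dist_norm add.assoc)
    also have "\<dots> \<le> h * norm a + h * norm b"
      using that by (intro add_mono mult_right_mono) auto
    also have "\<dots> \<le> h * (norm v + norm w + 1)"
      using that h by (auto simp: doubleton_eq_iff algebra_simps)
    also have "\<dots> = min r (min d1 d2) / 2"
      using pos unfolding h_def by (simp add: field_simps)
    also have "\<dots> < min r (min d1 d2)"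
      using r(1) d1(1) d2(1) by (simp add: min_def)
    finally show ?thesis .
  qed
  have key: "\<exists>y. dist y x < min r (min d1 d2) \<and>
      f (x + h *\<^sub>R a + h *\<^sub>R b) - f (x + h *\<^sub>R a) - f (x + h *\<^sub>R b) + f x = h * (h * D a b y)"
    if ab: "{a, b} = {v, w}" for a b
  proof -
    have inS: "x + s *\<^sub>R a + t *\<^sub>R b \<in> S" if "0 \<le> s" "s \<le> h" "0 \<le> t" "t \<le> h" for s t
      using near[OF that ab] r by (auto simp: dist_commute)
    define \<phi> where "\<phi> y = f (y + h *\<^sub>R b) - f y" for y
    have d\<phi>: "(\<phi> has_derivative (\<lambda>u. dird f (y + h *\<^sub>R b) u - dird f y u)) (at y)"
      if "y + h *\<^sub>R b \<in> S" "y \<in> S" for y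
    proof -
      have "((\<lambda>y. y + h *\<^sub>R b) has_derivative (\<lambda>u. u)) (at y)"
        by (auto intro!: derivative_eq_intros)
      from has_derivative_compose[OF this has_derivative_dird]
      show ?thesis unfolding \<phi>_def using f that
        by (intro has_derivative_diff has_derivative_dird) auto
    qed
    have "\<exists>s. 0 < s \<and> s < h \<and> \<phi> (x + h *\<^sub>R a) - \<phi> x = h * dird \<phi> (x + s *\<^sub>R a) a"
    proof (rule mean_value_along[OF _ h])
      fix s assume "0 \<le> s" "s \<le> h"
      then show "\<phi> differentiable (at (x + s *\<^sub>R a))"
        using d\<phi>[of "x + s *\<^sub>R a"] inS[of s h] inS[of s 0] h by (auto simp: differentiable_def)
    qed
    then obtain s where s: "0 < s" "s < h" "\<phi> (x + h *\<^sub>R a) - \<phi> x = h * dird \<phi> (x + s *\<^sub>R a) a"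
      by blast
    have "dird \<phi> (x + s *\<^sub>R a) a = dird f (x + s *\<^sub>R a + h *\<^sub>R b) a - dird f (x + s *\<^sub>R a) a"
      using d\<phi>[of "x + s *\<^sub>R a"] inS[of s h] inS[of s 0] h s by (intro dird_eq) auto
    moreover have "\<exists>t. 0 < t \<and> t < h \<and>
        dird f (x + s *\<^sub>R a + h *\<^sub>R b) a - dird f (x + s *\<^sub>R a) a = h * dird (\<lambda>y. dird f y a) (x + s *\<^sub>R a + t *\<^sub>R b) b"
      using f inS s by (intro mean_value_along[OF _ h]) auto
    ultimately obtain t where t: "0 < t" "t < h"
      "\<phi> (x + h *\<^sub>R a) - \<phi> x = h * (h * D a b (x + s *\<^sub>R a + t *\<^sub>R b))"
      using s unfolding D_def by auto
    with near[OF _ _ _ _ ab, of s t] s show ?thesis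
      by (auto simp: \<phi>_def intro!: exI[of _ "x + s *\<^sub>R a + t *\<^sub>R b"])
  qed
  obtain y1 where y1: "dist y1 x < min r (min d1 d2)"
      "f (x + h *\<^sub>R v + h *\<^sub>R w) - f (x + h *\<^sub>R v) - f (x + h *\<^sub>R w) + f x = h * (h * D v w y1)"
    using key[of v w] by blast
  obtain y2 where y2: "dist y2 x < min r (min d1 d2)"
      "f (x + h *\<^sub>R w + h *\<^sub>R v) - f (x + h *\<^sub>R w) - f (x + h *\<^sub>R v) + f x = h * (h * D w v y2)"
    using key[of w v] by blast
  have "h * (h * D v w y1) = h * (h * D w v y2)"
    unfolding y1(2)[symmetric] y2(2)[symmetric] by (simp add: algebra_simps)
  with h have "D v w y1 = D w v y2" by simp
  moreover have "\<bar>D v w y1 - D v w x\<bar> < e" "\<bar>D w v y2 - D w v x\<bar> < e"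
    using d1(2)[of y1] d2(2)[of y2] y1(1) y2(1) by (auto simp: dist_real_def)
  ultimately show False unfolding e_def by (simp add: abs_if split: if_splits)
qed

section \<open>The Levi-Civita connection in coordinates\<close>

lemma C2_differentiable:
  assumes "Ck_on (Suc (Suc 0)) S f" "x \<in> S"
  shows "f differentiable (at x)" "(\<lambda>x. dird f x u) differentiable (at x)"
  using assms unfolding Ck_on.simps by blast+

locale metric_components =
  fixes U :: "'e::euclidean_space set" and G :: "'e \<Rightarrow> 'e \<Rightarrow> 'e \<Rightarrow> real"
  assumes open_U: "open U"
    and bil: "\<And>x. x \<in> U \<Longrightarrow> bilinear (G x)"
    and sym: "\<And>x v w. x \<in> U \<Longrightarrow> G x v w = G x w v"
    and nondeg: "\<And>x. x \<in> U \<Longrightarrow> nondegenerate (G x)"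
    and C2: "\<And>v w. Ck_on (Suc (Suc 0)) U (\<lambda>x. G x v w)"
begin

abbreviation "DG x u v w \<equiv> dird (\<lambda>z. G z v w) x u"

abbreviation "\<Gamma> \<equiv> christoffel G"

lemma G_differentiable: "x \<in> U \<Longrightarrow> (\<lambda>z. G z v w) differentiable (at x)"
  using C2[of v w] by simp

lemma DG_differentiable: "x \<in> U \<Longrightarrow> (\<lambda>x. DG x u v w) differentiable (at x)"
  using C2[of v w] by simp

lemma DG_sym: "x \<in> U \<Longrightarrow> DG x u v w = DG x u w v"
  by (rule dird_transform[OF open_U, THEN fun_cong]) (auto intro: sym G_differentiable)

lemma linear_DG1: "x \<in> U \<Longrightarrow> linear (\<lambda>u. DG x u v w)"
  using linear_frechet_derivative[OF G_differentiable] .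

lemma linear_DG3:
  assumes x: "x \<in> U"
  shows "linear (\<lambda>w. DG x u v w)"
proof (rule linearI)
  fix w w' and c :: real
  have "((\<lambda>z. G z v w + G z v w') has_derivative (\<lambda>u. DG x u v w + DG x u v w')) (at x)"
    by (intro has_derivative_add has_derivative_dird G_differentiable x)
  then have "((\<lambda>z. G z v (w + w')) has_derivative (\<lambda>u. DG x u v w + DG x u v w')) (at x)"
    by (rule has_derivative_transform_within_open[OF _ open_U x]) (simp add: bilinear_radd[OF bil])
  then show "DG x u v (w + w') = DG x u v w + DG x u v w'" by (rule dird_eq)
  have "((\<lambda>z. c * G z v w) has_derivative (\<lambda>u. c * DG x u v w)) (at x)"
    by (intro has_derivative_mult_right has_derivative_dird G_differentiable x)
  then have "((\<lambda>z. G z v (c *\<^sub>R w)) has_derivative (\<lambda>u. c * DG x u v w)) (at x)"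
    by (rule has_derivative_transform_within_open[OF _ open_U x]) (simp add: bilinear_rmul[OF bil])
  then show "DG x u v (c *\<^sub>R w) = c *\<^sub>R DG x u v w" by (simp add: dird_eq)
qed

lemma linear_DG2:
  assumes x: "x \<in> U"
  shows "linear (\<lambda>v. DG x u v w)"
  using linear_DG3[OF x, where u = u and v = w] by (simp add: DG_sym[OF x, where v = w])

lemma linear_koszul: "x \<in> U \<Longrightarrow> linear (\<lambda>y. (1/2) * (DG x v w y + DG x w v y - DG x y v w))"
  using linear_compose_scale_right[OF linear_compose_sub[OF linear_compose_add[OF
        linear_DG3[where x = x and u = v and v = w] linear_DG3[where x = x and u = w and v = v]]
        linear_DG1[where x = x and v = v and w = w]], of "1/2"]
  by simp

lemma christoffel_eqI:
  assumes "x \<in> U" "\<And>y. G x z y = (1/2) * (DG x v w y + DG x w v y - DG x y v w)"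
  shows "\<Gamma> x v w = z"
  unfolding christoffel_def
proof (rule the_equality)
  fix z' assume "\<forall>y. G x z' y = (1/2) * (DG x v w y + DG x w v y - DG x y v w)"
  then have "G x z' y = G x z y" for y
    using assms(2)[of y] by metis
  then show "z' = z"
    by (rule nondegenerate_eqI[OF bil[OF assms(1)] nondeg[OF assms(1)]])
qed (use assms(2) in blast)

lemma koszul_formula:
  assumes "x \<in> U"
  shows "G x (\<Gamma> x v w) y = (1/2) * (DG x v w y + DG x w v y - DG x y v w)"
proof -
  obtain z where z: "\<forall>y. G x z y = (1/2) * (DG x v w y + DG x w v y - DG x y v w)"
    using riesz_nondegenerate[OF bil nondeg linear_koszul] assms by blast
  with christoffel_eqI[OF assms, where z = z and v = v and w = w] show ?thesis by metis
qed

lemma christoffel_sym: "x \<in> U \<Longrightarrow> \<Gamma> x v w = \<Gamma> x w v"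
  by (intro christoffel_eqI) (auto simp: koszul_formula DG_sym[where v = v and w = w])

lemma linear_christoffel:
  assumes x: "x \<in> U"
  shows "linear (\<lambda>w. \<Gamma> x v w)"
proof (rule linearI)
  fix w w' and c :: real
  show "\<Gamma> x v (w + w') = \<Gamma> x v w + \<Gamma> x v w'"
    by (rule christoffel_eqI[OF x])
       (simp add: bilinear_ladd[OF bil[OF x]] koszul_formula[OF x] linear_add[OF linear_DG1[OF x]]
         linear_add[OF linear_DG2[OF x]] linear_add[OF linear_DG3[OF x]] algebra_simps)
  show "\<Gamma> x v (c *\<^sub>R w) = c *\<^sub>R \<Gamma> x v w"
    by (rule christoffel_eqI[OF x])
       (simp add: bilinear_lmul[OF bil[OF x]] koszul_formula[OF x] linear_scale[OF linear_DG1[OF x]]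
         linear_scale[OF linear_DG2[OF x]] linear_scale[OF linear_DG3[OF x]] algebra_simps)
qed

lemma linear_christoffel_left: "x \<in> U \<Longrightarrow> linear (\<lambda>v. \<Gamma> x v w)"
  using linear_christoffel[of x w] by (simp add: christoffel_sym[of x w])

text \<open>
  The symbols solve the Koszul equations, a nondegenerate linear system with differentiable coefficients.
\<close>

lemma christoffel_differentiable:
  assumes x: "x \<in> U"
  shows "(\<lambda>x. \<Gamma> x v w) differentiable (at x)"
proof (rule nondegenerate_solution_differentiable[OF open_U x, where G = G
      and R = "\<lambda>x y. (1/2) * (DG x v w y + DG x w v y - DG x y v w)"])
  show "(\<lambda>x. (1/2) * (DG x v w y + DG x w v y - DG x y v w)) differentiable (at x)" for y
    by (intro derivative_intros DG_differentiable x)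
qed (auto simp: koszul_formula bil nondeg x G_differentiable)

text \<open>
  \<open>Ric\<^sub>v\<^sub>w = \<partial>\<^sub>e \<Gamma>\<^sup>e\<^sub>v\<^sub>w - \<partial>\<^sub>v \<Gamma>\<^sup>e\<^sub>e\<^sub>w + \<Gamma>\<^sup>e\<^sub>e\<^sub>f \<Gamma>\<^sup>f\<^sub>v\<^sub>w - \<Gamma>\<^sup>e\<^sub>v\<^sub>f \<Gamma>\<^sup>f\<^sub>e\<^sub>w\<close>, without indices.
\<close>

lemma ricci_comp_traces:
  assumes x: "x \<in> U"
  shows "ricci_comp G x v w =
    lin_trace (dird (\<lambda>x. \<Gamma> x v w) x) - dird (\<lambda>x. lin_trace (\<lambda>e. \<Gamma> x e w)) x v
    + lin_trace (\<lambda>e. \<Gamma> x e (\<Gamma> x v w)) - lin_trace (\<lambda>e. \<Gamma> x v (\<Gamma> x e w))"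
proof -
  have "((\<lambda>x. lin_trace (\<lambda>e. \<Gamma> x e w)) has_derivative
      (\<lambda>u. \<Sum>e\<in>Basis. dird (\<lambda>x. \<Gamma> x e w) x u \<bullet> e)) (at x)"
    unfolding lin_trace_def
    by (intro has_derivative_sum has_derivative_inner_left has_derivative_dird christoffel_differentiable x)
  then have "dird (\<lambda>x. lin_trace (\<lambda>e. \<Gamma> x e w)) x v = (\<Sum>e\<in>Basis. dird (\<lambda>x. \<Gamma> x e w) x v \<bullet> e)"
    by (rule dird_eq)
  then show ?thesis
    by (simp add: ricci_comp_def riemann_def lin_trace_def inner_add_left inner_diff_left
        sum.distrib sum_subtractf)
qed

lemma trace_christoffel_differentiable:
  assumes x: "x \<in> U"
  shows "(\<lambda>x. lin_trace (\<lambda>e. \<Gamma> x e w)) differentiable (at x)"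
  unfolding lin_trace_def by (intro differentiable_sum differentiable_inner differentiable_const ballI christoffel_differentiable x finite_Basis)

end

section \<open>Metrics of Kerr type in adapted coordinates\<close>

text \<open>
  Here \<open>k\<close>, \<open>A + ds\<close>, \<open>J\<close> are the base metric, the connection form and the complex structure in a
  trivialisation, and \<open>G\<close> has the components of \<open>\<sigma> g\<^sub>o + \<theta> \<or> (du + \<beta>/2 \<theta>)\<close> in the coordinates \<open>((x, s), u)\<close>.  The
  factor \<open>UNIV\<close> is the fibre of the principal bundle.
\<close>

locale kerr_coordinates =
  fixes V :: "'e::euclidean_space set" and I :: "real set"
    and k :: "'e \<Rightarrow> 'e \<Rightarrow> 'e \<Rightarrow> real" and A :: "'e \<Rightarrow> 'e \<Rightarrow> real" and J :: "'e \<Rightarrow> 'e \<Rightarrow> 'e"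
    and \<sigma> \<beta> :: "('e \<times> real) \<times> real \<Rightarrow> real"
    and G :: "('e \<times> real) \<times> real \<Rightarrow> ('e \<times> real) \<times> real \<Rightarrow> ('e \<times> real) \<times> real \<Rightarrow> real"
  assumes open_V: "open V" and open_I: "open I"
    and k_bil: "\<And>x. x \<in> V \<Longrightarrow> bilinear (k x)"
    and k_sym: "\<And>x v w. x \<in> V \<Longrightarrow> k x v w = k x w v"
    and k_pos: "\<And>x v. x \<in> V \<Longrightarrow> v \<noteq> 0 \<Longrightarrow> k x v v > 0"
    and k_C2: "\<And>v w. Ck_on (Suc (Suc 0)) V (\<lambda>x. k x v w)"
    and A_linear: "\<And>x. x \<in> V \<Longrightarrow> linear (A x)"
    and A_C2: "\<And>v. Ck_on (Suc (Suc 0)) V (\<lambda>x. A x v)"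
    and J_linear: "\<And>x. x \<in> V \<Longrightarrow> linear (J x)"
    and J_diff: "\<And>x v. x \<in> V \<Longrightarrow> (\<lambda>x. J x v) differentiable (at x)"
    and J_square: "\<And>x v. x \<in> V \<Longrightarrow> J x (J x v) = - v"
    and J_isometry: "\<And>x v w. x \<in> V \<Longrightarrow> k x (J x v) (J x w) = k x v w"
    and dA: "\<And>x v w. x \<in> V \<Longrightarrow> dird (\<lambda>x. A x w) x v - dird (\<lambda>x. A x v) x w = k x (J x v) w"
    and \<sigma>_C2: "Ck_on (Suc (Suc 0)) ((V \<times> UNIV) \<times> I) \<sigma>"
    and \<beta>_C2: "Ck_on (Suc (Suc 0)) ((V \<times> UNIV) \<times> I) \<beta>"
    and \<sigma>_nz: "\<And>y. y \<in> (V \<times> UNIV) \<times> I \<Longrightarrow> \<sigma> y \<noteq> 0"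
    and G_eq: "\<And>y v w. y \<in> (V \<times> UNIV) \<times> I \<Longrightarrow> G y v w =
        \<sigma> y * k (fst (fst y)) (fst (fst v)) (fst (fst w))
        + (1/2) * ((A (fst (fst y)) (fst (fst v)) + snd (fst v))
             * (snd w + \<beta> y / 2 * (A (fst (fst y)) (fst (fst w)) + snd (fst w)))
           + (snd v + \<beta> y / 2 * (A (fst (fst y)) (fst (fst v)) + snd (fst v)))
             * (A (fst (fst y)) (fst (fst w)) + snd (fst w)))"
begin

definition U where "U = (V \<times> (UNIV :: real set)) \<times> I"

abbreviation bs :: "('e \<times> real) \<times> real \<Rightarrow> 'e" where "bs y \<equiv> fst (fst y)"

definition \<theta> :: "'e \<Rightarrow> ('e \<times> real) \<times> real \<Rightarrow> real" where
  "\<theta> x v = A x (bs v) + snd (fst v)"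

definition p :: "('e \<times> real) \<times> real" where "p = ((0, 0), 1)"
definition q :: "('e \<times> real) \<times> real" where "q = ((0, 1), 0)"

definition lift :: "'e \<Rightarrow> 'e \<Rightarrow> ('e \<times> real) \<times> real" where
  "lift x v = ((v, - A x v), 0)"

lemma open_U: "open U"
  unfolding U_def by (intro open_Times open_V open_I open_UNIV)

lemma bs_in: "y \<in> U \<Longrightarrow> bs y \<in> V"
  by (auto simp: U_def)

lemma k_nondeg: "x \<in> V \<Longrightarrow> nondegenerate (k x)"
  unfolding nondegenerate_def by (metis k_pos less_irrefl)

lemma G_formula: "y \<in> U \<Longrightarrow> G y v w = \<sigma> y * k (bs y) (bs v) (bs w)
    + (1/2) * (\<theta> (bs y) v * (snd w + \<beta> y / 2 * \<theta> (bs y) w) + (snd v + \<beta> y / 2 * \<theta> (bs y) v) * \<theta> (bs y) w)"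
  using G_eq unfolding U_def \<theta>_def by simp

lemma Ck_on_base:
  assumes "Ck_on n V f"
  shows "Ck_on n U (\<lambda>y. f (bs y))"
  using bs_in by (intro Ck_on_compose[OF open_U open_V _ _ assms] Ck_on_linear open_U)
    (auto simp: linear_iff)

lemma Ck_on_mult: 
  fixes f g :: "('e \<times> real) \<times> real \<Rightarrow> real"
  assumes "Ck_on n U f" "Ck_on n U g"
  shows "Ck_on n U (\<lambda>y. f y * g y)"
  using Ck_on_scaleR[OF open_U assms] by simp

lemma \<theta>_linear: "x \<in> V \<Longrightarrow> linear (\<theta> x)"
  unfolding \<theta>_def by (intro linearI) (auto simp: linear_add[OF A_linear] linear_scale[OF A_linear] algebra_simps)

lemma G_C2: "Ck_on (Suc (Suc 0)) U (\<lambda>y. G y v w)"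
proof (rule Ck_on_cong[OF open_U G_formula[symmetric]])
  have \<theta>: "Ck_on (Suc (Suc 0)) U (\<lambda>y. \<theta> (bs y) v)" for v
    unfolding \<theta>_def by (intro Ck_on_add open_U Ck_on_base A_C2 Ck_on_const)
  have s: "Ck_on (Suc (Suc 0)) U \<sigma>" "Ck_on (Suc (Suc 0)) U \<beta>" using \<sigma>_C2 \<beta>_C2 by (auto simp: U_def)
  show "Ck_on (Suc (Suc 0)) U (\<lambda>y. \<sigma> y * k (bs y) (bs v) (bs w)
    + (1/2) * (\<theta> (bs y) v * (snd w + \<beta> y / 2 * \<theta> (bs y) w) + (snd v + \<beta> y / 2 * \<theta> (bs y) v) * \<theta> (bs y) w))"
    unfolding divide_inverse
    by (intro Ck_on_add Ck_on_mult open_U \<theta> s Ck_on_const Ck_on_base k_C2)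
qed

sublocale base: metric_components V k
  by unfold_locales (use open_V k_bil k_sym k_nondeg k_C2 in auto)

lemma G_bil: "y \<in> U \<Longrightarrow> bilinear (G y)"
  unfolding bilinear_def using bs_in[of y]
  by (intro conjI allI linearI) (simp_all add: G_formula linear_add[OF \<theta>_linear] linear_scale[OF \<theta>_linear]
      bilinear_ladd[OF k_bil] bilinear_radd[OF k_bil] bilinear_lmul[OF k_bil] bilinear_rmul[OF k_bil] field_simps)

lemma p_simps [simp]: "bs p = 0" "snd p = 1" "snd (fst p) = 0" "x \<in> V \<Longrightarrow> \<theta> x p = 0"
  using linear_0[OF A_linear] by (auto simp: p_def \<theta>_def)

lemma q_simps [simp]: "bs q = 0" "snd q = 0" "snd (fst q) = 1" "x \<in> V \<Longrightarrow> \<theta> x q = 1"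
  using linear_0[OF A_linear] by (auto simp: q_def \<theta>_def)

lemma lift_simps [simp]: "bs (lift x v) = v" "snd (lift x v) = 0" "\<theta> x (lift x v) = 0"
  by (auto simp: lift_def \<theta>_def)

lemma k_zero [simp]: "x \<in> V \<Longrightarrow> k x 0 v = 0" "x \<in> V \<Longrightarrow> k x v 0 = 0"
  by (auto simp: bilinear_lzero bilinear_rzero k_bil)

lemma decompose:
  assumes "x \<in> V"
  shows "v = lift x (bs v) + \<theta> x v *\<^sub>R q + snd v *\<^sub>R p"
  by (cases v) (auto simp: lift_def \<theta>_def q_def p_def zero_prod_def)

lemma G_p: "y \<in> U \<Longrightarrow> G y z p = \<theta> (bs y) z / 2"
  using bs_in by (simp add: G_formula)

lemma G_lift: "y \<in> U \<Longrightarrow> G y z (lift (bs y) w) = \<sigma> y * k (bs y) (bs z) w"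
  using bs_in by (simp add: G_formula)

text \<open>
  Pairing with \<open>p\<close>, with horizontal lifts and with \<open>q\<close> recovers the components of a vector one after the other.
\<close>

lemma G_nondeg:
  assumes y: "y \<in> U"
  shows "nondegenerate (G y)"
  unfolding nondegenerate_def
proof (intro allI impI)
  fix z assume z: "\<forall>w. G y z w = 0"
  have \<theta>: "\<theta> (bs y) z = 0" using G_p[OF y, of z] z by simp
  have "G y z (lift (bs y) (bs z)) = 0" using z by blast
  then have "bs z = 0"
    using \<sigma>_nz[of y] k_pos[OF bs_in[OF y], of "bs z"] y unfolding G_lift[OF y] U_def by auto
  moreover have "snd z = 0"
    using z[rule_format, of q] \<theta> bs_in[OF y] by (simp add: G_formula[OF y])
  ultimately show "z = 0"
    using \<theta> decompose[OF bs_in[OF y], of z] linear_0[OF A_linear[OF bs_in[OF y]]]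
    by (auto simp: lift_def zero_prod_def)
qed

sublocale metric_components U G
proof
  show "G y v w = G y w v" if "y \<in> U" for y v w
    using that k_sym[OF bs_in[OF that], of "bs v"] by (simp add: G_formula algebra_simps)
qed (use open_U G_bil G_nondeg G_C2 in auto)

abbreviation "Dk x u v w \<equiv> dird (\<lambda>x. k x v w) x u"
abbreviation "DA x u v \<equiv> dird (\<lambda>x. A x v) x u"

lemma bs_has_derivative: "(bs has_derivative bs) (at y)"
  by (intro bounded_linear_imp_has_derivative) (simp add: bounded_linear_fst_comp bounded_linear_fst)

lemma base_has_derivative:
  assumes "f differentiable (at (bs y))"
  shows "((\<lambda>y. f (bs y)) has_derivative (\<lambda>u. dird f (bs y) (bs u))) (at y)"
  using has_derivative_compose[OF bs_has_derivative has_derivative_dird[OF assms]] .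

lemma differentiable_data:
  assumes "y \<in> U"
  shows "\<sigma> differentiable (at y)" "\<beta> differentiable (at y)"
    "(\<lambda>y. dird \<sigma> y u) differentiable (at y)" "(\<lambda>y. dird \<beta> y u) differentiable (at y)"
    "(\<lambda>x. A x v) differentiable (at (bs y))" "(\<lambda>x. k x v w) differentiable (at (bs y))"
  using assms by (auto intro: C2_differentiable \<sigma>_C2 \<beta>_C2 A_C2 k_C2 bs_in simp: U_def)

lemma \<theta>_has_derivative:
  assumes "y \<in> U"
  shows "((\<lambda>y. \<theta> (bs y) v) has_derivative (\<lambda>u. DA (bs y) (bs u) (bs v))) (at y)"
  unfolding \<theta>_def using has_derivative_add_const[OF base_has_derivative[OF differentiable_data(5)[OF assms]]] .

lemma DG_eq:
  assumes y: "y \<in> U"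
  shows "DG y u v w = dird \<sigma> y u * k (bs y) (bs v) (bs w) + \<sigma> y * Dk (bs y) (bs u) (bs v) (bs w)
    + (1/2) * (DA (bs y) (bs u) (bs v) * (snd w + \<beta> y / 2 * \<theta> (bs y) w)
      + \<theta> (bs y) v * (dird \<beta> y u / 2 * \<theta> (bs y) w + \<beta> y / 2 * DA (bs y) (bs u) (bs w))
      + (dird \<beta> y u / 2 * \<theta> (bs y) v + \<beta> y / 2 * DA (bs y) (bs u) (bs v)) * \<theta> (bs y) w
      + (snd v + \<beta> y / 2 * \<theta> (bs y) v) * DA (bs y) (bs u) (bs w))"
proof -
  note d = differentiable_data[OF y, THEN has_derivative_dird]
  have "((\<lambda>y. \<sigma> y * k (bs y) (bs v) (bs w)
    + (1/2) * (\<theta> (bs y) v * (snd w + \<beta> y / 2 * \<theta> (bs y) w) + (snd v + \<beta> y / 2 * \<theta> (bs y) v) * \<theta> (bs y) w))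
    has_derivative (\<lambda>u. dird \<sigma> y u * k (bs y) (bs v) (bs w) + \<sigma> y * Dk (bs y) (bs u) (bs v) (bs w)
    + (1/2) * (DA (bs y) (bs u) (bs v) * (snd w + \<beta> y / 2 * \<theta> (bs y) w)
      + \<theta> (bs y) v * (dird \<beta> y u / 2 * \<theta> (bs y) w + \<beta> y / 2 * DA (bs y) (bs u) (bs w))
      + (dird \<beta> y u / 2 * \<theta> (bs y) v + \<beta> y / 2 * DA (bs y) (bs u) (bs v)) * \<theta> (bs y) w
      + (snd v + \<beta> y / 2 * \<theta> (bs y) v) * DA (bs y) (bs u) (bs w)))) (at y)"
    by (auto intro!: derivative_eq_intros d(1,2) \<theta>_has_derivative y
        base_has_derivative[OF differentiable_data(6)[OF y]] simp: algebra_simps)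
  from has_derivative_transform_within_open[OF this open_U y G_formula[symmetric]]
  show ?thesis by (rule dird_eq)
qed

lemma D_zero [simp]:
  assumes "x \<in> V"
  shows "DA x 0 v = 0" "DA x u 0 = 0" "Dk x 0 v w = 0" "Dk x u 0 w = 0" "Dk x u v 0 = 0"
proof -
  have lA: "linear (\<lambda>u. DA x u v)"
    using A_C2[of v] assms by (intro linear_frechet_derivative) simp
  show "DA x 0 v = 0" using linear_0[OF lA] .
  have "dird (\<lambda>x. A x 0) x = dird (\<lambda>x. 0) x"
    by (rule dird_transform[OF open_V assms]) (auto simp: linear_0[OF A_linear])
  then show "DA x u 0 = 0" by simp
  show "Dk x 0 v w = 0" using linear_0[OF base.linear_DG1[OF assms]] .
  show "Dk x u 0 w = 0" using linear_0[OF base.linear_DG2[OF assms]] .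
  show "Dk x u v 0 = 0" using linear_0[OF base.linear_DG3[OF assms]] .
qed

text \<open>The expansion and the twist of the congruence of null geodesics generated by \<open>p\<close>.\<close>

definition a where "a y = dird \<sigma> y p / (2 * \<sigma> y)"
definition b where "b y = 1 / (4 * \<sigma> y)"

definition P where "P y v = a y *\<^sub>R v + b y *\<^sub>R J (bs y) v"

lemma \<sigma>_nonzero: "y \<in> U \<Longrightarrow> \<sigma> y \<noteq> 0"
  using \<sigma>_nz by (simp add: U_def)

text \<open>
  Since \<open>G(p, \<cdot>) = \<theta>/2\<close>, the antisymmetric part of \<open>\<nabla>p\<close> is \<open>d\<theta>/4\<close>, which is \<open>\<omega>\<^sub>o/4\<close> and produces the term with \<open>J\<close>; the
  symmetric part is \<open>\<partial>\<^sub>u G / 2\<close>.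
\<close>

lemma christoffel_p:
  assumes y: "y \<in> U"
  shows "\<Gamma> y p v = lift (bs y) (P y (bs v)) + (dird \<beta> y p / 2 * \<theta> (bs y) v) *\<^sub>R p"
proof (rule christoffel_eqI[OF y])
  fix w
  note x = bs_in[OF y]
  have s: "\<sigma> y \<noteq> 0" using \<sigma>_nonzero[OF y] .
  have "\<theta> (bs y) (lift (bs y) (P y (bs v)) + (dird \<beta> y p / 2 * \<theta> (bs y) v) *\<^sub>R p) = 0"
    by (simp add: linear_add[OF \<theta>_linear[OF x]] linear_scale[OF \<theta>_linear[OF x]] x)
  moreover have "k (bs y) (P y (bs v)) (bs w)
      = a y * k (bs y) (bs v) (bs w) + b y * (DA (bs y) (bs v) (bs w) - DA (bs y) (bs w) (bs v))"
    by (simp add: P_def bilinear_ladd[OF k_bil[OF x]] bilinear_lmul[OF k_bil[OF x]] dA[OF x])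
  ultimately show "G y (lift (bs y) (P y (bs v)) + (dird \<beta> y p / 2 * \<theta> (bs y) v) *\<^sub>R p) w
      = (1/2) * (DG y p v w + DG y v p w - DG y w p v)"
    using s by (simp add: G_formula[OF y] DG_eq[OF y] x a_def b_def field_simps)
qed

text \<open>
  The frame consists of the horizontal lifts, \<open>q\<close> and \<open>p\<close>; its dual is \<open>bs\<close>, \<open>\<theta>\<close> and the last coordinate.
\<close>

lemma lin_trace_frame:
  assumes T: "linear T" and x: "x \<in> V"
  shows "lin_trace T = lin_trace (\<lambda>v. bs (T (lift x v))) + \<theta> x (T q) + snd (T p)"
proof -
  have split: "T ((v, 0), 0) = T (lift x v) + A x v *\<^sub>R T q" for v
  proof -
    have "((v, 0), 0) = lift x v + A x v *\<^sub>R q" by (simp add: lift_def q_def)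
    then show ?thesis by (simp add: linear_add[OF T] linear_scale[OF T])
  qed
  have "lin_trace T = lin_trace (\<lambda>v. bs (T ((v, 0), 0))) + snd (fst (T q)) + snd (T p)"
    by (subst lin_trace_prod, subst lin_trace_prod) (simp add: lin_trace_real p_def q_def zero_prod_def)
  also have "lin_trace (\<lambda>v. bs (T ((v, 0), 0))) = lin_trace (\<lambda>v. bs (T (lift x v))) + A x (bs (T q))"
    by (simp add: split lin_trace_add lin_trace_rank_one[OF A_linear[OF x]])
  finally show ?thesis by (simp add: \<theta>_def)
qed

lemma J_skew: "x \<in> V \<Longrightarrow> k x (J x v) w = - k x v (J x w)"
  using J_isometry[of x v "J x w"] by (simp add: J_square bilinear_rneg[OF k_bil])

lemma trace_J: "x \<in> V \<Longrightarrow> lin_trace (J x) = 0"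
  by (rule lin_trace_skew[of "k x"]) (fact k_bil k_nondeg k_sym J_linear J_skew)+

lemma linear_dird_\<sigma>_lift: "y \<in> U \<Longrightarrow> linear (\<lambda>v. dird \<sigma> y (lift (bs y) v))"
proof -
  assume y: "y \<in> U"
  have "linear (lift (bs y))"
    using A_linear[OF bs_in[OF y]] by (intro linearI) (auto simp: lift_def linear_add linear_scale)
  from linear_compose[OF this linear_frechet_derivative[OF differentiable_data(1)[OF y]]]
  show ?thesis by (simp add: o_def)
qed

lemma gradient_exists:
  assumes y: "y \<in> U"
  obtains grad where "\<And>v. k (bs y) grad v = dird \<sigma> y (lift (bs y) v)"
  using riesz_nondegenerate[OF k_bil k_nondeg linear_dird_\<sigma>_lift[OF y]] bs_in[OF y] by blast

text \<open>
  Apart from the last term, this is the formula for the conformal change from \<open>k\<close> to \<open>\<sigma> k\<close>, with the derivatives of \<open>\<sigma>\<close>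
  taken on the total space.  The last term is there because horizontal lifts do not commute.
\<close>

lemma christoffel_horizontal:
  assumes y: "y \<in> U" and grad: "\<And>v. k (bs y) grad v = dird \<sigma> y (lift (bs y) v)"
  shows "bs (\<Gamma> y (lift (bs y) v) X) = base.\<Gamma> (bs y) v (bs X)
    + (1 / (2 * \<sigma> y)) *\<^sub>R (dird \<sigma> y X *\<^sub>R v + dird \<sigma> y (lift (bs y) v) *\<^sub>R bs X - k (bs y) (bs X) v *\<^sub>R grad)
    + ((snd X + \<beta> y * \<theta> (bs y) X) / (4 * \<sigma> y)) *\<^sub>R J (bs y) v"
proof (rule nondegenerate_eqI[of "k (bs y)"])
  fix w
  note x = bs_in[OF y]
  have s: "\<sigma> y \<noteq> 0" using \<sigma>_nonzero[OF y] .
  have "\<sigma> y * k (bs y) (bs (\<Gamma> y (lift (bs y) v) X)) w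
      = (1/2) * (DG y (lift (bs y) v) X (lift (bs y) w) + DG y X (lift (bs y) v) (lift (bs y) w)
          - DG y (lift (bs y) w) (lift (bs y) v) X)"
    using koszul_formula[OF y, of "lift (bs y) v" X "lift (bs y) w"] by (simp add: G_lift[OF y])
  also have "\<dots> = \<sigma> y * k (bs y) (base.\<Gamma> (bs y) v (bs X)) w
     + (1/2) * (dird \<sigma> y X * k (bs y) v w + dird \<sigma> y (lift (bs y) v) * k (bs y) (bs X) w
         - dird \<sigma> y (lift (bs y) w) * k (bs y) v (bs X))
     + ((snd X + \<beta> y * \<theta> (bs y) X) / 4) * (DA (bs y) v w - DA (bs y) w v)"
    by (simp add: DG_eq[OF y] base.koszul_formula[OF x] x field_simps)
  also have "\<dots> = \<sigma> y * k (bs y) (base.\<Gamma> (bs y) v (bs X)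
    + (1 / (2 * \<sigma> y)) *\<^sub>R (dird \<sigma> y X *\<^sub>R v + dird \<sigma> y (lift (bs y) v) *\<^sub>R bs X - k (bs y) (bs X) v *\<^sub>R grad)
    + ((snd X + \<beta> y * \<theta> (bs y) X) / (4 * \<sigma> y)) *\<^sub>R J (bs y) v) w"
    using s unfolding dA[OF x]
    by (simp add: bilinear_ladd[OF k_bil[OF x]] bilinear_lmul[OF k_bil[OF x]] bilinear_lsub[OF k_bil[OF x]]
        grad k_sym[OF x, of "bs X" v] field_simps)
  finally show "k (bs y) (bs (\<Gamma> y (lift (bs y) v) X)) w =
     k (bs y) (base.\<Gamma> (bs y) v (bs X)
    + (1 / (2 * \<sigma> y)) *\<^sub>R (dird \<sigma> y X *\<^sub>R v + dird \<sigma> y (lift (bs y) v) *\<^sub>R bs X - k (bs y) (bs X) v *\<^sub>R grad)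
    + ((snd X + \<beta> y * \<theta> (bs y) X) / (4 * \<sigma> y)) *\<^sub>R J (bs y) v) w"
    using s by simp
qed (use bs_in[OF y] k_bil k_nondeg in auto)

text \<open>
  This is half the logarithmic derivative of \<open>det G\<close>, a constant multiple of \<open>\<sigma>\<^sup>d det k\<close> for \<open>d = DIM('e)\<close>.
\<close>

lemma trace_christoffel:
  assumes y: "y \<in> U"
  shows "lin_trace (\<lambda>e. \<Gamma> y e X) =
    lin_trace (\<lambda>e. base.\<Gamma> (bs y) e (bs X)) + DIM('e) / 2 * (dird \<sigma> y X / \<sigma> y)"
proof -
  note x = bs_in[OF y]
  obtain grad where grad: "\<And>v. k (bs y) grad v = dird \<sigma> y (lift (bs y) v)"
    using gradient_exists[OF y] by blast
  have kl: "linear (\<lambda>v. k (bs y) (bs X) v)" using k_bil[OF x] by (simp add: bilinear_def)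
  have kg: "k (bs y) (bs X) grad = dird \<sigma> y (lift (bs y) (bs X))"
    using grad k_sym[OF x, of "bs X" grad] by simp
  have "lin_trace (\<lambda>v. bs (\<Gamma> y (lift (bs y) v) X)) =
      lin_trace (\<lambda>e. base.\<Gamma> (bs y) e (bs X)) + DIM('e) / 2 * (dird \<sigma> y X / \<sigma> y)"
    by (simp add: christoffel_horizontal[OF y grad] lin_trace_add lin_trace_scaleR lin_trace_diff
        lin_trace_id lin_trace_rank_one[OF kl] lin_trace_rank_one[OF linear_dird_\<sigma>_lift[OF y]]
        trace_J[OF x] kg)
  moreover have "\<theta> (bs y) (\<Gamma> y q X) = - (dird \<beta> y p / 2 * \<theta> (bs y) X)"
  proof -
    have "\<theta> (bs y) (\<Gamma> y q X) = 2 * G y (\<Gamma> y q X) p" by (simp add: G_p[OF y])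
    also have "\<dots> = - (dird \<beta> y p / 2 * \<theta> (bs y) X)"
      by (simp add: koszul_formula[OF y] DG_eq[OF y] x)
    finally show ?thesis .
  qed
  moreover have "snd (\<Gamma> y p X) = dird \<beta> y p / 2 * \<theta> (bs y) X"
    by (simp add: christoffel_p[OF y])
  ultimately show ?thesis
    using lin_trace_frame[OF linear_christoffel_left[OF y] x, of X] by simp
qed

end

section \<open>The Ricci curvature in the direction of \<open>p\<close>\<close>

context kerr_coordinates
begin

lemma a_has_derivative:
  assumes y: "y \<in> U"
  shows "(a has_derivative (\<lambda>u. (dird (\<lambda>y. dird \<sigma> y p) y u * \<sigma> y - dird \<sigma> y p * dird \<sigma> y u) / (2 * (\<sigma> y)\<^sup>2))) (at y)"
proof -
  have "((\<lambda>y. dird \<sigma> y p / (2 * \<sigma> y)) has_derivative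
    (\<lambda>u. (dird (\<lambda>y. dird \<sigma> y p) y u * (2 * \<sigma> y) - dird \<sigma> y p * (2 * dird \<sigma> y u)) / ((2 * \<sigma> y) * (2 * \<sigma> y)))) (at y)"
    by (intro has_derivative_divide' has_derivative_mult_right has_derivative_dird differentiable_data y)
       (use \<sigma>_nonzero[OF y] in simp)
  moreover have "(\<lambda>y. dird \<sigma> y p / (2 * \<sigma> y)) = a"
    by (simp add: a_def fun_eq_iff)
  moreover have "(\<lambda>u. (dird (\<lambda>y. dird \<sigma> y p) y u * (2 * \<sigma> y) - dird \<sigma> y p * (2 * dird \<sigma> y u)) / ((2 * \<sigma> y) * (2 * \<sigma> y)))
      = (\<lambda>u. (dird (\<lambda>y. dird \<sigma> y p) y u * \<sigma> y - dird \<sigma> y p * dird \<sigma> y u) / (2 * (\<sigma> y)\<^sup>2))"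
    using \<sigma>_nonzero[OF y] by (simp add: fun_eq_iff field_simps power2_eq_square)
  ultimately show ?thesis by simp
qed

lemma b_has_derivative:
  assumes y: "y \<in> U"
  shows "(b has_derivative (\<lambda>u. - dird \<sigma> y u / (4 * (\<sigma> y)\<^sup>2))) (at y)"
proof -
  have "((\<lambda>y. 1 / (4 * \<sigma> y)) has_derivative
    (\<lambda>u. (0 * (4 * \<sigma> y) - 1 * (4 * dird \<sigma> y u)) / ((4 * \<sigma> y) * (4 * \<sigma> y)))) (at y)"
    by (intro has_derivative_divide' has_derivative_mult_right has_derivative_const has_derivative_dird differentiable_data y)
       (use \<sigma>_nonzero[OF y] in simp)
  moreover have "(\<lambda>y. 1 / (4 * \<sigma> y)) = b"
    by (simp add: b_def fun_eq_iff)
  ultimately show ?thesis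
    using \<sigma>_nonzero[OF y] by (simp add: field_simps power2_eq_square)
qed

lemma differentiable_ab: "y \<in> U \<Longrightarrow> a differentiable (at y)" "y \<in> U \<Longrightarrow> b differentiable (at y)"
  unfolding differentiable_def using a_has_derivative b_has_derivative by blast+

lemma Db: "y \<in> U \<Longrightarrow> dird b y u = - (b y / \<sigma> y) * dird \<sigma> y u"
  using dird_eq[OF b_has_derivative] by (simp add: b_def power2_eq_square)

text \<open>
  Both sides are the mixed second derivative of \<open>ln \<bar>\<sigma>\<bar>\<close> along the vectors \<open>u\<close> and \<open>p\<close>.
\<close>

lemma Da_eq:
  assumes y: "y \<in> U"
  shows "dird (\<lambda>y. dird \<sigma> y u / \<sigma> y) y p = 2 * dird a y u"
proof -
  have "((\<lambda>y. dird \<sigma> y u / \<sigma> y) has_derivative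
    (\<lambda>v. (dird (\<lambda>y. dird \<sigma> y u) y v * \<sigma> y - dird \<sigma> y u * dird \<sigma> y v) / (\<sigma> y * \<sigma> y))) (at y)"
    by (intro has_derivative_divide' has_derivative_dird differentiable_data y \<sigma>_nonzero)
  then have "dird (\<lambda>y. dird \<sigma> y u / \<sigma> y) y p =
      (dird (\<lambda>y. dird \<sigma> y u) y p * \<sigma> y - dird \<sigma> y u * dird \<sigma> y p) / (\<sigma> y * \<sigma> y)"
    by (rule dird_eq)
  also have "dird (\<lambda>y. dird \<sigma> y u) y p = dird (\<lambda>y. dird \<sigma> y p) y u"
    using dird_dird_commute[OF open_U y] \<sigma>_C2 by (simp add: U_def)
  finally show ?thesis
    using \<sigma>_nonzero[OF y] by (simp add: dird_eq[OF a_has_derivative[OF y]] power2_eq_square field_simps)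
qed

definition div_J :: "'e \<Rightarrow> 'e \<Rightarrow> real" where
  "div_J x v = lin_trace (dird (\<lambda>x. J x v) x)"

lemma A_expand: "x \<in> V \<Longrightarrow> A x v = (\<Sum>e\<in>Basis. (v \<bullet> e) * A x e)"
  using linear_sum[OF A_linear, of x "\<lambda>e. (v \<bullet> e) *\<^sub>R e" Basis]
  by (simp add: euclidean_representation linear_scale[OF A_linear])

lemma AJ_differentiable:
  assumes "x \<in> V"
  shows "(\<lambda>x. A x (J x v)) differentiable (at x)"
proof (rule differentiable_transform[OF open_V assms A_expand[symmetric]])
  have "(\<lambda>x. A x e) differentiable (at x)" for e
    using A_C2 assms by (rule C2_differentiable)
  then show "(\<lambda>x. \<Sum>e\<in>Basis. (J x v \<bullet> e) * A x e) differentiable (at x)"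
    by (intro differentiable_sum differentiable_mult differentiable_inner differentiable_const
        ballI finite_Basis J_diff assms)
qed

lemma christoffel_p_has_derivative:
  assumes y: "y \<in> U"
  shows "((\<lambda>y. \<Gamma> y p X) has_derivative (\<lambda>u.
      ((dird a y u *\<^sub>R bs X + (b y *\<^sub>R dird (\<lambda>x. J x (bs X)) (bs y) (bs u) + dird b y u *\<^sub>R J (bs y) (bs X)),
        - ((a y * DA (bs y) (bs u) (bs X) + dird a y u * A (bs y) (bs X))
           + (b y * dird (\<lambda>x. A x (J x (bs X))) (bs y) (bs u) + dird b y u * A (bs y) (J (bs y) (bs X))))),
       dird \<beta> y p / 2 * DA (bs y) (bs u) (bs X) + dird (\<lambda>y. dird \<beta> y p) y u / 2 * \<theta> (bs y) X))) (at y)"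
proof (rule has_derivative_transform_within_open[OF _ open_U y])
  show "((\<lambda>y. ((a y *\<^sub>R bs X + b y *\<^sub>R J (bs y) (bs X),
        - (a y * A (bs y) (bs X) + b y * A (bs y) (J (bs y) (bs X)))),
        dird \<beta> y p / 2 * \<theta> (bs y) X)) has_derivative (\<lambda>u.
      ((dird a y u *\<^sub>R bs X + (b y *\<^sub>R dird (\<lambda>x. J x (bs X)) (bs y) (bs u) + dird b y u *\<^sub>R J (bs y) (bs X)),
        - ((a y * DA (bs y) (bs u) (bs X) + dird a y u * A (bs y) (bs X))
           + (b y * dird (\<lambda>x. A x (J x (bs X))) (bs y) (bs u) + dird b y u * A (bs y) (J (bs y) (bs X))))),
       dird \<beta> y p / 2 * DA (bs y) (bs u) (bs X) + dird (\<lambda>y. dird \<beta> y p) y u / 2 * \<theta> (bs y) X))) (at y)"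
    unfolding divide_inverse
    by (intro has_derivative_Pair has_derivative_add has_derivative_scaleR_left has_derivative_scaleR
        has_derivative_minus has_derivative_mult has_derivative_mult_left has_derivative_dird base_has_derivative
        differentiable_ab AJ_differentiable J_diff bs_in y \<theta>_has_derivative differentiable_data)
next
  fix z assume z: "z \<in> U"
  show "((a z *\<^sub>R bs X + b z *\<^sub>R J (bs z) (bs X),
        - (a z * A (bs z) (bs X) + b z * A (bs z) (J (bs z) (bs X)))),
        dird \<beta> z p / 2 * \<theta> (bs z) X) = \<Gamma> z p X"
    by (simp add: prod_eq_iff christoffel_p[OF z] lift_def P_def linear_add[OF A_linear[OF bs_in[OF z]]]
        linear_scale[OF A_linear[OF bs_in[OF z]]])
qed

lemma linear_lift: "x \<in> V \<Longrightarrow> linear (lift x)"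
  by (intro linearI) (auto simp: lift_def linear_add[OF A_linear] linear_scale[OF A_linear])

text \<open>
  The first term of the Ricci tensor is the divergence of the vector field \<open>lift (P (bs X))\<close>.
\<close>

lemma trace_derivative_christoffel_p:
  assumes y: "y \<in> U" and X: "\<theta> (bs y) X = 0"
  shows "lin_trace (dird (\<lambda>y. \<Gamma> y p X) y) =
    dird a y (lift (bs y) (bs X)) + dird b y (lift (bs y) (J (bs y) (bs X))) + b y * div_J (bs y) (bs X)"
proof -
  note x = bs_in[OF y]
  note hd = christoffel_p_has_derivative[OF y, of X]
  have lin: "linear (dird (\<lambda>y. \<Gamma> y p X) y)"
    using hd by (intro linear_frechet_derivative) (auto simp: differentiable_def)
  have l: "linear (\<lambda>v. dird f y (lift (bs y) v))" if "f differentiable (at y)" for f :: "_ \<Rightarrow> real"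
    using linear_compose[OF linear_lift[OF x] linear_frechet_derivative[OF that]] by (simp add: o_def)
  have DJ0: "dird (\<lambda>x. J x (bs X)) (bs y) 0 = 0" "dird (\<lambda>x. A x (J x (bs X))) (bs y) 0 = 0"
    using linear_0[OF linear_frechet_derivative[OF J_diff[OF x]]]
      linear_0[OF linear_frechet_derivative[OF AJ_differentiable[OF x]]] by auto
  have 1: "lin_trace (\<lambda>v. bs (dird (\<lambda>y. \<Gamma> y p X) y (lift (bs y) v))) =
    dird a y (lift (bs y) (bs X)) + dird b y (lift (bs y) (J (bs y) (bs X))) + b y * div_J (bs y) (bs X)"
    by (simp add: dird_eq[OF hd] lin_trace_add lin_trace_scaleR div_J_def
        lin_trace_rank_one[OF l[OF differentiable_ab(1)[OF y]]] lin_trace_rank_one[OF l[OF differentiable_ab(2)[OF y]]])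
  have 2: "\<theta> (bs y) (dird (\<lambda>y. \<Gamma> y p X) y q) = 0"
    by (simp add: dird_eq[OF hd] \<theta>_def x DJ0 linear_add[OF A_linear[OF x]] linear_scale[OF A_linear[OF x]])
  have 3: "snd (dird (\<lambda>y. \<Gamma> y p X) y p) = 0"
    by (simp add: dird_eq[OF hd] x X)
  show ?thesis
    using lin_trace_frame[OF lin x] 1 2 3 by simp
qed

text \<open>The coefficient of \<open>b\<close> left over from the base: the divergence of \<open>J\<close> with respect to \<open>k\<close>, applied to \<open>v\<close>.\<close>

definition base_term :: "'e \<Rightarrow> 'e \<Rightarrow> real" where
  "base_term x v = div_J x v + lin_trace (\<lambda>e. base.\<Gamma> x e (J x v)) - lin_trace (\<lambda>e. J x (base.\<Gamma> x e v))"

text \<open>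
  The vector \<open>X\<close> lies in \<open>W\<^sub>o\<close>: it is the sum of the lift of \<open>bs X\<close> and of \<open>snd X\<close> times \<open>p\<close>.  The Christoffel
  symbols of \<open>k\<close> cancel, except for those in \<open>base_term\<close>.
\<close>

lemma ricci_p:
  assumes y: "y \<in> U" and X: "\<theta> (bs y) X = 0"
  shows "ricci_comp G y p X =
     dird a y (lift (bs y) (bs X)) - real DIM('e) * dird a y X
     + dird b y (lift (bs y) (J (bs y) (bs X))) + b y * base_term (bs y) (bs X)
     + real DIM('e) / (2 * \<sigma> y) * dird \<sigma> y (lift (bs y) (P y (bs X)))
     - real DIM('e) * a y / (2 * \<sigma> y) * dird \<sigma> y X
     - b y / \<sigma> y * dird \<sigma> y (lift (bs y) (J (bs y) (bs X)))
     + real DIM('e) * b y * snd X / (4 * \<sigma> y)"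
proof -
  note x = bs_in[OF y]
  obtain grad where grad: "\<And>v. k (bs y) grad v = dird \<sigma> y (lift (bs y) v)"
    using gradient_exists[OF y] by blast
  have dS: "dird (\<lambda>y. lin_trace (\<lambda>e. \<Gamma> y e X)) y p = real DIM('e) * dird a y X"
  proof -
    have "((\<lambda>y. dird \<sigma> y X / \<sigma> y) has_derivative dird (\<lambda>y. dird \<sigma> y X / \<sigma> y) y) (at y)"
      by (intro has_derivative_dird differentiable_divide differentiable_data y \<sigma>_nonzero)
    then have "((\<lambda>y. lin_trace (\<lambda>e. base.\<Gamma> (bs y) e (bs X)) + DIM('e) / 2 * (dird \<sigma> y X / \<sigma> y)) has_derivative
      (\<lambda>u. dird (\<lambda>x. lin_trace (\<lambda>e. base.\<Gamma> x e (bs X))) (bs y) (bs u)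
        + DIM('e) / 2 * dird (\<lambda>y. dird \<sigma> y X / \<sigma> y) y u)) (at y)"
      by (intro has_derivative_add has_derivative_mult_right base_has_derivative
          base.trace_christoffel_differentiable x)
    from has_derivative_transform_within_open[OF this open_U y trace_christoffel[symmetric]]
    have "dird (\<lambda>y. lin_trace (\<lambda>e. \<Gamma> y e X)) y p =
      dird (\<lambda>x. lin_trace (\<lambda>e. base.\<Gamma> x e (bs X))) (bs y) (bs p)
        + DIM('e) / 2 * dird (\<lambda>y. dird \<sigma> y X / \<sigma> y) y p"
      by (rule dird_eq)
    then show ?thesis
      using linear_0[OF linear_frechet_derivative[OF base.trace_christoffel_differentiable[OF x]]]
      by (simp add: Da_eq[OF y])
  qed
  have lk: "linear (\<lambda>v. base.\<Gamma> (bs y) e v)" for e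
    by (rule base.linear_christoffel[OF x])
  have M: "\<Gamma> y p X = lift (bs y) (P y (bs X))"
    by (simp add: christoffel_p[OF y] X)
  have T3: "lin_trace (\<lambda>e. \<Gamma> y e (\<Gamma> y p X)) =
     a y * lin_trace (\<lambda>e. base.\<Gamma> (bs y) e (bs X)) + b y * lin_trace (\<lambda>e. base.\<Gamma> (bs y) e (J (bs y) (bs X)))
     + real DIM('e) / (2 * \<sigma> y) * dird \<sigma> y (lift (bs y) (P y (bs X)))"
    unfolding trace_christoffel[OF y] unfolding M
    by (simp add: P_def linear_add[OF lk] linear_scale[OF lk] lin_trace_add lin_trace_scaleR)
  have lT: "linear (\<lambda>e. \<Gamma> y p (\<Gamma> y e X))"
    using linear_compose[OF linear_christoffel_left[OF y, of X] linear_christoffel[OF y, of p]] by (simp add: o_def)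
  have kl: "linear (\<lambda>v. k (bs y) (bs X) v)" using k_bil[OF x] by (simp add: bilinear_def)
  have kg: "k (bs y) (bs X) grad = dird \<sigma> y (lift (bs y) (bs X))"
    using grad k_sym[OF x, of "bs X" grad] by simp
  have kJg: "k (bs y) (bs X) (J (bs y) grad) = - dird \<sigma> y (lift (bs y) (J (bs y) (bs X)))"
    using grad[of "J (bs y) (bs X)"] J_skew[OF x, of grad "bs X"] k_sym[OF x, of "J (bs y) grad" "bs X"] by simp
  note lJ = J_linear[OF x]
  have "lin_trace (\<lambda>v. bs (\<Gamma> y (lift (bs y) v) X)) = lin_trace (\<lambda>e. base.\<Gamma> (bs y) e (bs X))
      + DIM('e) / 2 * (dird \<sigma> y X / \<sigma> y)"
    by (simp add: christoffel_horizontal[OF y grad] lin_trace_add lin_trace_scaleR lin_trace_diff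
        lin_trace_id lin_trace_rank_one[OF kl] lin_trace_rank_one[OF linear_dird_\<sigma>_lift[OF y]]
        trace_J[OF x] kg)
  moreover have "lin_trace (\<lambda>v. J (bs y) (bs (\<Gamma> y (lift (bs y) v) X))) =
      lin_trace (\<lambda>e. J (bs y) (base.\<Gamma> (bs y) e (bs X)))
      + dird \<sigma> y (lift (bs y) (J (bs y) (bs X))) / \<sigma> y - DIM('e) * snd X / (4 * \<sigma> y)"
    by (simp add: christoffel_horizontal[OF y grad] linear_add[OF lJ] linear_scale[OF lJ] linear_diff[OF lJ]
        lin_trace_add lin_trace_scaleR lin_trace_diff lin_trace_minus J_square[OF x] X
        lin_trace_id lin_trace_rank_one[OF kl] lin_trace_rank_one[OF linear_dird_\<sigma>_lift[OF y]]
        trace_J[OF x] kJg)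
  moreover have "\<theta> (bs y) (\<Gamma> y p X) = 0"
    unfolding M by simp
  ultimately have T4: "lin_trace (\<lambda>e. \<Gamma> y p (\<Gamma> y e X)) =
      a y * (lin_trace (\<lambda>e. base.\<Gamma> (bs y) e (bs X)) + DIM('e) / 2 * (dird \<sigma> y X / \<sigma> y))
    + b y * (lin_trace (\<lambda>e. J (bs y) (base.\<Gamma> (bs y) e (bs X)))
      + dird \<sigma> y (lift (bs y) (J (bs y) (bs X))) / \<sigma> y - DIM('e) * snd X / (4 * \<sigma> y))"
    unfolding lin_trace_frame[OF lT x] unfolding christoffel_p[OF y]
    by (simp add: P_def lin_trace_add lin_trace_scaleR x linear_add[OF \<theta>_linear[OF x]] linear_scale[OF \<theta>_linear[OF x]])
  show ?thesis
    unfolding ricci_comp_traces[OF y] dS T3 T4 trace_derivative_christoffel_p[OF y X] base_term_def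
    by (simp add: algebra_simps)
qed

end

section \<open>Consequences of the curvature condition\<close>

text \<open>
  The values at \<open>w = 0\<close> and \<open>w = \<plusminus>f\<close> determine the polynomial; they also show that \<open>E = 0\<close>.
\<close>

lemma polynomial_identity:
  fixes f m n W F W' F' E :: real
  assumes f: "f \<noteq> 0"
    and eq: "\<And>w. m * (W * (f\<^sup>2 - w\<^sup>2) - 2 * w * f * F) + n * (F' * (w\<^sup>2 - f\<^sup>2) - 2 * w * f * W')
        + f * (w\<^sup>2 + f\<^sup>2) * E = 0"
  shows "m * F + n * W' = 0" "m * W = n * F'"
proof -
  have "f\<^sup>2 * (m * W - n * F' + f * E) = 0"
    using eq[of 0] by (simp add: algebra_simps power2_eq_square)
  then have 0: "m * W - n * F' + f * E = 0" using f by simp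
  have "2 * f\<^sup>2 * (- (m * F + n * W') + f * E) = 0"
    using eq[of f] by (simp add: algebra_simps power2_eq_square)
  then have 1: "- (m * F + n * W') + f * E = 0" using f by simp
  have "2 * f\<^sup>2 * (m * F + n * W' + f * E) = 0"
    using eq[of "- f"] by (simp add: algebra_simps power2_eq_square)
  then have 2: "m * F + n * W' + f * E = 0" using f by simp
  from 0 1 2 show "m * F + n * W' = 0" "m * W = n * F'" by linarith+
qed

context kerr_coordinates
begin

text \<open>
  These are defined by \<open>1 / (a + i b) = w - i f\<close>.
\<close>

definition f where "f y = b y / ((a y)\<^sup>2 + (b y)\<^sup>2)"
definition w where "w y = a y / ((a y)\<^sup>2 + (b y)\<^sup>2)"

lemma b_nz: "y \<in> U \<Longrightarrow> b y \<noteq> 0"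
  using \<sigma>_nonzero by (simp add: b_def)

lemma ab_pos: "y \<in> U \<Longrightarrow> (a y)\<^sup>2 + (b y)\<^sup>2 > 0"
  using b_nz by (simp add: sum_power2_gt_zero_iff)

lemma f_nz: "y \<in> U \<Longrightarrow> f y \<noteq> 0"
  using b_nz[of y] ab_pos[of y] by (simp add: f_def)

lemma w_f_sq: "y \<in> U \<Longrightarrow> (w y)\<^sup>2 + (f y)\<^sup>2 = 1 / ((a y)\<^sup>2 + (b y)\<^sup>2)"
  using ab_pos[of y]
  by (simp add: w_def f_def power_divide add_divide_distrib[symmetric]) (simp add: power2_eq_square)

lemma f_has_derivative:
  assumes y: "y \<in> U"
  shows "(f has_derivative (\<lambda>u. (dird b y u * ((a y)\<^sup>2 - (b y)\<^sup>2) - 2 * a y * b y * dird a y u)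
      / ((a y)\<^sup>2 + (b y)\<^sup>2)\<^sup>2)) (at y)"
proof -
  note d = differentiable_ab[OF y, THEN has_derivative_dird]
  have "((\<lambda>y. b y / (a y * a y + b y * b y)) has_derivative (\<lambda>u.
     (dird b y u * (a y * a y + b y * b y) - b y * ((a y * dird a y u + dird a y u * a y)
        + (b y * dird b y u + dird b y u * b y)))
      / ((a y * a y + b y * b y) * (a y * a y + b y * b y)))) (at y)"
    by (intro has_derivative_divide' has_derivative_add has_derivative_mult d)
       (use b_nz[OF y] in \<open>simp add: power2_eq_square\<close>)
  moreover have "(\<lambda>y. b y / (a y * a y + b y * b y)) = f"
    by (simp add: f_def fun_eq_iff power2_eq_square)
  moreover have "(\<lambda>u.
     (dird b y u * (a y * a y + b y * b y) - b y * ((a y * dird a y u + dird a y u * a y)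
        + (b y * dird b y u + dird b y u * b y)))
      / ((a y * a y + b y * b y) * (a y * a y + b y * b y))) =
     (\<lambda>u. (dird b y u * ((a y)\<^sup>2 - (b y)\<^sup>2) - 2 * a y * b y * dird a y u) / ((a y)\<^sup>2 + (b y)\<^sup>2)\<^sup>2)"
    by (simp add: fun_eq_iff power2_eq_square algebra_simps)
  ultimately show ?thesis by simp
qed

lemma w_has_derivative:
  assumes y: "y \<in> U"
  shows "(w has_derivative (\<lambda>u. (dird a y u * ((b y)\<^sup>2 - (a y)\<^sup>2) - 2 * a y * b y * dird b y u)
      / ((a y)\<^sup>2 + (b y)\<^sup>2)\<^sup>2)) (at y)"
proof -
  note d = differentiable_ab[OF y, THEN has_derivative_dird]
  have "((\<lambda>y. a y / (a y * a y + b y * b y)) has_derivative (\<lambda>u.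
     (dird a y u * (a y * a y + b y * b y) - a y * ((a y * dird a y u + dird a y u * a y)
        + (b y * dird b y u + dird b y u * b y)))
      / ((a y * a y + b y * b y) * (a y * a y + b y * b y)))) (at y)"
    by (intro has_derivative_divide' has_derivative_add has_derivative_mult d)
       (use b_nz[OF y] in \<open>simp add: power2_eq_square\<close>)
  moreover have "(\<lambda>y. a y / (a y * a y + b y * b y)) = w"
    by (simp add: w_def fun_eq_iff power2_eq_square)
  moreover have "(\<lambda>u.
     (dird a y u * (a y * a y + b y * b y) - a y * ((a y * dird a y u + dird a y u * a y)
        + (b y * dird b y u + dird b y u * b y)))
      / ((a y * a y + b y * b y) * (a y * a y + b y * b y))) =
     (\<lambda>u. (dird a y u * ((b y)\<^sup>2 - (a y)\<^sup>2) - 2 * a y * b y * dird b y u) / ((a y)\<^sup>2 + (b y)\<^sup>2)\<^sup>2)"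
    by (simp add: fun_eq_iff power2_eq_square algebra_simps)
  ultimately show ?thesis by simp
qed

text \<open>
  The real and imaginary parts of \<open>dz = - z\<^sup>2 d(1/z)\<close> for \<open>z = a + i b\<close>, multiplied by \<open>\<bar>1/z\<bar>\<^sup>4\<close>.
\<close>

lemma Dab_in_terms_of_wf:
  assumes y: "y \<in> U"
  shows "dird a y u * ((w y)\<^sup>2 + (f y)\<^sup>2)\<^sup>2 = dird w y u * ((f y)\<^sup>2 - (w y)\<^sup>2) - 2 * w y * f y * dird f y u"
    and "dird b y u * ((w y)\<^sup>2 + (f y)\<^sup>2)\<^sup>2 = dird f y u * ((w y)\<^sup>2 - (f y)\<^sup>2) - 2 * w y * f y * dird w y u"
proof -
  define N where "N = (a y)\<^sup>2 + (b y)\<^sup>2"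
  have N: "N \<noteq> 0" using b_nz[OF y] by (simp add: N_def)
  have wf: "w y = a y / N" "f y = b y / N" by (simp_all add: w_def f_def N_def)
  have 1: "((w y)\<^sup>2 + (f y)\<^sup>2)\<^sup>2 = 1 / N\<^sup>2"
    by (simp add: w_f_sq[OF y] N_def power_divide)
  have D: "dird w y u = (dird a y u * ((b y)\<^sup>2 - (a y)\<^sup>2) - 2 * a y * b y * dird b y u) / N\<^sup>2"
    "dird f y u = (dird b y u * ((a y)\<^sup>2 - (b y)\<^sup>2) - 2 * a y * b y * dird a y u) / N\<^sup>2"
    using dird_eq[OF w_has_derivative[OF y]] dird_eq[OF f_has_derivative[OF y]] by (simp_all add: N_def)
  have Nsq: "N\<^sup>2 = ((a y)\<^sup>2 - (b y)\<^sup>2)\<^sup>2 + 4 * (a y)\<^sup>2 * (b y)\<^sup>2"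
    by (simp add: N_def power2_eq_square algebra_simps)
  have e: "dird w y u * ((f y)\<^sup>2 - (w y)\<^sup>2) - 2 * w y * f y * dird f y u
      = dird a y u * (((a y)\<^sup>2 - (b y)\<^sup>2)\<^sup>2 + 4 * (a y)\<^sup>2 * (b y)\<^sup>2) / (N\<^sup>2 * N\<^sup>2)"
    "dird f y u * ((w y)\<^sup>2 - (f y)\<^sup>2) - 2 * w y * f y * dird w y u
      = dird b y u * (((a y)\<^sup>2 - (b y)\<^sup>2)\<^sup>2 + 4 * (a y)\<^sup>2 * (b y)\<^sup>2) / (N\<^sup>2 * N\<^sup>2)"
    using N unfolding D wf by (simp_all add: field_simps power2_eq_square)
  show "dird a y u * ((w y)\<^sup>2 + (f y)\<^sup>2)\<^sup>2 = dird w y u * ((f y)\<^sup>2 - (w y)\<^sup>2) - 2 * w y * f y * dird f y u"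
    "dird b y u * ((w y)\<^sup>2 + (f y)\<^sup>2)\<^sup>2 = dird f y u * ((w y)\<^sup>2 - (f y)\<^sup>2) - 2 * w y * f y * dird w y u"
    unfolding e Nsq[symmetric] 1 using N by (simp_all add: field_simps)
qed

lemma base_derivative_lift:
  assumes y: "((x, s), u) \<in> U" and g: "g differentiable (at ((x, s), u))"
  shows "((\<lambda>x. g ((x, s), u)) has_derivative (\<lambda>v. dird g ((x, s), u) (lift x v) + A x v * dird g ((x, s), u) q)) (at x)"
proof -
  have "((\<lambda>x. ((x, s), u)) has_derivative (\<lambda>v. ((v, 0), 0))) (at x)"
    by (intro has_derivative_Pair has_derivative_const has_derivative_ident)
  from has_derivative_compose[OF this has_derivative_dird[OF g]]
  have "((\<lambda>x. g ((x, s), u)) has_derivative (\<lambda>v. dird g ((x, s), u) ((v, 0), 0))) (at x)" .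
  moreover have "((v, 0), 0) = lift x v + A x v *\<^sub>R q" for v
    by (simp add: lift_def q_def)
  moreover note lin = linear_frechet_derivative[OF g]
  ultimately show ?thesis
    by (simp add: linear_add[OF lin] linear_scale[OF lin])
qed

lemma fibre_constant:
  assumes g: "\<And>s. g differentiable (at ((x, s), u))" and D: "\<And>s. dird g ((x, s), u) q = c"
  shows "g ((x, s), u) = g ((x, 0), u) + c * s"
proof -
  have "DERIV (\<lambda>s. g ((x, s), u) - c * s) s :> 0" for s
  proof -
    have "((\<lambda>s. ((x, s), u)) has_derivative (\<lambda>t. ((0, t), 0))) (at s)"
      by (intro has_derivative_Pair has_derivative_const has_derivative_ident)
    from has_derivative_compose[OF this has_derivative_dird[OF g]]
    have "((\<lambda>s. g ((x, s), u)) has_derivative (\<lambda>t. dird g ((x, s), u) ((0, t), 0))) (at s)" .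
    moreover have "((0, t), 0) = t *\<^sub>R q" for t by (simp add: q_def zero_prod_def)
    moreover note linear_scale[OF linear_frechet_derivative[OF g]]
    ultimately have "((\<lambda>s. g ((x, s), u)) has_derivative (\<lambda>t. c * t)) (at s)"
      by (simp add: D mult.commute)
    then have "((\<lambda>s. g ((x, s), u) - c * s) has_derivative (\<lambda>t. c * t - c * t)) (at s)"
      by (intro has_derivative_diff has_derivative_mult_right has_derivative_ident)
    then show ?thesis by (simp add: has_field_derivative_def lambda_zero)
  qed
  from DERIV_isconst_all[OF allI[OF this], of s 0] show ?thesis by simp
qed

text \<open>
  The curvature condition forces \<open>w\<close> to be constant in horizontal directions, which makes \<open>A\<close> closed.
\<close>

lemma no_ricci_condition:
  assumes ne: "V \<noteq> {}" "I \<noteq> {}" and dim: "DIM('e) \<ge> 3" and B: "B \<noteq> 0"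
    and invariant: "\<And>y. y \<in> U \<Longrightarrow> dird \<sigma> y q = B * dird \<sigma> y p"
    and ricci: "\<And>y X. y \<in> U \<Longrightarrow> \<theta> (bs y) X = 0 \<Longrightarrow> ricci_comp G y p X = 0"
  shows False
proof -
  obtain x0 u0 where "x0 \<in> V" and u0: "u0 \<in> I" using ne by blast
  have inU: "((x, s), u0) \<in> U" if "x \<in> V" for x s using that u0 by (simp add: U_def)
  define m where "m = 1 - real DIM('e)"
  define n where "n = 2 - real DIM('e) / 2"

  \<comment> \<open>For \<open>X = p\<close>, the curvature condition is the equation of Raychaudhuri and Sachs.\<close>
  have Dp: "dird a y p = (b y)\<^sup>2 - (a y)\<^sup>2" "dird b y p = - 2 * a y * b y" if y: "y \<in> U" for y
  proof -
    note x = bs_in[OF y]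
    have l0: "lift (bs y) 0 = 0" using linear_0[OF linear_lift[OF x]] .
    have d0: "dird g y 0 = 0" if "g differentiable (at y)" for g :: "_ \<Rightarrow> real"
      using linear_0[OF linear_frechet_derivative[OF that]] .
    have "P y 0 = 0" "J (bs y) 0 = 0" using linear_0[OF J_linear[OF x]] by (auto simp: P_def)
    moreover have "base_term (bs y) 0 = 0"
    proof -
      have "dird (\<lambda>x. J x 0) (bs y) = dird (\<lambda>x. 0) (bs y)"
        by (rule dird_transform[OF open_V x]) (auto simp: linear_0[OF J_linear])
      then show ?thesis
        using linear_0[OF base.linear_christoffel[OF x]] linear_0[OF J_linear[OF x]]
        by (simp add: base_term_def div_J_def lin_trace_def)
    qed
    ultimately have "ricci_comp G y p p = real DIM('e) * ((b y)\<^sup>2 - (a y)\<^sup>2 - dird a y p)"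
      using \<sigma>_nonzero[OF y]
      by (simp add: ricci_p[OF y, of p] x l0 d0 differentiable_ab[OF y] differentiable_data[OF y])
         (simp add: a_def b_def power2_eq_square field_simps)
    then show "dird a y p = (b y)\<^sup>2 - (a y)\<^sup>2"
      using dim ricci[OF y, of p] x by simp
    show "dird b y p = - 2 * a y * b y"
      using \<sigma>_nonzero[OF y] by (simp add: Db[OF y] a_def)
  qed
  have Dq: "dird a y q = B * dird a y p" "dird b y q = B * dird b y p" if y: "y \<in> U" for y
  proof -
    have "dird (\<lambda>y. dird \<sigma> y q / \<sigma> y) y p = dird (\<lambda>y. B * (dird \<sigma> y p / \<sigma> y)) y p"
      by (rule dird_transform[OF open_U y, THEN fun_cong])
         (auto intro!: derivative_intros differentiable_data y \<sigma>_nonzero simp: invariant)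
    also have "dird (\<lambda>y. B * (dird \<sigma> y p / \<sigma> y)) y p = B * dird (\<lambda>y. dird \<sigma> y p / \<sigma> y) y p"
      by (intro dird_eq has_derivative_mult_right has_derivative_dird differentiable_divide
          differentiable_data y \<sigma>_nonzero)
    finally show "dird a y q = B * dird a y p" by (simp add: Da_eq[OF y])
    show "dird b y q = B * dird b y p" by (simp add: Db[OF y] invariant[OF y])
  qed
  have Dfw: "dird f y q = 0" "dird w y q = B" if y: "y \<in> U" for y
  proof -
    have "((b y)\<^sup>2 - (a y)\<^sup>2)\<^sup>2 + (2 * a y * b y)\<^sup>2 = ((a y)\<^sup>2 + (b y)\<^sup>2)\<^sup>2"
      by (simp add: power2_eq_square algebra_simps)
    moreover have "dird w y q = B * (((b y)\<^sup>2 - (a y)\<^sup>2)\<^sup>2 + (2 * a y * b y)\<^sup>2) / ((a y)\<^sup>2 + (b y)\<^sup>2)\<^sup>2"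
      by (simp add: dird_eq[OF w_has_derivative[OF y]] Dq[OF y] Dp[OF y] power2_eq_square algebra_simps)
    ultimately show "dird w y q = B" using b_nz[OF y] by simp
    show "dird f y q = 0"
      by (simp add: dird_eq[OF f_has_derivative[OF y]] Dq[OF y] Dp[OF y] algebra_simps)
  qed
  have diff: "f differentiable (at y)" "w differentiable (at y)" if "y \<in> U" for y
    unfolding differentiable_def using f_has_derivative[OF that] w_has_derivative[OF that] by blast+

  \<comment> \<open>Along the fibre over \<open>x\<close>, \<open>f\<close> is constant and \<open>w\<close> is affine with slope \<open>B\<close>.\<close>
  define f0 where "f0 x = f ((x, 0), u0)" for x
  define w0 where "w0 x = w ((x, 0), u0)" for x
  have f_eq: "f ((x, s), u0) = f0 x" if "x \<in> V" for x s
    using fibre_constant[of f x u0 0 s] diff Dfw inU[OF that] by (simp add: f0_def)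
  have w_eq: "w ((x, s), u0) = w0 x + B * s" if "x \<in> V" for x s
    using fibre_constant[of w x u0 B s] diff Dfw inU[OF that] by (simp add: w0_def)
  have f0: "f0 differentiable (at x)" and w0: "w0 differentiable (at x)" if "x \<in> V" for x
    using base_derivative_lift[OF inU[OF that] diff(1)[OF inU[OF that, of 0]]]
      base_derivative_lift[OF inU[OF that] diff(2)[OF inU[OF that, of 0]]]
    unfolding f0_def[abs_def] w0_def[abs_def] differentiable_def by blast+
  have lift_f: "dird f ((x, s), u0) (lift x v) = dird f0 x v" if x: "x \<in> V" for x s v
  proof -
    have "((\<lambda>x. f ((x, s), u0)) has_derivative (\<lambda>v. dird f ((x, s), u0) (lift x v) + A x v * dird f ((x, s), u0) q)) (at x)"
      by (rule base_derivative_lift[OF inU[OF x] diff(1)[OF inU[OF x]]])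
    from has_derivative_transform_within_open[OF this open_V x f_eq]
    show ?thesis by (simp add: dird_eq Dfw[OF inU[OF x]])
  qed
  have lift_w: "dird w ((x, s), u0) (lift x v) = dird w0 x v - B * A x v" if x: "x \<in> V" for x s v
  proof -
    have "((\<lambda>x. w ((x, s), u0)) has_derivative (\<lambda>v. dird w ((x, s), u0) (lift x v) + A x v * dird w ((x, s), u0) q)) (at x)"
      by (rule base_derivative_lift[OF inU[OF x] diff(2)[OF inU[OF x]]])
    from has_derivative_transform_within_open[OF this open_V x w_eq]
    have "((\<lambda>x. w0 x + B * s) has_derivative (\<lambda>v. dird w ((x, s), u0) (lift x v) + A x v * dird w ((x, s), u0) q)) (at x)" .
    from has_derivative_diff[OF this has_derivative_const[of "B * s"]]
    have "(w0 has_derivative (\<lambda>v. dird w ((x, s), u0) (lift x v) + A x v * dird w ((x, s), u0) q)) (at x)"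
      by simp
    then show ?thesis by (simp add: dird_eq Dfw[OF inU[OF x]])
  qed

  have W0: "dird w0 x v = B * A x v" if x: "x \<in> V" for x v
  proof -
    define W where "W v = dird w0 x v - B * A x v" for v
    define F where "F v = dird f0 x v" for v
    have id: "m * (W v * ((f0 x)\<^sup>2 - t\<^sup>2) - 2 * t * f0 x * F v)
        + n * (F (J x v) * (t\<^sup>2 - (f0 x)\<^sup>2) - 2 * t * f0 x * W (J x v))
        + f0 x * (t\<^sup>2 + (f0 x)\<^sup>2) * base_term x v = 0" for v t
    proof -
      \<comment> \<open>The fibre coordinate is chosen such that \<open>w y = t\<close>.\<close>
      define y where "y = ((x, (t - w0 x) / B), u0)"
      have y: "y \<in> U" "bs y = x" using inU[OF x] by (auto simp: y_def)
      have wf: "w y = t" "f y = f0 x" using B by (auto simp: y_def w_eq[OF x] f_eq[OF x])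
      have Dwf: "dird w y (lift x v) = W v" "dird f y (lift x v) = F v" for v
        by (auto simp: y_def W_def F_def lift_f[OF x] lift_w[OF x])
      have b: "b y * (t\<^sup>2 + (f0 x)\<^sup>2)\<^sup>2 = f0 x * (t\<^sup>2 + (f0 x)\<^sup>2)"
        using w_f_sq[OF y(1)] ab_pos[OF y(1)] unfolding wf
        by (simp add: wf(2)[symmetric] f_def power2_eq_square)
      have P: "dird \<sigma> y (lift x (P y v)) = a y * dird \<sigma> y (lift x v) + b y * dird \<sigma> y (lift x (J x v))"
        using linear_dird_\<sigma>_lift[OF y(1)] by (simp add: y(2) P_def linear_iff)
      have "ricci_comp G y p (lift x v) = m * dird a y (lift x v) + n * dird b y (lift x (J x v)) + b y * base_term x v"
        using \<sigma>_nonzero[OF y(1)] unfolding m_def n_def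
        by (simp add: ricci_p[OF y(1)] y(2) P Db[OF y(1)] field_simps)
      then have "m * dird a y (lift x v) + n * dird b y (lift x (J x v)) + b y * base_term x v = 0"
        using ricci[OF y(1), of "lift x v"] y(2) by simp
      then have "(m * dird a y (lift x v) + n * dird b y (lift x (J x v)) + b y * base_term x v)
         * (t\<^sup>2 + (f0 x)\<^sup>2)\<^sup>2 = 0"
        by simp
      then have "m * (dird a y (lift x v) * (t\<^sup>2 + (f0 x)\<^sup>2)\<^sup>2) + n * (dird b y (lift x (J x v)) * (t\<^sup>2 + (f0 x)\<^sup>2)\<^sup>2)
          + (b y * (t\<^sup>2 + (f0 x)\<^sup>2)\<^sup>2) * base_term x v = 0"
        by (simp add: algebra_simps)
      then show ?thesis
        unfolding b using Dab_in_terms_of_wf[OF y(1)] unfolding wf by (simp add: Dwf)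
    qed
    have "f0 x \<noteq> 0" using f_nz[OF inU[OF x, of 0]] by (simp add: f0_def)
    note coeff = polynomial_identity[OF this id]
    \<comment> \<open>Replacing \<open>v\<close> by \<open>J v\<close> in the first relation makes the two relations a system for \<open>W v\<close> and \<open>F (J v)\<close>.\<close>
    have "W (- v) = - W v"
      using linear_neg[OF linear_frechet_derivative[OF w0[OF x]]] linear_neg[OF A_linear[OF x]]
      by (simp add: W_def)
    then have "m * F (J x v) = n * W v"
      using coeff(1)[of "J x v"] J_square[OF x] by simp
    with coeff(2)[of v] have "(m * m - n * n) * W v = 0"
      by (simp add: algebra_simps)
    moreover have "m * m - n * n \<noteq> 0"
    proof -
      have "m * m - n * n = (3 / 4) * (real DIM('e) - 2) * (real DIM('e) + 2)"
        unfolding m_def n_def by (simp add: algebra_simps)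
      also have "\<dots> > 0" using dim by simp
      finally show ?thesis by simp
    qed
    ultimately have "W v = 0" by simp
    then show ?thesis by (simp add: W_def)
  qed

  \<comment> \<open>Now \<open>A\<close> is the differential of \<open>w0 / B\<close>, hence closed.\<close>
  have w0_C2: "Ck_on (Suc (Suc 0)) V w0"
  proof -
    have "Ck_on (Suc 0) V (\<lambda>x. dird w0 x v)" for v
    proof (rule Ck_on_cong[OF open_V W0[symmetric]])
      have "Ck_on (Suc 0) V (\<lambda>x. A x v)" using A_C2 by (rule Ck_on_Suc_imp)
      from Ck_on_scaleR[OF open_V Ck_on_const this]
      show "Ck_on (Suc 0) V (\<lambda>x. B * A x v)" by simp
    qed
    then show ?thesis using w0 by (subst Ck_on.simps) blast
  qed
  have closed: "DA x0 v u = DA x0 u v" for u v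
  proof -
    have "dird (\<lambda>x. dird w0 x u) x0 v = B * DA x0 v u" for u v
    proof -
      have "((\<lambda>x. B * A x u) has_derivative (\<lambda>v. B * DA x0 v u)) (at x0)"
        by (intro has_derivative_mult_right has_derivative_dird C2_differentiable[OF A_C2 \<open>x0 \<in> V\<close>])
      from has_derivative_transform_within_open[OF this open_V \<open>x0 \<in> V\<close> W0[symmetric]]
      show ?thesis by (rule dird_eq)
    qed
    then show ?thesis
      using dird_dird_commute[OF open_V \<open>x0 \<in> V\<close> w0_C2, of u v] B by simp
  qed
  obtain e :: 'e where e: "e \<in> Basis" using nonempty_Basis by blast
  then have "J x0 e \<noteq> 0"
    using J_square[OF \<open>x0 \<in> V\<close>, of e] linear_0[OF J_linear[OF \<open>x0 \<in> V\<close>]] nonzero_Basis by force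
  then show False
    using k_pos[OF \<open>x0 \<in> V\<close>] dA[OF \<open>x0 \<in> V\<close>, of "J x0 e" e] closed[of e "J x0 e"]
      dA[OF \<open>x0 \<in> V\<close>, of e "J x0 e"] by force
qed

end

section \<open>Charts and tangent vectors\<close>

lemma smooth_on_subset: "smooth_on S f \<Longrightarrow> T \<subseteq> S \<Longrightarrow> smooth_on T f"
  unfolding smooth_on_def using Ck_on_subset by blast

lemma smooth_on_cong: "open S \<Longrightarrow> (\<And>x. x \<in> S \<Longrightarrow> f x = g x) \<Longrightarrow> smooth_on S f \<Longrightarrow> smooth_on S g"
  unfolding smooth_on_def using Ck_on_cong by blast

lemma smooth_on_compose:
  "open S \<Longrightarrow> open T \<Longrightarrow> f ` S \<subseteq> T \<Longrightarrow> smooth_on S f \<Longrightarrow> smooth_on T g \<Longrightarrow> smooth_on S (\<lambda>x. g (f x))"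
  unfolding smooth_on_def using Ck_on_compose by blast

lemma smooth_on_affine: "open S \<Longrightarrow> linear L \<Longrightarrow> smooth_on S (\<lambda>x. L x + z)"
  unfolding smooth_on_def by (intro allI Ck_on_add Ck_on_linear Ck_on_const)

lemma smooth_on_linear: "open S \<Longrightarrow> linear L \<Longrightarrow> smooth_on S L"
  unfolding smooth_on_def by (intro allI Ck_on_linear)

lemma smooth_on_Pair:
  assumes S: "open S" and "smooth_on S f" "smooth_on S g"
  shows "smooth_on S (\<lambda>x. (f x, g x))"
  unfolding smooth_on_def
proof
  fix k
  have "Ck_on k S (\<lambda>x. (f x, 0) + (0, g x))"
    using assms unfolding smooth_on_def
    by (intro Ck_on_add[OF S] Ck_on_linear_compose[OF S, of "\<lambda>v. (v, 0)"] Ck_on_linear_compose[OF S, of "\<lambda>v. (0, v)"])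
       (auto simp: linear_iff)
  then show "Ck_on k S (\<lambda>x. (f x, g x))" by simp
qed

lemma smooth_on_differentiable: "smooth_on S f \<Longrightarrow> x \<in> S \<Longrightarrow> f differentiable (at x)"
  unfolding smooth_on_def by (metis Ck_on.simps(2))

lemma smooth_on_continuous: "smooth_on S f \<Longrightarrow> continuous_on S f"
  unfolding smooth_on_def by (metis Ck_on.simps(1))

lemma smooth_on_dird: "smooth_on S f \<Longrightarrow> smooth_on S (\<lambda>x. dird f x v)"
  unfolding smooth_on_def by (metis Ck_on.simps(2))

lemma is_chartD:
  assumes "is_chart c"
  shows "open (cdom c)" "open (cran c)" "continuous_on (cdom c) (cmap c)" "continuous_on (cran c) (cinv c)"
    "\<And>p. p \<in> cdom c \<Longrightarrow> cinv c (cmap c p) = p" "\<And>x. x \<in> cran c \<Longrightarrow> cmap c (cinv c x) = x"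
    "\<And>x. x \<in> cran c \<Longrightarrow> cinv c x \<in> cdom c" "inj_on (cmap c) (cdom c)"
proof -
  have h: "homeomorphism (cdom c) (cran c) (cmap c) (cinv c)"
    using assms by (simp add: is_chart_def)
  show "open (cdom c)" "open (cran c)" using assms by (simp_all add: is_chart_def)
  show "continuous_on (cdom c) (cmap c)" "continuous_on (cran c) (cinv c)"
    using h by (simp_all add: homeomorphism_def)
  show i: "cinv c (cmap c p) = p" if "p \<in> cdom c" for p
    using h that by (simp add: homeomorphism_def)
  show "cmap c (cinv c x) = x" "cinv c x \<in> cdom c" if "x \<in> cran c" for x
    using that by (simp_all add: f_inv_into_f inv_into_into)
  show "inj_on (cmap c) (cdom c)"
    using i by (rule inj_on_inverseI)
qed

lemma open_chart_image:
  assumes c: "is_chart c" and V: "open V" "V \<subseteq> cdom c"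
  shows "open (cmap c ` V)"
proof -
  have "openin (top_of_set (cran c)) (cmap c ` V)"
    using c unfolding is_chart_def
    by (intro homeomorphism_imp_open_map[of "cdom c" "cran c" "cmap c" "cinv c"] open_subset V) simp_all
  then show ?thesis
    using is_chartD(2)[OF c] by (rule openin_open_trans)
qed

lemma is_chart_restrict:
  assumes c: "is_chart c" and V: "open V" "V \<subseteq> cdom c"
  shows "is_chart (V, cmap c)" "x \<in> cmap c ` V \<Longrightarrow> inv_into V (cmap c) x = cinv c x"
proof -
  have inj: "inj_on (cmap c) V" using is_chartD(8)[OF c] V inj_on_subset by blast
  show eq: "inv_into V (cmap c) x = cinv c x" if "x \<in> cmap c ` V" for x
    using that V is_chartD(5)[OF c] inj by (auto simp: inv_into_f_f)
  have "continuous_on (cmap c ` V) (inv_into V (cmap c))"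
    using continuous_on_subset[OF is_chartD(4)[OF c], of "cmap c ` V"] V eq
    by (subst continuous_on_cong[OF refl eq]) auto
  then show "is_chart (V, cmap c)"
    using V open_chart_image[OF c V] continuous_on_subset[OF is_chartD(3)[OF c] V(2)] inj
    by (auto simp: is_chart_def homeomorphism_def image_image)
qed

lemma atlas_subset_max_atlas: "atlas A \<Longrightarrow> A \<subseteq> max_atlas A"
  by (auto simp: atlas_def max_atlas_def carrier_def)

lemma restrict_in_max_atlas:
  assumes A: "atlas A" "c \<in> A" and V: "open V" "V \<subseteq> cdom c"
  shows "(V, cmap c) \<in> max_atlas A"
proof -
  have c: "is_chart c" using A by (simp add: atlas_def)
  note r = is_chart_restrict[OF c V]
  have "smooth_change (V, cmap c) d" "smooth_change d (V, cmap c)" if d: "d \<in> A" for d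
  proof -
    have dc: "is_chart d" "smooth_change c d" "smooth_change d c" using A d by (auto simp: atlas_def)
    have "smooth_on (cmap c ` (V \<inter> cdom d)) (cmap d \<circ> cinv c)"
      by (rule smooth_on_subset[OF dc(2)[unfolded smooth_change_def]]) (use V in auto)
    moreover have "open (cmap c ` (V \<inter> cdom d))"
      using V is_chartD(1)[OF dc(1)] by (intro open_chart_image[OF c]) auto
    ultimately show "smooth_change (V, cmap c) d"
      unfolding smooth_change_def using r(2) by (auto elim!: smooth_on_cong[rotated 2])
    show "smooth_change d (V, cmap c)"
      using smooth_on_subset[OF dc(3)[unfolded smooth_change_def], of "cmap d ` (cdom d \<inter> V)"] V
      unfolding smooth_change_def by auto
  qed
  with r(1) V(2) A show ?thesis by (auto simp: max_atlas_def carrier_def)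
qed

text \<open>
  Changes of charts being smooth, one fixed chart, restricted to a small neighbourhood, can replace all others.
\<close>

lemma smooth_near_iff:
  assumes A: "atlas A" "c \<in> A" "p \<in> cdom c"
  shows "smooth_near (max_atlas A) p \<phi> \<longleftrightarrow>
    (\<exists>V. open V \<and> p \<in> V \<and> V \<subseteq> cdom c \<and> smooth_on (cmap c ` V) (\<phi> \<circ> cinv c))"
proof
  have c: "is_chart c" using A by (simp add: atlas_def)
  assume "smooth_near (max_atlas A) p \<phi>"
  then obtain d where d: "d \<in> max_atlas A" "p \<in> cdom d" "smooth_on (cran d) (\<phi> \<circ> cinv d)"
    by (auto simp: smooth_near_def)
  then have dc: "is_chart d" "smooth_change c d" using A by (auto simp: max_atlas_def)
  define V where "V = cdom c \<inter> cdom d"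
  have V: "open V" "p \<in> V" "V \<subseteq> cdom c"
    using is_chartD(1)[OF c] is_chartD(1)[OF dc(1)] A d by (auto simp: V_def)
  have sm: "smooth_on (cmap c ` V) (\<lambda>x. (\<phi> \<circ> cinv d) ((cmap d \<circ> cinv c) x))"
  proof (rule smooth_on_compose[OF open_chart_image[OF c V(1,3)] is_chartD(2)[OF dc(1)] _ _ d(3)])
    show "smooth_on (cmap c ` V) (cmap d \<circ> cinv c)"
      using dc(2) by (simp add: smooth_change_def V_def)
  qed (auto simp: V_def is_chartD(5)[OF c])
  have eq: "(\<phi> \<circ> cinv d) ((cmap d \<circ> cinv c) x) = (\<phi> \<circ> cinv c) x" if "x \<in> cmap c ` V" for x
    using that is_chartD(5)[OF c] is_chartD(5)[OF dc(1)] by (auto simp: V_def)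
  have "smooth_on (cmap c ` V) (\<phi> \<circ> cinv c)"
    by (rule smooth_on_cong[OF open_chart_image[OF c V(1,3)] eq sm])
  with V show "\<exists>V. open V \<and> p \<in> V \<and> V \<subseteq> cdom c \<and> smooth_on (cmap c ` V) (\<phi> \<circ> cinv c)" by blast
next
  have c: "is_chart c" using A by (simp add: atlas_def)
  assume "\<exists>V. open V \<and> p \<in> V \<and> V \<subseteq> cdom c \<and> smooth_on (cmap c ` V) (\<phi> \<circ> cinv c)"
  then obtain V where V: "open V" "V \<subseteq> cdom c" and p: "p \<in> V" and s: "smooth_on (cmap c ` V) (\<phi> \<circ> cinv c)"
    by blast
  have "smooth_on (cmap c ` V) (\<phi> \<circ> inv_into V (cmap c))"
    by (rule smooth_on_cong[OF open_chart_image[OF c V] _ s]) (simp add: is_chart_restrict(2)[OF c V])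
  with restrict_in_max_atlas[OF A(1,2) V] p show "smooth_near (max_atlas A) p \<phi>"
    unfolding smooth_near_def by (intro bexI[of _ "(V, cmap c)"]) auto
qed

lemma smooth_near_differentiable:
  assumes A: "atlas A" "c \<in> A" "p \<in> cdom c" and "smooth_near (max_atlas A) p \<phi>"
  shows "(\<phi> \<circ> cinv c) differentiable (at (cmap c p))"
  using assms(4) unfolding smooth_near_iff[OF A] by (blast intro: smooth_on_differentiable)

text \<open>
  The coordinate functions of the chart separate the tangent vectors.
\<close>

lemma coord_vec_eq_iff:
  fixes A :: "('a::topological_space, 'e::euclidean_space) chart set"
  assumes A: "atlas A" "c \<in> A" "p \<in> cdom c"
  shows "coord_vec (max_atlas A) c p v = coord_vec (max_atlas A) c p w \<longleftrightarrow> v = w"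
proof
  have c: "is_chart c" using A by (simp add: atlas_def)
  assume eq: "coord_vec (max_atlas A) c p v = coord_vec (max_atlas A) c p w"
  have "v \<bullet> e = w \<bullet> e" for e
  proof -
    define \<phi> where "\<phi> q = cmap c q \<bullet> e" for q
    have hd: "((\<phi> \<circ> cinv c) has_derivative (\<lambda>v. v \<bullet> e)) (at (cmap c p))"
      using A(3) is_chartD(6)[OF c]
      by (intro has_derivative_transform_within_open[OF bounded_linear_imp_has_derivative[OF bounded_linear_inner_left]
            is_chartD(2)[OF c]]) (auto simp: \<phi>_def)
    have l: "linear (\<lambda>x. x \<bullet> e)" by (simp add: bounded_linear.linear bounded_linear_inner_left)
    have "smooth_on (cran c) (\<phi> \<circ> cinv c)"
      by (rule smooth_on_cong[OF is_chartD(2)[OF c] _ smooth_on_linear[OF is_chartD(2)[OF c] l]])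
        (simp add: \<phi>_def is_chartD(6)[OF c])
    then have "smooth_near (max_atlas A) p \<phi>"
      unfolding smooth_near_iff[OF A] using is_chartD(1)[OF c] A(3) by blast
    then show ?thesis
      using fun_cong[OF eq, of \<phi>] by (simp add: coord_vec_def dird_eq[OF hd])
  qed
  then show "v = w" by (metis vector_eq_rdot)
qed simp

lemma components_coord_vec:
  assumes "atlas A" "c \<in> A" "p \<in> cdom c"
  shows "components (max_atlas A) c p (coord_vec (max_atlas A) c p v) = v"
  unfolding components_def coord_vec_eq_iff[OF assms] by auto

lemma coord_vec_add:
  assumes A: "atlas A" "c \<in> A" "p \<in> cdom c"
  shows "coord_vec (max_atlas A) c p (v + w) = (\<lambda>\<phi>. coord_vec (max_atlas A) c p v \<phi> + coord_vec (max_atlas A) c p w \<phi>)"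
proof
  fix \<phi>
  show "coord_vec (max_atlas A) c p (v + w) \<phi> = coord_vec (max_atlas A) c p v \<phi> + coord_vec (max_atlas A) c p w \<phi>"
    using linear_add[OF linear_frechet_derivative[OF smooth_near_differentiable[OF A]]]
    by (simp add: coord_vec_def)
qed

lemma coord_vec_scaleR:
  assumes A: "atlas A" "c \<in> A" "p \<in> cdom c"
  shows "coord_vec (max_atlas A) c p (r *\<^sub>R v) = (\<lambda>\<phi>. r * coord_vec (max_atlas A) c p v \<phi>)"
proof
  fix \<phi>
  show "coord_vec (max_atlas A) c p (r *\<^sub>R v) \<phi> = r * coord_vec (max_atlas A) c p v \<phi>"
    using linear_scale[OF linear_frechet_derivative[OF smooth_near_differentiable[OF A]]]
    by (simp add: coord_vec_def)
qed

text \<open>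
  The chain rule.  As \<open>\<phi> \<circ> f\<close> is smooth near \<open>p\<close> whenever \<open>\<phi>\<close> is smooth near \<open>f p\<close>, a function that is tested
  on the right-hand side is not sent to the default value \<open>0\<close> on the left-hand side.
\<close>

lemma push_coord_vec:
  assumes A: "atlas A" "c \<in> A" "p \<in> cdom c" and B: "atlas B" "d \<in> B"
    and f: "f ` cdom c \<subseteq> cdom d" and smooth: "smooth_on (cran c) (\<lambda>x. cmap d (f (cinv c x)))"
  shows "push (max_atlas B) f p (coord_vec (max_atlas A) c p v) =
    coord_vec (max_atlas B) d (f p) (dird (\<lambda>x. cmap d (f (cinv c x))) (cmap c p) v)"
proof
  fix \<phi>
  have c: "is_chart c" and d: "is_chart d" using A B by (auto simp: atlas_def)
  have fp: "f p \<in> cdom d" using f A(3) by blast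
  define F where "F x = cmap d (f (cinv c x))" for x
  have F: "smooth_on (cran c) F" using smooth by (simp add: F_def[abs_def])
  show "push (max_atlas B) f p (coord_vec (max_atlas A) c p v) \<phi> =
    coord_vec (max_atlas B) d (f p) (dird (\<lambda>x. cmap d (f (cinv c x))) (cmap c p) v) \<phi>"
  proof (cases "smooth_near (max_atlas B) (f p) \<phi>")
    case True
    then obtain V where V: "open V" "V \<subseteq> cdom d" "f p \<in> V" "smooth_on (cmap d ` V) (\<phi> \<circ> cinv d)"
      unfolding smooth_near_iff[OF B fp] by blast
    define W where "W = cran c \<inter> F -` (cmap d ` V)"
    have oV: "open (cmap d ` V)" using open_chart_image[OF d V(1,2)] .
    have W: "open W"
      unfolding W_def using continuous_open_preimage[OF smooth_on_continuous[OF F] is_chartD(2)[OF c] oV] .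
    have pW: "cmap c p \<in> W"
      using A(3) V(3) is_chartD(5)[OF c A(3)] by (auto simp: W_def F_def)
    have eq: "(\<phi> \<circ> cinv d) (F x) = ((\<phi> \<circ> f) \<circ> cinv c) x" if "x \<in> W" for x
    proof -
      have "f (cinv c x) \<in> cdom d" using that f is_chartD(7)[OF c, of x] by (auto simp: W_def)
      then show ?thesis by (simp add: F_def is_chartD(5)[OF d])
    qed
    have "smooth_on W (\<lambda>x. (\<phi> \<circ> cinv d) (F x))"
      by (rule smooth_on_compose[OF W oV _ smooth_on_subset[OF F] V(4)]) (auto simp: W_def)
    then have sW: "smooth_on W ((\<phi> \<circ> f) \<circ> cinv c)"
      by (rule smooth_on_cong[OF W eq, rotated])
    have "open (cdom c \<inter> cmap c -` W)"
      using continuous_open_preimage[OF is_chartD(3)[OF c] is_chartD(1)[OF c] W] .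
    moreover have "cmap c ` (cdom c \<inter> cmap c -` W) = W"
      using is_chartD(6,7)[OF c] by (force simp: W_def)
    ultimately have near: "smooth_near (max_atlas A) p (\<phi> \<circ> f)"
      unfolding smooth_near_iff[OF A] using sW pW A(3) by (intro exI[of _ "cdom c \<inter> cmap c -` W"]) auto
    have dF: "F differentiable (at (cmap c p))"
      using smooth_on_differentiable[OF F] A(3) by blast
    have Fp: "F (cmap c p) = cmap d (f p)" by (simp add: F_def is_chartD(5)[OF c A(3)])
    have d\<phi>: "(\<phi> \<circ> cinv d) differentiable (at (F (cmap c p)))"
      using smooth_near_differentiable[OF B fp True] by (simp add: Fp)
    have "dird ((\<phi> \<circ> f) \<circ> cinv c) (cmap c p) v = dird (\<lambda>x. (\<phi> \<circ> cinv d) (F x)) (cmap c p) v"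
      by (rule dird_transform[OF W pW eq dird_compose(2)[OF dF d\<phi>], THEN fun_cong])
    also have "\<dots> = dird (\<phi> \<circ> cinv d) (cmap d (f p)) (dird F (cmap c p) v)"
      using dird_compose(1)[OF dF d\<phi>] unfolding Fp .
    finally show ?thesis
      using True near by (simp add: push_def coord_vec_def F_def[abs_def])
  qed (simp add: push_def coord_vec_def)
qed

text \<open>
  The projections and the group action of a principal bundle are affine in a trivialisation.
\<close>

lemma push_coord_vec_affine:
  assumes A: "atlas A" "c \<in> A" "p \<in> cdom c" and B: "atlas B" "d \<in> B"
    and f: "f ` cdom c \<subseteq> cdom d" and L: "linear L" and eq: "\<And>q. q \<in> cdom c \<Longrightarrow> cmap d (f q) = L (cmap c q) + z"
  shows "push (max_atlas B) f p (coord_vec (max_atlas A) c p v) = coord_vec (max_atlas B) d (f p) (L v)"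
proof -
  have c: "is_chart c" using A by (auto simp: atlas_def)
  have eq': "L x + z = cmap d (f (cinv c x))" if "x \<in> cran c" for x
    using eq[OF is_chartD(7)[OF c that]] is_chartD(6)[OF c that] by simp
  have "((\<lambda>x. L x + z) has_derivative L) (at (cmap c p))"
    using L by (intro has_derivative_add_const bounded_linear_imp_has_derivative) (simp add: linear_conv_bounded_linear)
  from has_derivative_transform_within_open[OF this is_chartD(2)[OF c] _ eq'] A(3)
  have "dird (\<lambda>x. cmap d (f (cinv c x))) (cmap c p) v = L v" by (intro dird_eq) blast
  moreover have "smooth_on (cran c) (\<lambda>x. cmap d (f (cinv c x)))"
    by (rule smooth_on_cong[OF is_chartD(2)[OF c] eq' smooth_on_affine[OF is_chartD(2)[OF c] L]])
  ultimately show ?thesis using push_coord_vec[OF A B f] by simp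
qed

lemma velocity_coord_vec:
  assumes A: "atlas A" "c \<in> A" and T: "open T" "t \<in> T" "\<And>r. r \<in> T \<Longrightarrow> \<gamma> r \<in> cdom c"
    and d: "((\<lambda>r. cmap c (\<gamma> r)) has_derivative (\<lambda>h. h *\<^sub>R v)) (at t)"
  shows "velocity (max_atlas A) \<gamma> t = coord_vec (max_atlas A) c (\<gamma> t) v"
proof
  fix \<phi>
  have c: "is_chart c" using A by (auto simp: atlas_def)
  have p: "\<gamma> t \<in> cdom c" using T by blast
  show "velocity (max_atlas A) \<gamma> t \<phi> = coord_vec (max_atlas A) c (\<gamma> t) v \<phi>"
  proof (cases "smooth_near (max_atlas A) (\<gamma> t) \<phi>")
    case True
    note d\<phi> = smooth_near_differentiable[OF A p True]
    from has_derivative_compose[OF d has_derivative_dird[OF d\<phi>]]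
    have "((\<lambda>r. (\<phi> \<circ> cinv c) (cmap c (\<gamma> r))) has_derivative (\<lambda>h. dird (\<phi> \<circ> cinv c) (cmap c (\<gamma> t)) (h *\<^sub>R v))) (at t)" .
    from has_derivative_transform_within_open[OF this T(1,2), of "\<phi> \<circ> \<gamma>"]
    have "((\<phi> \<circ> \<gamma>) has_derivative (\<lambda>h. dird (\<phi> \<circ> cinv c) (cmap c (\<gamma> t)) (h *\<^sub>R v))) (at t)"
      by (simp add: T(3) is_chartD(5)[OF c])
    then have "((\<phi> \<circ> \<gamma>) has_field_derivative dird (\<phi> \<circ> cinv c) (cmap c (\<gamma> t)) v) (at t)"
      using linear_scale[OF linear_frechet_derivative[OF d\<phi>]]
      by (auto simp: has_field_derivative_def elim!: has_derivative_eq_rhs)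
    then show ?thesis
      using True by (simp add: velocity_def coord_vec_def DERIV_imp_deriv)
  qed (simp add: velocity_def coord_vec_def)
qed

text \<open>
  The chain rule for \<open>\<phi> \<circ> cinv d = (\<phi> \<circ> cinv c) \<circ> (cmap c \<circ> cinv d)\<close>.
\<close>

lemma coord_vec_change:
  assumes A: "atlas A" "c \<in> A" "p \<in> cdom c" "d \<in> A" "p \<in> cdom d"
  shows "coord_vec (max_atlas A) d p v = coord_vec (max_atlas A) c p (dird (cmap c \<circ> cinv d) (cmap d p) v)"
proof
  fix \<phi>
  have c: "is_chart c" and d: "is_chart d" and dc: "smooth_change d c" using A by (auto simp: atlas_def)
  show "coord_vec (max_atlas A) d p v \<phi> =
     coord_vec (max_atlas A) c p (dird (cmap c \<circ> cinv d) (cmap d p) v) \<phi>"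
  proof (cases "smooth_near (max_atlas A) p \<phi>")
    case True
    define V where "V = cdom d \<inter> cdom c"
    have V: "open V" "V \<subseteq> cdom d" "p \<in> V"
      using A is_chartD(1)[OF c] is_chartD(1)[OF d] by (auto simp: V_def)
    have F: "(cmap c \<circ> cinv d) differentiable (at (cmap d p))"
      using smooth_on_differentiable[OF dc[unfolded smooth_change_def]] V by (simp add: V_def)
    have Fp: "(cmap c \<circ> cinv d) (cmap d p) = cmap c p" by (simp add: is_chartD(5)[OF d A(5)])
    have d\<phi>: "(\<phi> \<circ> cinv c) differentiable (at ((cmap c \<circ> cinv d) (cmap d p)))"
      using smooth_near_differentiable[OF A(1-3) True] by (simp only: Fp)
    have eq: "(\<phi> \<circ> cinv c) ((cmap c \<circ> cinv d) x) = (\<phi> \<circ> cinv d) x" if "x \<in> cmap d ` V" for x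
      using that by (auto simp: V_def is_chartD(5)[OF d] is_chartD(5)[OF c])
    have "dird (\<phi> \<circ> cinv d) (cmap d p) v = dird (\<lambda>x. (\<phi> \<circ> cinv c) ((cmap c \<circ> cinv d) x)) (cmap d p) v"
      by (rule dird_transform[OF open_chart_image[OF d V(1,2)] _ eq dird_compose(2)[OF F d\<phi>], THEN fun_cong])
         (use V in auto)
    also have "\<dots> = dird (\<phi> \<circ> cinv c) (cmap c p) (dird (cmap c \<circ> cinv d) (cmap d p) v)"
      using dird_compose(1)[OF F d\<phi>] unfolding Fp .
    finally show ?thesis using True by (simp add: coord_vec_def)
  qed (simp add: coord_vec_def)
qed

lemma tangent_space_eq_range:
  assumes A: "atlas A" "max_atlas A = A" "c \<in> A" "p \<in> cdom c"
  shows "tangent_space A p = range (coord_vec A c p)"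
proof
  show "tangent_space A p \<subseteq> range (coord_vec A c p)"
    using coord_vec_change[OF A(1,3,4)] A(2) by (auto simp: tangent_space_def)
  show "range (coord_vec A c p) \<subseteq> tangent_space A p"
    using A unfolding tangent_space_def by blast
qed

section \<open>Complex structures in arbitrary charts\<close>

text \<open>
  In a holomorphic chart \<open>d\<close>, \<open>J\<close> is a constant \<open>j\<close>; in the chart \<open>c\<close> it is conjugated with the differential of the
  change of charts, so that \<open>J\<^sup>2 = -1\<close> is inherited from \<open>j\<close> and differentiability from the change of charts.
\<close>

lemma complex_structure_in_chart:
  fixes N :: "('n::{t2_space,second_countable_topology}, 'e::euclidean_space) chart set"
  assumes N: "atlas N" "max_atlas N = N" and J: "complex_structure N J" and c: "c \<in> N" and x: "x \<in> cran c"
    and Jc_def: "\<And>x v. Jc x v = components N c (cinv c x) (J (cinv c x) (coord_vec N c (cinv c x) v))"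
  shows "J (cinv c x) (coord_vec N c (cinv c x) v) = coord_vec N c (cinv c x) (Jc x v)"
    and "linear (Jc x)" and "Jc x (Jc x v) = - v" and "(\<lambda>x. Jc x v) differentiable (at x)"
proof -
  have cc: "is_chart c" using N c by (simp add: atlas_def)
  have "cinv c x \<in> carrier N" using is_chartD(7)[OF cc x] c by (auto simp: carrier_def)
  then obtain d j where d: "d \<in> N" "cinv c x \<in> cdom d" and j: "linear j" "\<And>v. j (j v) = - v"
    and Jd: "\<And>q v. q \<in> cdom d \<Longrightarrow> J q (coord_vec N d q v) = coord_vec N d q (j v)"
    using J unfolding complex_structure_def by blast
  have dc: "is_chart d" using N d by (simp add: atlas_def)
  define \<psi> where "\<psi> = cmap d \<circ> cinv c"
  define \<eta> where "\<eta> = cmap c \<circ> cinv d"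
  define W where "W = cmap c ` (cdom c \<inter> cdom d)"
  have W: "open W"
    unfolding W_def using is_chartD(1)[OF cc] is_chartD(1)[OF dc] by (intro open_chart_image[OF cc]) auto
  have xW: "x \<in> W"
    using x d(2) is_chartD(6,7)[OF cc x] unfolding W_def by (metis IntI image_eqI)
  have s\<psi>: "smooth_on W \<psi>" and s\<eta>: "smooth_on (\<psi> ` W) \<eta>"
  proof -
    have "smooth_change c d" "smooth_change d c" using N c d by (auto simp: atlas_def)
    moreover have "\<psi> ` W = cmap d ` (cdom d \<inter> cdom c)"
      by (auto simp: \<psi>_def W_def image_iff is_chartD(5)[OF cc])
    ultimately show "smooth_on W \<psi>" "smooth_on (\<psi> ` W) \<eta>"
      by (auto simp: smooth_change_def W_def \<psi>_def \<eta>_def)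
  qed
  have q: "cinv c y \<in> cdom c" "cinv c y \<in> cdom d" "cmap c (cinv c y) = y" "cmap d (cinv c y) = \<psi> y"
    if "y \<in> W" for y
    using that by (auto simp: W_def \<psi>_def is_chartD(5)[OF cc])
  have cd: "coord_vec N c (cinv c y) v = coord_vec N d (cinv c y) (dird \<psi> y v)" if "y \<in> W" for y v
    using coord_vec_change[OF N(1) d(1) q(2)[OF that] c q(1)[OF that], of v]
    by (simp add: N(2) q(3)[OF that] \<psi>_def)
  have dc': "coord_vec N d (cinv c y) v = coord_vec N c (cinv c y) (dird \<eta> (\<psi> y) v)" if "y \<in> W" for y v
    using coord_vec_change[OF N(1) c q(1)[OF that] d(1) q(2)[OF that], of v]
    by (simp add: N(2) q(4)[OF that] \<eta>_def)
  note inj = coord_vec_eq_iff[OF N(1), unfolded N(2)]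
  have inv1: "dird \<psi> y (dird \<eta> (\<psi> y) v) = v" if "y \<in> W" for y v
    using dc'[OF that, of v] unfolding cd[OF that] inj[OF d(1) q(2)[OF that]] by simp
  have inv2: "dird \<eta> (\<psi> y) (dird \<psi> y v) = v" if "y \<in> W" for y v
    using cd[OF that, of v] unfolding dc'[OF that] inj[OF c q(1)[OF that]] by simp
  define E where "E y v = dird \<eta> (\<psi> y) (j (dird \<psi> y v))" for y v
  have JE: "J (cinv c y) (coord_vec N c (cinv c y) v) = coord_vec N c (cinv c y) (E y v)" if "y \<in> W" for y v
    by (simp only: cd[OF that, of v] Jd[OF q(2)[OF that]] dc'[OF that, of "j (dird \<psi> y v)"] E_def)
  have Jc: "Jc y v = E y v" if "y \<in> W" for y v
    unfolding Jc_def JE[OF that]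
    using components_coord_vec[OF N(1) c q(1)[OF that]] by (simp add: N(2))
  show "J (cinv c x) (coord_vec N c (cinv c x) v) = coord_vec N c (cinv c x) (Jc x v)"
    unfolding Jc[OF xW] by (rule JE[OF xW])
  have \<psi>d: "\<psi> differentiable (at x)" using smooth_on_differentiable[OF s\<psi> xW] .
  have \<eta>d: "\<eta> differentiable (at (\<psi> x))" using smooth_on_differentiable[OF s\<eta>] xW by blast
  have lE: "linear (E x)"
    using linear_compose[OF linear_compose[OF linear_frechet_derivative[OF \<psi>d] j(1)] linear_frechet_derivative[OF \<eta>d]]
    by (simp add: E_def[abs_def] o_def)
  then show "linear (Jc x)" using Jc[OF xW] by (simp add: linear_iff)
  have "E x (E x v) = - v"
    unfolding E_def inv1[OF xW] j(2)
    using linear_neg[OF linear_frechet_derivative[OF \<eta>d]] inv2[OF xW] by simp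
  then show "Jc x (Jc x v) = - v" by (simp add: Jc[OF xW])
  show "(\<lambda>x. Jc x v) differentiable (at x)"
  proof (rule differentiable_transform[OF W xW])
    show "(\<Sum>b\<in>Basis. (j (dird \<psi> y v) \<bullet> b) *\<^sub>R dird \<eta> (\<psi> y) b) = Jc y v" if "y \<in> W" for y
    proof -
      have l: "linear (dird \<eta> (\<psi> y))"
        using linear_frechet_derivative[OF smooth_on_differentiable[OF s\<eta>]] that by blast
      have "dird \<eta> (\<psi> y) (j (dird \<psi> y v)) = dird \<eta> (\<psi> y) (\<Sum>b\<in>Basis. (j (dird \<psi> y v) \<bullet> b) *\<^sub>R b)"
        by (simp add: euclidean_representation)
      also have "\<dots> = (\<Sum>b\<in>Basis. (j (dird \<psi> y v) \<bullet> b) *\<^sub>R dird \<eta> (\<psi> y) b)"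
        by (simp add: linear_sum[OF l] linear_scale[OF l])
      finally show ?thesis by (simp add: Jc[OF that] E_def)
    qed
    have 1: "(\<lambda>y. j (dird \<psi> y v)) differentiable (at x)"
      by (rule dird_compose(2)[OF smooth_on_differentiable[OF smooth_on_dird[OF s\<psi>] xW]
            linear_imp_differentiable[OF j(1)]])
    have 2: "(\<lambda>y. dird \<eta> (\<psi> y) b) differentiable (at x)" for b
      by (rule dird_compose(2)[OF \<psi>d smooth_on_differentiable[OF smooth_on_dird[OF s\<eta>] imageI[OF xW]]])
    show "(\<lambda>y. \<Sum>b\<in>Basis. (j (dird \<psi> y v) \<bullet> b) *\<^sub>R dird \<eta> (\<psi> y) b) differentiable (at x)"
      by (intro differentiable_sum ballI finite_Basis differentiable_scaleR differentiable_inner 1 2 differentiable_const)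
  qed
qed

section \<open>The product of a manifold with an interval\<close>

definition prod_chart :: "real set \<Rightarrow> ('s, 'f::euclidean_space) chart \<Rightarrow> ('s \<times> real, 'f \<times> real) chart" where
  "prod_chart I d = (cdom d \<times> I, \<lambda>(s, u). (cmap d s, u))"

lemma prod_chart_simps [simp]:
  "cdom (prod_chart I d) = cdom d \<times> I" "cmap (prod_chart I d) (s, u) = (cmap d s, u)"
  "cmap (prod_chart I d) ` (X \<times> Y) = (cmap d ` X) \<times> Y"
  by (auto simp: prod_chart_def image_iff)

lemma prod_chart_inv:
  assumes "is_chart d" "z \<in> cran d" "u \<in> I"
  shows "inv_into (cdom d \<times> I) (cmap (prod_chart I d)) (z, u) = (cinv d z, u)"
proof -
  have "inj_on (cmap (prod_chart I d)) (cdom d \<times> I)"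
    using is_chartD(8)[OF assms(1)] by (auto simp: inj_on_def)
  then show ?thesis
    using is_chartD(6,7)[OF assms(1,2)] assms(3)
    by (intro inv_into_f_eq) auto
qed

lemma is_chart_prod_chart:
  assumes d: "is_chart d" and I: "open I"
  shows "is_chart (prod_chart I d)"
proof -
  have 1: "continuous_on (cdom d \<times> I) (\<lambda>x. (cmap d (fst x), snd x))"
    by (intro continuous_on_Pair continuous_on_compose2[OF is_chartD(3)[OF d]] continuous_intros) auto
  have 2: "continuous_on (cran d \<times> I) (\<lambda>x. (cinv d (fst x), snd x))"
    by (intro continuous_on_Pair continuous_on_compose2[OF is_chartD(4)[OF d]] continuous_intros) auto
  have c1: "continuous_on (cdom d \<times> I) (cmap (prod_chart I d))"
    by (rule continuous_on_eq[OF 1]) auto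
  have c2: "continuous_on (cran d \<times> I) (cinv (prod_chart I d))"
    by (rule continuous_on_eq[OF 2]) (auto simp: prod_chart_inv[OF d])
  have i1: "cinv (prod_chart I d) (cmap (prod_chart I d) (s, u)) = (s, u)" if "s \<in> cdom d" "u \<in> I" for s u
    using that by (simp only: prod_chart_simps prod_chart_inv[OF d imageI] is_chartD(5)[OF d])
  have i2: "cmap (prod_chart I d) (cinv (prod_chart I d) (z, u)) = (z, u)"
    "cinv (prod_chart I d) (z, u) \<in> cdom d \<times> I" if "z \<in> cran d" "u \<in> I" for z u
    using that is_chartD(6,7)[OF d that(1)] by (simp_all only: prod_chart_simps prod_chart_inv[OF d that] mem_Times_iff fst_conv snd_conv)
  have "homeomorphism (cdom d \<times> I) (cran d \<times> I) (cmap (prod_chart I d)) (cinv (prod_chart I d))"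
  proof (rule homeomorphismI[OF c1 c2])
    show "cmap (prod_chart I d) ` (cdom d \<times> I) \<subseteq> cran d \<times> I"
      by (simp only: prod_chart_simps)
    show "cinv (prod_chart I d) ` (cran d \<times> I) \<subseteq> cdom d \<times> I"
    proof (rule image_subsetI)
      fix x assume "x \<in> cran d \<times> I"
      then have "fst x \<in> cran d" "snd x \<in> I" by (simp_all only: mem_Times_iff)
      from i2(2)[OF this] show "cinv (prod_chart I d) x \<in> cdom d \<times> I" by (simp only: prod.collapse)
    qed
    show "cinv (prod_chart I d) (cmap (prod_chart I d) x) = x" if "x \<in> cdom d \<times> I" for x
      using i1[of "fst x" "snd x"] that by (simp only: prod.collapse mem_Times_iff)
    show "cmap (prod_chart I d) (cinv (prod_chart I d) x) = x" if "x \<in> cran d \<times> I" for x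
      using i2(1)[of "fst x" "snd x"] that by (simp only: prod.collapse mem_Times_iff)
  qed
  moreover have "open (cdom d \<times> I)" "open (cran d \<times> I)"
    using is_chartD(1,2)[OF d] I by (auto intro: open_Times)
  ultimately show ?thesis
    by (simp add: is_chart_def)
qed

lemma atlas_prod_chart:
  assumes A: "atlas A" and I: "open I"
  shows "atlas (prod_chart I ` A)"
proof -
  have "smooth_change (prod_chart I c) (prod_chart I d)" if cd: "c \<in> A" "d \<in> A" for c d
  proof -
    have c: "is_chart c" and d: "is_chart d" and s: "smooth_change c d"
      using A cd by (auto simp: atlas_def)
    define W where "W = cmap c ` (cdom c \<inter> cdom d)"
    have W: "open W"
      unfolding W_def using is_chartD(1)[OF c] is_chartD(1)[OF d] by (intro open_chart_image[OF c]) auto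
    have WI: "open (W \<times> I)" using W I by (rule open_Times)
    have fs: "fst ` (W \<times> I) \<subseteq> W" by auto
    have lin: "linear (fst :: 'b \<times> real \<Rightarrow> 'b)" "linear (snd :: 'b \<times> real \<Rightarrow> real)"
      by (auto simp: linear_iff)
    have "smooth_on (W \<times> I) (\<lambda>y. ((cmap d \<circ> cinv c) (fst y), snd y))"
      by (rule smooth_on_Pair[OF WI smooth_on_compose[OF WI W fs smooth_on_linear[OF WI lin(1)]
              s[unfolded smooth_change_def, folded W_def]] smooth_on_linear[OF WI lin(2)]])
    then have "smooth_on (W \<times> I) (cmap (prod_chart I d) \<circ> cinv (prod_chart I c))"
    proof (rule smooth_on_cong[OF WI, rotated])
      fix y assume "y \<in> W \<times> I"
      then obtain z u where y: "y = (z, u)" "z \<in> W" "u \<in> I" by blast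
      then have "z \<in> cran c" unfolding W_def by blast
      with y show "((cmap d \<circ> cinv c) (fst y), snd y) = (cmap (prod_chart I d) \<circ> cinv (prod_chart I c)) y"
        by (simp only: o_apply prod_chart_inv[OF c] prod_chart_simps fst_conv snd_conv)
    qed
    moreover have "cmap (prod_chart I c) ` (cdom (prod_chart I c) \<inter> cdom (prod_chart I d)) = W \<times> I"
      by (simp only: prod_chart_simps W_def Times_Int_Times Int_absorb)
    ultimately show ?thesis by (simp only: smooth_change_def)
  qed
  with A I show ?thesis by (auto simp: atlas_def intro: is_chart_prod_chart)
qed

lemma kerr_space_eq: "kerr_space K = max_atlas (prod_chart (factor K) ` total K)"
  unfolding kerr_space_def prod_chart_def by (rule arg_cong[of _ _ max_atlas]) blast

section \<open>Kerr manifolds in a trivialising chart\<close>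

locale trivialising_chart =
  fixes K :: "('n::{t2_space,second_countable_topology}, 'e::euclidean_space,
               's::{t2_space,second_countable_topology}) kerr"
    and c :: "('n, 'e) chart" and \<tau> :: "'s \<Rightarrow> real"
  assumes kerr: "kerr_manifold K"
    and c: "c \<in> base K"
    and triv: "({s \<in> carrier (total K). proj K s \<in> cdom c}, \<lambda>s. (cmap c (proj K s), \<tau> s)) \<in> total K"
    and triv_image: "(\<lambda>s. (cmap c (proj K s), \<tau> s)) ` {s \<in> carrier (total K). proj K s \<in> cdom c} = cran c \<times> UNIV"
    and equivariant: "\<And>s a. s \<in> carrier (total K) \<Longrightarrow> proj K s \<in> cdom c \<Longrightarrow> \<tau> (act K s a) = \<tau> s + a"
begin

definition cS where "cS = ({s \<in> carrier (total K). proj K s \<in> cdom c}, \<lambda>s. (cmap c (proj K s), \<tau> s))"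

definition cM where "cM = prod_chart (factor K) cS"

lemma base_atlas: "atlas (base K)" "max_atlas (base K) = base K"
  and total_atlas: "atlas (total K)" "max_atlas (total K) = total K"
  using kerr by (auto simp: kerr_manifold_def principal_bundle_def smooth_manifold_def)

lemma open_factor: "open (factor K)"
  using kerr by (simp add: kerr_manifold_def)

lemma prod_atlas: "atlas (prod_chart (factor K) ` total K)"
  by (rule atlas_prod_chart[OF total_atlas(1) open_factor])

lemma cS: "cS \<in> total K"
  using triv by (simp add: cS_def)

lemma cM: "cM \<in> prod_chart (factor K) ` total K"
  using cS by (simp add: cM_def)

lemma cM_in_kerr_space: "cM \<in> kerr_space K"
  using cM atlas_subset_max_atlas[OF prod_atlas] by (auto simp: kerr_space_eq)

lemma chart_c: "is_chart c" and chart_cS: "is_chart cS" and chart_cM: "is_chart cM"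
  using c cS cM base_atlas(1) total_atlas(1) prod_atlas by (auto simp: atlas_def)

lemma cdom_cS: "s \<in> cdom cS \<longleftrightarrow> s \<in> carrier (total K) \<and> proj K s \<in> cdom c"
  by (simp add: cS_def)

lemma cmap_cS: "cmap cS s = (cmap c (proj K s), \<tau> s)"
  by (simp add: cS_def)

lemma cran_cS: "cran cS = cran c \<times> UNIV"
  using triv_image by (simp add: cS_def)

lemma cM_simps: "cdom cM = cdom cS \<times> factor K" "cmap cM (s, u) = (cmap cS s, u)"
  "cran cM = (cran c \<times> UNIV) \<times> factor K"
  unfolding cM_def cran_cS[symmetric] by (simp_all only: prod_chart_simps)

lemma act_cS: "s \<in> cdom cS \<Longrightarrow> act K s a \<in> cdom cS" "s \<in> cdom cS \<Longrightarrow> cmap cS (act K s a) = cmap cS s + (0, a)"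
  "s \<in> cdom cS \<Longrightarrow> act K s 0 = s"
  using kerr by (auto simp: cdom_cS cmap_cS kerr_manifold_def principal_bundle_def equivariant)

abbreviation vN where "vN s \<equiv> coord_vec (base K) c (proj K s)"
abbreviation vS where "vS s \<equiv> coord_vec (total K) cS s"
abbreviation vM where "vM m \<equiv> coord_vec (kerr_space K) cM m"

lemma push_proj:
  assumes "s \<in> cdom cS"
  shows "push (base K) (proj K) s (vS s v) = vN s (fst v)"
  by (rule push_coord_vec_affine[OF total_atlas(1) cS assms base_atlas(1) c, of "proj K" fst 0,
        unfolded base_atlas total_atlas])
     (auto simp: cdom_cS cmap_cS linear_iff)

lemma push_proj_fst:
  assumes "s \<in> cdom cS" "u \<in> factor K"
  shows "push (base K) (proj K \<circ> fst) (s, u) (vM (s, u) v) = vN s (fst (fst v))"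
proof -
  have "(s, u) \<in> cdom cM" using assms by (simp add: cM_simps)
  from push_coord_vec_affine[OF prod_atlas cM this base_atlas(1) c, of "proj K \<circ> fst" "\<lambda>v. fst (fst v)" 0 v,
      unfolded base_atlas kerr_space_eq[symmetric]]
  moreover have "(proj K \<circ> fst) ` cdom cM \<subseteq> cdom c" by (auto simp: cM_simps cdom_cS)
  moreover have "linear (\<lambda>v :: ('e \<times> real) \<times> real. fst (fst v))" by (simp add: linear_iff)
  moreover have "cmap c ((proj K \<circ> fst) q) = fst (fst (cmap cM q)) + 0" if "q \<in> cdom cM" for q
    by (cases q) (simp add: cM_simps(2) cmap_cS)
  ultimately show ?thesis by (simp only: o_apply fst_conv simp_thms)
qed

lemma push_fst:
  assumes "s \<in> cdom cS" "u \<in> factor K"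
  shows "push (total K) fst (s, u) (vM (s, u) v) = vS s (fst v)"
proof -
  have "(s, u) \<in> cdom cM" using assms by (simp add: cM_simps)
  from push_coord_vec_affine[OF prod_atlas cM this total_atlas(1) cS, of fst fst 0 v,
      unfolded total_atlas kerr_space_eq[symmetric]]
  show ?thesis by (auto simp: cM_simps linear_iff)
qed

lemma push_section:
  assumes "s \<in> cdom cS" "u \<in> factor K"
  shows "push (kerr_space K) (\<lambda>s. (s, u)) s (vS s v) = vM (s, u) (v, 0)"
proof -
  from push_coord_vec_affine[OF total_atlas(1) cS assms(1) prod_atlas cM, of "\<lambda>s. (s, u)" "\<lambda>v. (v, 0)" "(0, u)" v,
      unfolded total_atlas kerr_space_eq[symmetric]]
  show ?thesis using assms(2) by (auto simp: cM_simps linear_iff)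
qed

lemma push_act:
  assumes "s \<in> cdom cS"
  shows "push (total K) (\<lambda>s. act K s a) s (vS s v) = vS (act K s a) v"
proof -
  from push_coord_vec_affine[OF total_atlas(1) cS assms total_atlas(1) cS, of "\<lambda>s. act K s a" "\<lambda>v. v" "(0, a)" v,
      unfolded total_atlas]
  moreover have "(\<lambda>s. act K s a) ` cdom cS \<subseteq> cdom cS" using act_cS(1) by blast
  ultimately show ?thesis by (simp add: act_cS linear_iff)
qed

lemma fundamental_coord:
  assumes s: "s \<in> cdom cS"
  shows "fundamental K s = vS s (0, 1)"
proof -
  have "((\<lambda>t. cmap cS s + (0, t)) has_derivative (\<lambda>h. h *\<^sub>R (0, 1))) (at 0)"
    by (auto intro!: derivative_eq_intros)
  from velocity_coord_vec[OF total_atlas(1) cS open_UNIV UNIV_I,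
      where \<gamma> = "\<lambda>t. act K s t" and t = 0 and v = "(0, 1)", unfolded total_atlas] this
  show ?thesis by (simp add: fundamental_def act_cS s)
qed

lemma p_o_coord:
  assumes "s \<in> cdom cS" "u \<in> factor K"
  shows "p_o K (s, u) = vM (s, u) ((0, 0), 1)"
proof -
  have "((\<lambda>t. (cmap cS s, t)) has_derivative (\<lambda>h. h *\<^sub>R ((0, 0), 1))) (at u)"
    by (auto intro!: derivative_eq_intros simp: zero_prod_def)
  from velocity_coord_vec[OF prod_atlas cM open_factor assms(2),
      where \<gamma> = "\<lambda>t. (s, t)" and v = "((0, 0), 1)", folded kerr_space_eq] this
  show ?thesis using assms by (simp add: p_o_def cM_simps)
qed

lemma q_o_coord:
  assumes "s \<in> cdom cS" "u \<in> factor K"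
  shows "q_o K (s, u) = vM (s, u) ((0, 1), 0)"
  using push_section[OF assms] fundamental_coord[OF assms(1)] by (simp add: q_o_def)

text \<open>
  The connection form is invariant along the fibres, so its components at height \<open>0\<close> determine it.
\<close>

definition A :: "'e \<Rightarrow> 'e \<Rightarrow> real" where
  "A x v = comp1 (total K) cS (conn K) (x, 0) (v, 0)"

text \<open>
  In the trivialisation, \<open>\<theta> = ds + A\<close>: the coefficient of \<open>ds\<close> is \<open>1\<close> because the fundamental field is \<open>\<partial>\<^sub>s\<close>, and
  the action by \<open>- \<tau> s\<close> transports the other coefficients to height \<open>0\<close>.
\<close>

lemma conn_coord:
  assumes s: "s \<in> cdom cS"
  shows "conn K s (vS s v) = A (cmap c (proj K s)) (fst v) + snd v"
proof -
  have lin: "linear (\<lambda>v. conn K s (vS s v))" if "s \<in> cdom cS" for s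
  proof -
    have "linear (comp1 (total K) cS (conn K) (cmap cS s))"
      using kerr cS that unfolding kerr_manifold_def connection_form_def one_form_def by blast
    then show ?thesis by (simp add: comp1_def[abs_def] is_chartD(5)[OF chart_cS that])
  qed
  define s0 where "s0 = act K s (- \<tau> s)"
  have s0: "s0 \<in> cdom cS" "cmap cS s0 = (cmap c (proj K s), 0)"
    using act_cS[OF s] by (auto simp: s0_def cmap_cS)
  have "vS s v \<in> tangent_space (total K) s" for v
    using cS s unfolding tangent_space_def by blast
  then have "conn K (act K s (- \<tau> s)) (push (total K) (\<lambda>s'. act K s' (- \<tau> s)) s (vS s v)) = conn K s (vS s v)" for v
    using kerr s unfolding kerr_manifold_def connection_form_def cdom_cS by blast
  then have "conn K s0 (vS s0 v) = conn K s (vS s v)" for v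
    unfolding push_act[OF s] s0_def .
  then have 1: "conn K s (vS s (w, 0)) = A (cmap c (proj K s)) w" for w
    using is_chartD(5)[OF chart_cS s0(1)] s0(2) by (simp add: A_def comp1_def)
  have "conn K s (vS s v) = conn K s (vS s ((fst v, 0) + snd v *\<^sub>R (0, 1)))"
    by (cases v) simp
  also have "\<dots> = conn K s (vS s (fst v, 0)) + snd v * conn K s (vS s (0, 1))"
    by (simp only: linear_add[OF lin[OF s]] linear_scale[OF lin[OF s]] real_scaleR_def)
  also have "conn K s (vS s (0, 1)) = 1"
    using kerr s by (simp add: fundamental_coord[OF s, symmetric] kerr_manifold_def connection_form_def cdom_cS)
  finally show ?thesis by (simp add: 1)
qed

lemma vartheta_coord:
  assumes "s \<in> cdom cS" "u \<in> factor K"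
  shows "vartheta K (s, u) (vM (s, u) v) = A (cmap c (proj K s)) (fst (fst v)) + snd (fst v)"
  by (simp add: vartheta_def push_fst[OF assms] conn_coord[OF assms(1)])

lemma horizontal_coord:
  assumes "s \<in> cdom cS" "u \<in> factor K"
  shows "horizontal K (s, u) = {vM (s, u) (v, 0) | v. A (cmap c (proj K s)) (fst v) + snd v = 0}"
  unfolding horizontal_def
  using tangent_space_eq_range[OF total_atlas cS assms(1)] push_section[OF assms]
  by (force simp: conn_coord[OF assms(1)] image_iff)

lemma vM_add: "m \<in> cdom cM \<Longrightarrow> vM m (v + w) = (\<lambda>\<phi>. vM m v \<phi> + vM m w \<phi>)"
  and vM_scaleR: "m \<in> cdom cM \<Longrightarrow> vM m (r *\<^sub>R v) = (\<lambda>\<phi>. r * vM m v \<phi>)"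
  using coord_vec_add[OF prod_atlas cM] coord_vec_scaleR[OF prod_atlas cM] by (auto simp: kerr_space_eq)

lemma vM_eq_iff: "m \<in> cdom cM \<Longrightarrow> vM m v = vM m w \<longleftrightarrow> v = w"
  using coord_vec_eq_iff[OF prod_atlas cM] by (simp add: kerr_space_eq)

text \<open>
  As \<open>\<H>\<close> and \<open>\<q>\<^sub>o\<close> are tangent to the levels of the coordinate \<open>u\<close>, the form \<open>\<p>\<^sub>o\<^sup>*\<close> is \<open>du\<close>.
\<close>

lemma p_o_dual_coord:
  assumes su: "s \<in> cdom cS" "u \<in> factor K"
  shows "p_o_dual K (s, u) (vM (s, u) v) = snd v"
proof -
  have m: "(s, u) \<in> cdom cM" using su by (simp add: cM_simps)
  have combine: "(\<lambda>\<phi>. vM (s, u) (z, 0) \<phi> + b * p_o K (s, u) \<phi> + a * q_o K (s, u) \<phi>) = vM (s, u) (z + (0, a), b)" for z a b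
  proof -
    have "(z + (0, a), b) = (z, 0) + b *\<^sub>R ((0, 0), 1) + a *\<^sub>R ((0, 1), 0)"
      by (simp add: zero_prod_def[symmetric])
    then show ?thesis
      by (simp only: vM_add[OF m] vM_scaleR[OF m] p_o_coord[OF su] q_o_coord[OF su])
  qed
  show ?thesis
    unfolding p_o_dual_def
  proof (rule the_equality)
    define z where "z = (fst (fst v), - A (cmap c (proj K s)) (fst (fst v)))"
    define a where "a = snd (fst v) - snd z"
    have "vM (s, u) (z, 0) \<in> horizontal K (s, u)"
      unfolding horizontal_coord[OF su] by (intro CollectI exI[of _ z]) (simp add: z_def)
    moreover have "vM (s, u) v = (\<lambda>\<phi>. vM (s, u) (z, 0) \<phi> + snd v * p_o K (s, u) \<phi> + a * q_o K (s, u) \<phi>)"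
      unfolding combine by (intro arg_cong[of _ _ "vM (s, u)"]) (auto simp: z_def a_def prod_eq_iff)
    ultimately show "\<exists>Y\<in>horizontal K (s, u). \<exists>a. vM (s, u) v = (\<lambda>\<phi>. Y \<phi> + snd v * p_o K (s, u) \<phi> + a * q_o K (s, u) \<phi>)"
      by blast
  next
    fix b assume "\<exists>Y\<in>horizontal K (s, u). \<exists>a. vM (s, u) v = (\<lambda>\<phi>. Y \<phi> + b * p_o K (s, u) \<phi> + a * q_o K (s, u) \<phi>)"
    then obtain z a where "vM (s, u) v = vM (s, u) (z + (0, a), b)"
      unfolding horizontal_coord[OF su] using combine by auto
    then show "b = snd v" unfolding vM_eq_iff[OF m] by simp
  qed
qed

definition k :: "'e \<Rightarrow> 'e \<Rightarrow> 'e \<Rightarrow> real" where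
  "k = comp2 (base K) c (base_metric K)"

lemma proj_eq: "s \<in> cdom cS \<Longrightarrow> cinv c (cmap c (proj K s)) = proj K s"
  by (simp add: is_chartD(5)[OF chart_c] cdom_cS)

lemma pullback_metric_coord:
  assumes "s \<in> cdom cS" "u \<in> factor K"
  shows "pullback_metric K (s, u) (vM (s, u) v) (vM (s, u) w) = k (cmap c (proj K s)) (fst (fst v)) (fst (fst w))"
  by (simp add: pullback_metric_def push_proj_fst[OF assms] k_def comp2_def proj_eq[OF assms(1)])

lemma W_o_coord:
  assumes su: "s \<in> cdom cS" "u \<in> factor K" and v: "A (cmap c (proj K s)) (fst (fst v)) + snd (fst v) = 0"
  shows "vM (s, u) v \<in> W_o K (s, u)"
proof -
  have m: "(s, u) \<in> cdom cM" using su by (simp add: cM_simps)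
  have "v = (fst v, 0) + snd v *\<^sub>R ((0, 0), 1)"
    by (cases v) (simp add: zero_prod_def[symmetric])
  then have "vM (s, u) v = (\<lambda>\<phi>. vM (s, u) (fst v, 0) \<phi> + snd v * p_o K (s, u) \<phi>)"
    using vM_add[OF m, of "(fst v, 0)" "snd v *\<^sub>R ((0, 0), 1)"] unfolding vM_scaleR[OF m] p_o_coord[OF su] by simp
  moreover have "vM (s, u) (fst v, 0) \<in> horizontal K (s, u)"
    using v unfolding horizontal_coord[OF su] by (intro CollectI exI[of _ "fst v"]) simp
  ultimately show ?thesis unfolding W_o_def by blast
qed

lemma W_o_coord_exists:
  assumes su: "s \<in> cdom cS" "u \<in> factor K" and X: "X \<in> W_o K (s, u)"
  obtains v where "X = vM (s, u) v"
proof -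
  have m: "(s, u) \<in> cdom cM" using su by (simp add: cM_simps)
  obtain w b where "X = (\<lambda>\<phi>. vM (s, u) w \<phi> + b * vM (s, u) ((0, 0), 1) \<phi>)"
    using X unfolding W_o_def horizontal_coord[OF su] p_o_coord[OF su] by blast
  then have "X = vM (s, u) (w + b *\<^sub>R ((0, 0), 1))"
    by (simp only: vM_add[OF m] vM_scaleR[OF m])
  with that show thesis by blast
qed

definition J :: "'e \<Rightarrow> 'e \<Rightarrow> 'e" where
  "J x v = components (base K) c (cinv c x) (cplx K (cinv c x) (coord_vec (base K) c (cinv c x) v))"

lemma J:
  assumes "x \<in> cran c"
  shows "cplx K (cinv c x) (coord_vec (base K) c (cinv c x) v) = coord_vec (base K) c (cinv c x) (J x v)"
    and "linear (J x)" and "J x (J x v) = - v" and "(\<lambda>x. J x v) differentiable (at x)"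
proof -
  have "complex_structure (base K) (cplx K)"
    using kerr by (simp add: kerr_manifold_def kaehler_manifold_def)
  note J = complex_structure_in_chart[OF base_atlas this c assms J_def]
  show "cplx K (cinv c x) (coord_vec (base K) c (cinv c x) v) = coord_vec (base K) c (cinv c x) (J x v)"
    "linear (J x)" "J x (J x v) = - v" "(\<lambda>x. J x v) differentiable (at x)"
    by (fact J)+
qed

lemma A_linear: "x \<in> cran c \<Longrightarrow> linear (A x)"
proof -
  assume "x \<in> cran c"
  then have "(x, 0) \<in> cran cS" by (simp add: cran_cS)
  then have "linear (comp1 (total K) cS (conn K) (x, 0))"
    using kerr cS unfolding kerr_manifold_def connection_form_def one_form_def by blast
  from linear_compose[OF _ this, of "\<lambda>v. (v, 0)"] show ?thesis
    by (simp add: o_def A_def[abs_def] linear_iff)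
qed

lemma A_smooth: "smooth_on (cran c) (\<lambda>x. A x v)"
proof -
  have 1: "smooth_on (cran cS) (\<lambda>y. comp1 (total K) cS (conn K) y (v, 0))"
    using kerr cS unfolding kerr_manifold_def connection_form_def one_form_def by blast
  have 2: "smooth_on (cran c) (\<lambda>x. (x, 0))"
    by (rule smooth_on_linear[OF is_chartD(2)[OF chart_c]]) (simp add: linear_iff)
  show ?thesis
    unfolding A_def
    by (rule smooth_on_compose[OF is_chartD(2)[OF chart_c] is_chartD(2)[OF chart_cS] _ 2 1]) (auto simp: cran_cS)
qed

text \<open>
  The curvature condition \<open>d\<theta> = \<pi>\<^sup>* \<omega>\<^sub>o\<close>, evaluated on vectors tangent to the section of height \<open>0\<close>, to which
  \<open>\<theta>\<close> restricts as \<open>A\<close>.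
\<close>

lemma dA:
  assumes x: "x \<in> cran c"
  shows "dird (\<lambda>x. A x w) x v - dird (\<lambda>x. A x v) x w = k x (J x v) w"
proof -
  have y: "(x, 0) \<in> cran cS" using x by (simp add: cran_cS)
  define s where "s = cinv cS (x, 0)"
  have s: "s \<in> cdom cS" "cmap cS s = (x, 0)"
    using is_chartD(6,7)[OF chart_cS y] by (auto simp: s_def)
  then have ps: "proj K s = cinv c x" using proj_eq[OF s(1)] by (simp add: cmap_cS)
  have D: "dird (\<lambda>y. comp1 (total K) cS (conn K) y (w, 0)) (x, 0) (v, 0) = dird (\<lambda>x. A x w) x v" for v w
  proof -
    have fst: "((\<lambda>y. A (fst y) w) has_derivative (\<lambda>u. dird (\<lambda>x. A x w) x (fst u))) (at (x, 0::real))"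
      using has_derivative_compose[OF bounded_linear_imp_has_derivative[OF bounded_linear_fst],
          of "\<lambda>x. A x w" _ "(x, 0::real)"] has_derivative_dird[OF smooth_on_differentiable[OF A_smooth x]] by simp
    have eq: "A (fst y) w = comp1 (total K) cS (conn K) y (w, 0)" if "y \<in> cran cS" for y
    proof -
      have "cinv cS y \<in> cdom cS" "cmap cS (cinv cS y) = y"
        using is_chartD(6,7)[OF chart_cS that] by auto
      then show ?thesis
        using conn_coord[of "cinv cS y" "(w, 0)"] by (cases y) (auto simp: comp1_def cmap_cS)
    qed
    from has_derivative_transform_within_open[OF fst is_chartD(2)[OF chart_cS] y eq]
    show ?thesis by (simp add: dird_eq)
  qed
  have "d1 (total K) cS (conn K) (cmap cS s) (v, 0) (w, 0) =
        kaehler_form (cplx K) (base_metric K) (proj K s) (vN s v) (vN s w)"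
    using kerr cS s(1) push_proj[OF s(1)] unfolding kerr_manifold_def curvature_condition_def by force
  then show ?thesis
    unfolding s(2) d1_def D by (simp add: kaehler_form_def ps J(1)[OF x] k_def comp2_def)
qed

lemma k_props:
  assumes x: "x \<in> cran c"
  shows "bilinear (k x)" "k x v w = k x w v" "v \<noteq> 0 \<Longrightarrow> k x v v > 0"
    "smooth_on (cran c) (\<lambda>x. k x v w)" "k x (J x v) (J x w) = k x v w"
proof -
  have r: "riemannian_metric (base K) (base_metric K)"
    using kerr by (simp add: kerr_manifold_def kaehler_manifold_def)
  then show "bilinear (k x)" "k x v w = k x w v" "v \<noteq> 0 \<Longrightarrow> k x v v > 0"
    "smooth_on (cran c) (\<lambda>x. k x v w)"
    using c x unfolding riemannian_metric_def symmetric_tensor_def k_def by blast+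
  have p: "cinv c x \<in> cdom c" by (rule is_chartD(7)[OF chart_c x])
  then have "coord_vec (base K) c (cinv c x) v \<in> tangent_space (base K) (cinv c x)" for v
    using c unfolding tangent_space_def by blast
  moreover have "cinv c x \<in> carrier (base K)" using c p by (auto simp: carrier_def)
  ultimately have "base_metric K (cinv c x) (cplx K (cinv c x) (coord_vec (base K) c (cinv c x) v))
     (cplx K (cinv c x) (coord_vec (base K) c (cinv c x) w)) =
     base_metric K (cinv c x) (coord_vec (base K) c (cinv c x) v) (coord_vec (base K) c (cinv c x) w)"
    using kerr unfolding kerr_manifold_def kaehler_manifold_def by blast
  then show "k x (J x v) (J x w) = k x v w"
    by (simp add: J(1)[OF x] k_def comp2_def)
qed

lemma carrier_cM: "m \<in> cdom cM \<Longrightarrow> m \<in> carrier (kerr_space K)"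
  using cM_in_kerr_space unfolding carrier_def by blast

lemma vM_tangent: "m \<in> cdom cM \<Longrightarrow> vM m v \<in> tangent_space (kerr_space K) m"
  using cM_in_kerr_space unfolding tangent_space_def by blast

lemma cinv_cM:
  assumes "y \<in> cran cM"
  obtains s u where "cinv cM y = (s, u)" "s \<in> cdom cS" "u \<in> factor K"
    "fst y = cmap cS s" "fst (fst y) = cmap c (proj K s)" "u = snd y"
proof -
  obtain s u where su: "cinv cM y = (s, u)" by (cases "cinv cM y")
  have "(s, u) \<in> cdom cM" "cmap cM (s, u) = y"
    using is_chartD(6,7)[OF chart_cM assms] by (simp_all add: su)
  then show thesis
    using that[OF su] by (auto simp: cM_simps cmap_cS)
qed

text \<open>
  Being in \<open>W\<^sub>o\<close> and projected to \<open>0\<close> in \<open>N\<close>, \<open>\<p>\<^sub>o\<close> is orthogonal to \<open>W\<^sub>o\<close> for every compatible metric.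
\<close>

lemma einstein_imp_ricci_p_o:
  assumes su: "s \<in> cdom cS" "u \<in> factor K" and d: "d \<in> kerr_space K" "(s, u) \<in> cdom d"
    and g: "compatible_metric K g" "einstein (kerr_space K) g" and X: "X \<in> W_o K (s, u)"
  shows "ricci (kerr_space K) d g (s, u) (p_o K (s, u)) X = 0"
proof -
  have m: "(s, u) \<in> cdom cM" using su by (simp add: cM_simps)
  obtain v where v: "X = vM (s, u) v" using W_o_coord_exists[OF su X] .
  have x: "cmap c (proj K s) \<in> cran c" using su(1) by (simp add: cdom_cS)
  have p: "p_o K (s, u) \<in> W_o K (s, u)"
    unfolding p_o_coord[OF su] using linear_0[OF A_linear[OF x]] by (intro W_o_coord[OF su]) simp
  obtain \<sigma> where "g (s, u) (p_o K (s, u)) X = \<sigma> * pullback_metric K (s, u) (p_o K (s, u)) X"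
    using g(1) carrier_cM[OF m] p X unfolding compatible_metric_def by blast
  also have "pullback_metric K (s, u) (p_o K (s, u)) X = 0"
    using bilinear_lzero[OF k_props(1)[OF x]] by (simp add: p_o_coord[OF su] v pullback_metric_coord[OF su])
  finally have "g (s, u) (p_o K (s, u)) X = 0" by simp
  moreover have "p_o K (s, u) \<in> tangent_space (kerr_space K) (s, u)" "X \<in> tangent_space (kerr_space K) (s, u)"
    unfolding p_o_coord[OF su] v by (rule vM_tangent[OF m])+
  ultimately show ?thesis
    using g(2) d unfolding einstein_def by force
qed

text \<open>
  The components of \<open>g\<close> in the chart \<open>cM\<close> are of the form treated in \<open>kerr_coordinates\<close>, and the two summands
  of \<open>T\<close> become \<open>q\<close> and \<open>p\<close>.
\<close>

lemma no_special_metric: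
  assumes ne: "cdom c \<noteq> {}" and dim: "DIM('e) \<ge> 3"
    and special: "special_form K g" and ricci: "ricci_condition K g"
  shows False
proof -
  obtain \<sigma> \<beta> B where smooth: "smooth_fun (kerr_space K) \<sigma>" "smooth_fun (kerr_space K) \<beta>"
    and nz: "\<And>m. m \<in> carrier (kerr_space K) \<Longrightarrow> \<sigma> m \<noteq> 0"
    and g: "\<And>m X Y. m \<in> carrier (kerr_space K) \<Longrightarrow> X \<in> tangent_space (kerr_space K) m \<Longrightarrow>
        Y \<in> tangent_space (kerr_space K) m \<Longrightarrow> g m X Y = \<sigma> m * pullback_metric K m X Y
             + (vartheta K \<or>\<^sub>s (\<lambda>m X. p_o_dual K m X + \<beta> m / 2 * vartheta K m X)) m X Y"
    and B: "B \<noteq> 0" and T: "\<And>m. m \<in> carrier (kerr_space K) \<Longrightarrow> q_o K m \<sigma> - B * p_o K m \<sigma> = 0"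
    using special unfolding special_form_def Let_def by blast
  have s\<sigma>: "smooth_on (cran cM) (\<sigma> \<circ> cinv cM)" "smooth_on (cran cM) (\<beta> \<circ> cinv cM)"
    using smooth cM_in_kerr_space unfolding smooth_fun_def by blast+
  have C2: "Ck_on (Suc (Suc 0)) S f" if "smooth_on S f" for S and f :: "'x::euclidean_space \<Rightarrow> 'y::euclidean_space"
    using that unfolding smooth_on_def by blast
  interpret kc: kerr_coordinates "cran c" "factor K" k A J "\<sigma> \<circ> cinv cM" "\<beta> \<circ> cinv cM" "comp2 (kerr_space K) cM g"
  proof
    show "open (cran c)" by (rule is_chartD(2)[OF chart_c])
    show "open (factor K)" by (rule open_factor)
    show "Ck_on (Suc (Suc 0)) ((cran c \<times> UNIV) \<times> factor K) (\<sigma> \<circ> cinv cM)"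
      "Ck_on (Suc (Suc 0)) ((cran c \<times> UNIV) \<times> factor K) (\<beta> \<circ> cinv cM)"
      by (fact C2[OF s\<sigma>(1)[unfolded cM_simps(3)]] C2[OF s\<sigma>(2)[unfolded cM_simps(3)]])+
    fix v w
    show "Ck_on (Suc (Suc 0)) (cran c) (\<lambda>x. A x v)" by (rule C2[OF A_smooth])
    obtain x0 where "x0 \<in> cran c" using ne by blast
    from k_props(4)[OF this] show "Ck_on (Suc (Suc 0)) (cran c) (\<lambda>x. k x v w)" by (rule C2)
  next
    fix y assume "y \<in> (cran c \<times> (UNIV :: real set)) \<times> factor K"
    then have y: "y \<in> cran cM" unfolding cM_simps(3) .
    obtain s u where su: "cinv cM y = (s, u)" "s \<in> cdom cS" "u \<in> factor K" "fst (fst y) = cmap c (proj K s)"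
      using cinv_cM[OF y] by metis
    have m: "(s, u) \<in> cdom cM" using su by (simp add: cM_simps)
    show "(\<sigma> \<circ> cinv cM) y \<noteq> 0" using nz[OF carrier_cM[OF m]] su(1) by simp
    fix v w
    show "comp2 (kerr_space K) cM g y v w =
        (\<sigma> \<circ> cinv cM) y * k (fst (fst y)) (fst (fst v)) (fst (fst w))
        + (1/2) * ((A (fst (fst y)) (fst (fst v)) + snd (fst v))
             * (snd w + (\<beta> \<circ> cinv cM) y / 2 * (A (fst (fst y)) (fst (fst w)) + snd (fst w)))
           + (snd v + (\<beta> \<circ> cinv cM) y / 2 * (A (fst (fst y)) (fst (fst v)) + snd (fst v)))
             * (A (fst (fst y)) (fst (fst w)) + snd (fst w)))"
      using g[OF carrier_cM[OF m] vM_tangent[OF m] vM_tangent[OF m]]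
      by (simp add: comp2_def su(1,4) sym_prod_def pullback_metric_coord[OF su(2,3)]
          vartheta_coord[OF su(2,3)] p_o_dual_coord[OF su(2,3)])
  qed (fact k_props J dA linear_add[OF A_linear] linear_scale[OF A_linear] linear_add[OF J(2)] linear_scale[OF J(2)])+
  show False
  proof (rule kc.no_ricci_condition[OF _ _ dim B])
    show "cran c \<noteq> {}" using ne by blast
    show "factor K \<noteq> {}" using kerr by (simp add: kerr_manifold_def)
    fix y assume "y \<in> kc.U"
    then have y: "y \<in> cran cM" unfolding cM_simps(3) kc.U_def .
    obtain s u where su: "cinv cM y = (s, u)" "s \<in> cdom cS" "u \<in> factor K" "fst (fst y) = cmap c (proj K s)"
      using cinv_cM[OF y] by metis
    have m: "(s, u) \<in> cdom cM" using su by (simp add: cM_simps)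
    have y_eq: "cmap cM (s, u) = y" using is_chartD(6)[OF chart_cM y] su(1) by simp
    have near: "smooth_near (kerr_space K) (s, u) \<sigma>"
      using s\<sigma>(1) cM_in_kerr_space m unfolding smooth_near_def by blast
    show "dird (\<sigma> \<circ> cinv cM) y kc.q = B * dird (\<sigma> \<circ> cinv cM) y kc.p"
      using T[OF carrier_cM[OF m]] near
      by (simp add: p_o_coord[OF su(2,3)] q_o_coord[OF su(2,3)] coord_vec_def y_eq kc.p_def kc.q_def)
    fix X assume "kc.\<theta> (fst (fst y)) X = 0"
    then have "vM (s, u) X \<in> W_o K (s, u)"
      by (intro W_o_coord[OF su(2,3)]) (simp add: kc.\<theta>_def su(4))
    then have "ricci (kerr_space K) cM g (s, u) (vM (s, u) kc.p) (vM (s, u) X) = 0"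
      using ricci cM_in_kerr_space m p_o_coord[OF su(2,3)] unfolding ricci_condition_def kc.p_def by metis
    then show "ricci_comp (comp2 (kerr_space K) cM g) y kc.p X = 0"
      using components_coord_vec[OF prod_atlas cM m]
      by (simp add: ricci_def y_eq kerr_space_eq)
  qed
qed

end

lemma trivialising_chart_exists:
  assumes "kerr_manifold K" "x \<in> carrier (base K)"
  obtains c \<tau> where "trivialising_chart K c \<tau>" "x \<in> cdom c"
proof -
  have "principal_bundle (base K) (total K) (proj K) (act K)"
    using assms(1) by (simp add: kerr_manifold_def)
  then obtain c \<tau> where "c \<in> base K" "x \<in> cdom c"
    "({s \<in> carrier (total K). proj K s \<in> cdom c}, \<lambda>s. (cmap c (proj K s), \<tau> s)) \<in> total K"
    "(\<lambda>s. (cmap c (proj K s), \<tau> s)) ` {s \<in> carrier (total K). proj K s \<in> cdom c} = cran c \<times> UNIV"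
    "\<forall>s\<in>{s \<in> carrier (total K). proj K s \<in> cdom c}. \<forall>a. \<tau> (act K s a) = \<tau> s + a"
    using assms(2) unfolding principal_bundle_def Let_def by blast
  with assms(1) have "trivialising_chart K c \<tau>"
    unfolding trivialising_chart_def by blast
  with that \<open>x \<in> cdom c\<close> show thesis by blast
qed

section \<open>Nonexistence of the metrics\<close>

lemma carrier_kerr_space:
  assumes "(s, u) \<in> carrier (kerr_space K)"
  shows "s \<in> carrier (total K)" "u \<in> factor K"
proof -
  have "carrier (max_atlas A) \<subseteq> carrier A" for A :: "('x::topological_space, 'y::euclidean_space) chart set"
    unfolding max_atlas_def carrier_def[of "Collect _"] by blast
  then have "(s, u) \<in> carrier (prod_chart (factor K) ` total K)"
    using assms unfolding kerr_space_eq by blast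
  then show "s \<in> carrier (total K)" "u \<in> factor K" by (auto simp: carrier_def)
qed

lemma einstein_imp_ricci_condition:
  assumes K: "kerr_manifold K" and g: "compatible_metric K g" "einstein (kerr_space K) g"
  shows "ricci_condition K g"
  unfolding ricci_condition_def
proof (intro ballI)
  fix d m X assume d: "d \<in> kerr_space K" "m \<in> cdom d" and X: "X \<in> W_o K m"
  obtain s u where m: "m = (s, u)" by (cases m)
  have "(s, u) \<in> carrier (kerr_space K)" using d m unfolding carrier_def by blast
  note su = carrier_kerr_space[OF this]
  have "proj K s \<in> carrier (base K)"
    using K su(1) unfolding kerr_manifold_def principal_bundle_def by blast
  then obtain c \<tau> where "trivialising_chart K c \<tau>" and s: "proj K s \<in> cdom c"
    using trivialising_chart_exists[OF K] by blast
  then interpret trivialising_chart K c \<tau> by simp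
  show "ricci (kerr_space K) d g m (p_o K m) X = 0"
    using einstein_imp_ricci_p_o[of s u d g X] su s d X g unfolding m cdom_cS by blast
qed

theorem theorem3p1:
  fixes K :: "('n::{t2_space,second_countable_topology}, 'e::euclidean_space,
               's::{t2_space,second_countable_topology}) kerr"
  assumes "kerr_manifold K"
    and "DIM(('e \<times> real) \<times> real) > 4"
  shows "(\<nexists>g. compatible_metric K g \<and> special_form K g \<and> ricci_condition K g) \<and>
         (\<nexists>g. compatible_metric K g \<and> special_form K g \<and> einstein (kerr_space K) g)"
proof -
  have dim: "DIM('e) \<ge> 3" using assms(2) by simp
  obtain x where "x \<in> carrier (base K)"
    using assms(1) unfolding kerr_manifold_def kaehler_manifold_def smooth_manifold_def by blast
  then obtain c \<tau> where "trivialising_chart K c \<tau>" and x: "x \<in> cdom c"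
    using trivialising_chart_exists[OF assms(1)] by blast
  then interpret trivialising_chart K c \<tau> by simp
  have "\<not> (special_form K g \<and> ricci_condition K g)" for g
    using no_special_metric[OF _ dim, of g] x by blast
  with einstein_imp_ricci_condition[OF assms(1)] show ?thesis by blast
qed

end
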